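(* Let $K$ be a totally real biquadratic field (i.e. $K=\mathbb{Q}(\sqrt{p},\sqrt{q})$ for distinct square-free integers $p,q>1$) such that $K$ contains none of $\sqrt{2}$, $\sqrt{3}$, $\sqrt{5}$. Then $\mathcal{P}(\mathcal{O}_K)\geq 6$, except possibly for $K=\mathbb{Q}(\sqrt{6},\sqrt{14})$.
   Context: For a commutative ring $R$, let $\sum R^2$ denote the set of finite sums of squares of elements of $R$. For $\alpha\in\sum R^2$, the length $\ell(\alpha)$ is the minimal number of squares of elements of $R$ whose sum is $\alpha$. The Pythagoras number is $\mathcal{P}(R)=\sup\{\ell(\alpha):\alpha\in\sum R^2\}$. $\mathcal{O}_K$ denotes the ring of integers of $K$. *)

theory Defs
  imports Complex_Main "HOL-Library.Extended_Nat"
    "HOL-Computational_Algebra.Computational_Algebra"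
begin

text \<open>Number fields are taken as subfields of the reals, and rings as subrings (given by their
  underlying sets) of an ambient commutative ring.\<close>

definition is_subfield :: "'a::field set \<Rightarrow> bool" where
  "is_subfield F \<longleftrightarrow> 0 \<in> F \<and> 1 \<in> F \<and>
     (\<forall>x\<in>F. \<forall>y\<in>F. x + y \<in> F \<and> x * y \<in> F) \<and>
     (\<forall>x\<in>F. - x \<in> F \<and> inverse x \<in> F)"

text \<open>Every subfield of the reals contains the rationals, so the following is the extension of the
  rationals generated by \<open>S\<close>.\<close>

definition rat_adjoin :: "real set \<Rightarrow> real set" where
  "rat_adjoin S = is_subfield hull S"

text \<open>For distinct square-free \<open>p, q > 1\<close> the degree over the rationals is automatically 4. Since a
  biquadratic field is normal, being contained in the reals makes it totally real.\<close>

definition totally_real_biquadratic :: "real set \<Rightarrow> bool" where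
  "totally_real_biquadratic K \<longleftrightarrow>
     (\<exists>p q :: int. p > 1 \<and> q > 1 \<and> p \<noteq> q \<and> squarefree p \<and> squarefree q \<and>
        K = rat_adjoin {sqrt (of_int p), sqrt (of_int q)})"

definition ring_of_integers :: "'a::field_char_0 set \<Rightarrow> 'a set" where
  "ring_of_integers K = {x \<in> K. algebraic_int x}"

definition is_sum_of_n_squares :: "'a::comm_ring_1 set \<Rightarrow> nat \<Rightarrow> 'a \<Rightarrow> bool" where
  "is_sum_of_n_squares R n a \<longleftrightarrow>
     (\<exists>x :: nat \<Rightarrow> 'a. (\<forall>i<n. x i \<in> R) \<and> a = (\<Sum>i<n. (x i)\<^sup>2))"

definition sums_of_squares :: "'a::comm_ring_1 set \<Rightarrow> 'a set" where
  "sums_of_squares R = {a. \<exists>n. is_sum_of_n_squares R n a}"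

text \<open>Only meaningful on \<open>sums_of_squares R\<close>.\<close>

definition sq_length :: "'a::comm_ring_1 set \<Rightarrow> 'a \<Rightarrow> nat" where
  "sq_length R a = (LEAST n. is_sum_of_n_squares R n a)"

definition pythagoras_number :: "'a::comm_ring_1 set \<Rightarrow> enat" where
  "pythagoras_number R = (SUP a \<in> sums_of_squares R. enat (sq_length R a))"

end

theory Submission
  imports Defs "Jordan_Normal_Form.Char_Poly"
begin

text \<open>For the three radicands \<open>p\<close>, \<open>q\<close>, \<open>r\<close> of \<open>K\<close> we choose, depending on their residues modulo 4, a
  sum \<open>\<alpha>\<close> of six squares of small integers of \<open>K\<close>. If \<open>\<alpha>\<close> were a sum of five squares, then comparing
  coefficients of \<open>1\<close>, \<open>sqrt q\<close>, \<open>sqrt p\<close>, \<open>sqrt r\<close> would give vectors \<open>a\<close>, \<open>b\<close>, \<open>c\<close>, \<open>d\<close> in dimension five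
  with prescribed relations between their inner products and with a prescribed value of
  \<open>a\<^sup>2 + q b\<^sup>2 + p c\<^sup>2 + r d\<^sup>2\<close>. Since \<open>p\<close>, \<open>q\<close>, \<open>r\<close> are not too small, \<open>b\<close>, \<open>c\<close>, \<open>d\<close> are forced to be
  shortest possible, and this determines the Gram matrix. It is typically equivalent to
  \<open>7 x\<^sup>2 + y\<^sup>2 + z\<^sup>2\<close>, which is not a sum of five squares of integral linear forms because 7 is not a
  sum of three squares.\<close>

section \<open>Short vectors in dimension five\<close>

text \<open>The number six comes from integral quadratic forms: 7 takes four squares, and two unit
  vectors beside it take two more coordinates. The form \<open>7 x^2 + y^2 + z^2\<close> is not the
  only obstruction used. The two others are a unit vector beside the binary form
  \<open>2 y^2 + 2 y z + 4 z^2\<close> of determinant 7, and a unit vector beside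
  \<open>2 y^2 + 14 z^2\<close>; neither binary form is a sum of four squares of integral linear
  forms.

  The obstacle is the denominators. Integers of the field may have halves or quarters as
  coordinates, so the coordinate vectors satisfy congruences instead of being arbitrary, and small
  radicands leave room for Gram matrices other than the intended one. Hence every congruence case
  has a general witness for large radicands and special ones for small or degenerate triples
  \<open>g\<close>, \<open>h\<close>, \<open>k\<close>; Gram matrices that survive the size
  comparison are removed by Cauchy-Schwarz, parity or divisibility. The triple 2, 7, 3 with
  radicands 6, 14, 21 is covered by none of the witnesses and is the exceptional field.\<close>

definition dot :: "(nat \<Rightarrow> int) \<Rightarrow> (nat \<Rightarrow> int) \<Rightarrow> int" where
  "dot a b = (\<Sum>i<5. a i * b i)"

lemma dot_commute: "dot a b = dot b a"
  by (simp add: dot_def mult.commute)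

lemma dot_add_right: "dot a (\<lambda>i. b i + c i) = dot a b + dot a c"
  by (simp add: dot_def distrib_left sum.distrib)

lemma dot_diff_right: "dot a (\<lambda>i. b i - c i) = dot a b - dot a c"
  by (simp add: dot_def right_diff_distrib sum_subtractf)

lemma dot_scale_right: "dot a (\<lambda>i. s * b i) = s * dot a b"
  by (simp add: dot_def sum_distrib_left mult_ac)

lemma dot_add_left: "dot (\<lambda>i. b i + c i) a = dot b a + dot c a"
  by (simp add: dot_def distrib_right sum.distrib)

lemma dot_diff_left: "dot (\<lambda>i. b i - c i) a = dot b a - dot c a"
  by (simp add: dot_def left_diff_distrib sum_subtractf)

lemma dot_scale_left: "dot (\<lambda>i. s * b i) a = s * dot b a"
  by (simp add: dot_def sum_distrib_left mult_ac)

lemmas dot_linear = dot_add_left dot_add_right dot_diff_left dot_diff_right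
  dot_scale_left dot_scale_right

lemma dot_cong: "(\<And>i. i < 5 \<Longrightarrow> a i = a' i) \<Longrightarrow> (\<And>i. i < 5 \<Longrightarrow> b i = b' i) \<Longrightarrow> dot a b = dot a' b'"
  by (simp add: dot_def)

lemma dot_self_nonneg: "dot a a \<ge> 0"
  by (simp add: dot_def sum_nonneg)

lemma dot_self_eq_0D: "dot a a = 0 \<Longrightarrow> i < 5 \<Longrightarrow> a i = 0"
  by (simp add: dot_def sum_nonneg_eq_0_iff)

lemma dot_zero:
  assumes "dot a a = 0"
  shows "dot a b = 0" "dot b a = 0"
  using dot_self_eq_0D[OF assms] by (simp_all add: dot_def)

lemma dot_Cauchy_Schwarz: "(dot a b)\<^sup>2 \<le> dot a a * dot b b"
proof -
  define x y z where "x = dot a a" and "y = dot b b" and "z = dot a b"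
  \<comment> \<open>Up to the factor \<open>y\<close>, this is the component of \<open>a\<close>
    orthogonal to \<open>b\<close>; the factor keeps it integral.\<close>
  define v where "v = (\<lambda>i. y * a i - z * b i)"
  have "dot v v = y * (x * y - z\<^sup>2)"
    unfolding v_def dot_linear x_def y_def z_def dot_commute[of b a]
    by (simp add: algebra_simps power2_eq_square)
  with dot_self_nonneg[of v] have nonneg: "y * (x * y - z\<^sup>2) \<ge> 0" by simp
  show ?thesis
  proof (cases "y = 0")
    case True
    then have "z = 0" using dot_zero[of b a] by (simp add: y_def z_def)
    with True show ?thesis by (simp add: x_def y_def z_def)
  next
    case False
    then have "y > 0" using dot_self_nonneg[of b] by (simp add: y_def)
    with nonneg have "x * y - z\<^sup>2 \<ge> 0" by (simp add: zero_le_mult_iff)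
    then show ?thesis by (simp add: x_def y_def z_def)
  qed
qed

lemma dot_abs_le:
  assumes "dot a a * dot b b \<le> n\<^sup>2" "n \<ge> 0"
  shows "\<bar>dot a b\<bar> \<le> n"
  using dot_Cauchy_Schwarz[of a b] assms by (metis abs_le_square_iff abs_of_nonneg order_trans)

text \<open>This is the equality case of Cauchy-Schwarz: \<open>c - d\<close> has norm 0. The
  conclusion is phrased with a further vector \<open>a\<close> because only the five entries are
  controlled, so the functions \<open>c\<close> and \<open>d\<close> need not be equal.\<close>

lemma dot_same:
  assumes "dot c c = dot c d" "dot d d = dot c d"
  shows "dot a d = dot a c"
proof -
  have "dot (\<lambda>i. c i - d i) (\<lambda>i. c i - d i) = 0"
    using assms by (simp add: dot_linear dot_commute[of d c])
  from dot_zero(2)[OF this, of a] show ?thesis by (simp add: dot_linear)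
qed

lemma dot_opp:
  assumes "dot c c = - dot c d" "dot d d = - dot c d"
  shows "dot a d = - dot a c"
proof -
  have "dot (\<lambda>i. c i + d i) (\<lambda>i. c i + d i) = 0"
    using assms by (simp add: dot_linear dot_commute[of d c])
  from dot_zero(2)[OF this, of a] show ?thesis by (simp add: dot_linear)
qed

lemma dot_even: "(\<And>i. i < 5 \<Longrightarrow> even (c i)) \<Longrightarrow> even (dot a c)"
  unfolding dot_def by (intro dvd_sum) simp

lemma dot_cong_mod2:
  assumes "\<And>i. i < 5 \<Longrightarrow> even (c i - d i)"
  shows "even (dot a c - dot a d)"
  using dot_even[of "\<lambda>i. c i - d i" a] assms by (simp add: dot_linear)

lemma dot_self_cong_mod4:
  assumes "\<And>i. i < 5 \<Longrightarrow> even (c i - d i)"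
  shows "4 dvd dot c c - dot d d"
proof -
  have "4 dvd c i * c i - d i * d i" if "i < 5" for i
  proof -
    obtain t where "c i - d i = 2 * t" using assms[OF \<open>i < 5\<close>] by (rule dvdE)
    then have "c i = d i + 2 * t" by simp
    then have "c i * c i - d i * d i = 4 * (t * d i + t * t)" by (simp add: algebra_simps)
    then show ?thesis by simp
  qed
  then have "4 dvd (\<Sum>i<5. c i * c i - d i * d i)" by (intro dvd_sum) auto
  then show ?thesis by (simp add: dot_def sum_subtractf)
qed

lemma dot_half:
  assumes "\<And>i. i < 5 \<Longrightarrow> even (c i)"
  obtains c' where "\<And>a. dot a c = 2 * dot a c'" "dot c c = 4 * dot c' c'" "\<And>i. i < 5 \<Longrightarrow> c i = 2 * c' i"
proof
  define c' where "c' = (\<lambda>i. c i div 2)"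
  have *: "\<And>i. i < 5 \<Longrightarrow> c i = 2 * c' i" using assms by (simp add: c'_def)
  then show "\<And>i. i < 5 \<Longrightarrow> c i = 2 * c' i" .
  show **: "\<And>a. dot a c = 2 * dot a c'" using * by (simp add: dot_def sum_distrib_left mult_ac)
  show "dot c c = 4 * dot c' c'" using **[of c] **[of c'] by (simp add: dot_commute)
qed

lemma dot_odd_ge_1:
  assumes "i < 5" "odd (c i)" shows "dot c c \<ge> 1"
  using dot_self_nonneg[of c] dot_self_eq_0D[of c i] assms by fastforce

lemma dot_split:
  assumes "i < 5"
  shows "dot a b = a i * b i + (\<Sum>j\<in>{..<5} - {i}. a j * b j)"
  using assms by (simp add: dot_def sum.remove[of "{..<5}" i])

lemma dot_split2:
  assumes "i < 5" "j < 5" "i \<noteq> j"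
  shows "dot a b = a i * b i + a j * b j + (\<Sum>l\<in>{..<5} - {i, j}. a l * b l)"
proof -
  have "(\<Sum>l\<in>{..<5} - {i}. a l * b l) = a j * b j + (\<Sum>l\<in>{..<5} - {i} - {j}. a l * b l)"
    using assms by (subst sum.remove[of _ j]) auto
  moreover have "{..<5} - {i} - {j} = {..<5} - {i, j}" by auto
  ultimately show ?thesis using dot_split[OF assms(1)] by simp
qed

text \<open>An integral vector of norm 1 is a signed coordinate vector; \<open>i\<close> is its
  position and \<open>s\<close> its sign.\<close>

lemma dot_norm1:
  assumes "dot e e = 1"
  obtains i s where "i < 5" "s * s = 1" "\<And>a. dot a e = s * a i" "e i = s"
proof -
  have "\<exists>i<5. e i \<noteq> 0"
  proof (rule ccontr)
    assume "\<not> ?thesis"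
    then have "dot e e = 0" by (auto simp: dot_def)
    with assms show False by simp
  qed
  then obtain i where i: "i < 5" "e i \<noteq> 0" by blast
  let ?S = "\<Sum>j\<in>{..<5} - {i}. e j * e j"
  have S: "?S \<ge> 0" by (simp add: sum_nonneg)
  have "e i * e i \<ge> 1" using i(2) by (metis int_one_le_iff_zero_less not_square_less_zero linorder_neqE mult_eq_0_iff)
  with S dot_split[OF i(1), of e e] assms have *: "e i * e i = 1" "?S = 0" by linarith+
  then have "e j = 0" if "j < 5" "j \<noteq> i" for j
    using that by (simp add: sum_nonneg_eq_0_iff)
  then have "dot a e = e i * a i" for a
    using dot_split[OF i(1), of a e] by (simp add: mult.commute)
  with i * that show ?thesis by blast
qed

text \<open>Some entry is 1 or -1, and deleting it leaves a vector of norm 1, so the vector is a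
  signed sum of two coordinate vectors (a root).\<close>

lemma dot_norm2:
  assumes "dot e e = 2"
  obtains i j s t where "i < 5" "j < 5" "i \<noteq> j" "s * s = 1" "t * t = 1"
    "\<And>a. dot a e = s * a i + t * a j" "e i = s" "e j = t"
proof -
  have "\<exists>i<5. e i \<noteq> 0"
  proof (rule ccontr)
    assume "\<not> ?thesis"
    then have "dot e e = 0" by (auto simp: dot_def)
    with assms show False by simp
  qed
  then obtain i where i: "i < 5" "e i \<noteq> 0" by blast
  let ?S = "\<Sum>j\<in>{..<5} - {i}. e j * e j"
  have S: "?S \<ge> 0" by (simp add: sum_nonneg)
  have ge: "e i * e i \<ge> 1" using i(2) by (metis int_one_le_iff_zero_less not_square_less_zero linorder_neqE mult_eq_0_iff)
  have le: "e i * e i \<le> 2" using S dot_split[OF i(1), of e e] assms by linarith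
  have "\<bar>e i\<bar> < 2"
  proof (rule ccontr)
    assume "\<not> ?thesis"
    then have "2 * 2 \<le> \<bar>e i\<bar> * \<bar>e i\<bar>" by (intro mult_mono) auto
    with le show False by simp
  qed
  then have "\<bar>e i\<bar> = 1" using i(2) by linarith
  then have ei: "e i * e i = 1" by (metis abs_mult_self_eq mult_1)
  define f where "f = e(i := 0)"
  have "dot f f = ?S" using i(1) by (subst dot_split[OF i(1)]) (auto simp: f_def intro!: sum.cong)
  then have ff: "dot f f = 1" using ei dot_split[OF i(1), of e e] assms by simp
  obtain j t where j: "j < 5" "t * t = 1" "\<And>a. dot a f = t * a j" "f j = t"
    using dot_norm1[OF ff] by blast
  have "i \<noteq> j"
  proof
    assume "i = j"
    have "dot f f = t * f j" by (rule j(3))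
    with \<open>i = j\<close> ff show False by (simp add: f_def)
  qed
  have "dot a e = e i * a i + t * a j" for a
  proof -
    have "dot a f = (\<Sum>j\<in>{..<5} - {i}. a j * e j)"
      using i(1) by (subst dot_split[OF i(1)]) (auto simp: f_def intro!: sum.cong)
    then show ?thesis using j(3)[of a] dot_split[OF i(1), of a e] by (simp add: mult.commute)
  qed
  moreover have "e j = t" using j(4) \<open>i \<noteq> j\<close> by (simp add: f_def)
  ultimately show ?thesis using i(1) j(1,2) \<open>i \<noteq> j\<close> ei that by blast
qed

section \<open>Obstructions from sums of two, three and four squares\<close>

lemma square_mod8: "(x::int) * x mod 8 \<in> {0, 1, 4}"
proof -
  have "x mod 8 \<in> {0, 1, 2, 3, 4, 5, 6, 7}" by auto
  moreover have "x * x mod 8 = (x mod 8) * (x mod 8) mod 8" by (simp add: mod_mult_eq)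
  ultimately show ?thesis by auto
qed

lemma sum3_mod8: "(a mod 8 + b mod 8 + c mod 8) mod 8 = (a + b + c) mod (8::int)"
  by (rule mod_add_cong) (simp_all add: mod_add_eq)

lemma even_mod8_iff: "even (x mod 8) \<longleftrightarrow> even (x::int)"
  by (simp add: dvd_mod_iff)

lemma even_if_square_mod8:
  assumes "x * x mod 8 \<in> {0, 4}" shows "even (x::int)"
proof -
  have "even (x * x mod 8)" using assms by auto
  then show ?thesis unfolding even_mod8_iff by simp
qed

lemma three_squares_ne_7: "(x::int) * x + y * y + z * z \<noteq> 7"
proof
  assume *: "x * x + y * y + z * z = 7"
  have "(x * x mod 8 + y * y mod 8 + z * z mod 8) mod 8 = (x * x + y * y + z * z) mod 8"
    by (rule sum3_mod8)
  also have "\<dots> = 7" using * by simp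
  finally have "(x * x mod 8 + y * y mod 8 + z * z mod 8) mod 8 = 7" .
  with square_mod8[of x] square_mod8[of y] square_mod8[of z] show False by auto
qed

text \<open>Modulo 8 the three squares must all be even, and dividing by 4 leads back to 7.\<close>

lemma three_squares_ne_28: "(x::int) * x + y * y + z * z \<noteq> 28"
proof
  assume *: "x * x + y * y + z * z = 28"
  have "(x * x mod 8 + y * y mod 8 + z * z mod 8) mod 8 = (x * x + y * y + z * z) mod 8"
    by (rule sum3_mod8)
  also have "\<dots> = 4" using * by simp
  finally have "(x * x mod 8 + y * y mod 8 + z * z mod 8) mod 8 = 4" .
  moreover have "X \<in> {0, 4} \<and> Y \<in> {0, 4} \<and> Z \<in> {0, 4}"
    if "(X + Y + Z) mod 8 = 4" "X \<in> {0, 1, 4}" "Y \<in> {0, 1, 4}" "Z \<in> {0, 1, 4}" for X Y Z :: int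
    using that by auto
  ultimately have "x * x mod 8 \<in> {0, 4} \<and> y * y mod 8 \<in> {0, 4} \<and> z * z mod 8 \<in> {0, 4}"
    using square_mod8 by metis
  then have "even x \<and> even y \<and> even z"
    using even_if_square_mod8[of x] even_if_square_mod8[of y] even_if_square_mod8[of z] by metis
  then obtain u v w where "x = 2 * u" "y = 2 * v" "z = 2 * w" by (meson evenE)
  with * have "u * u + v * v + w * w = 7" by simp
  with three_squares_ne_7 show False by blast
qed

text \<open>The inner products prescribed in the lemmas \<open>no_two_unit_vectors\<close>,
  \<open>no_unit_and_root_vector\<close> and \<open>no_root_and_unit_vector\<close> are realised in dimension six.\<close>

lemma no_two_unit_vectors:
  assumes "dot e e = 1" "dot f f = 1" "dot e f = 0"
    and "dot a a - (dot a e)\<^sup>2 - (dot a f)\<^sup>2 \<in> {7, 28}"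
  shows False
proof -
  obtain i s where i: "i < 5" "s * s = 1" "\<And>a. dot a e = s * a i" "e i = s" using dot_norm1[OF assms(1)] by blast
  obtain j t where j: "j < 5" "t * t = 1" "\<And>a. dot a f = t * a j" "f j = t" using dot_norm1[OF assms(2)] by blast
  have s: "s \<noteq> 0" "t \<noteq> 0" using i(2) j(2) by auto
  have "i \<noteq> j"
  proof
    assume "i = j"
    have "s * e i = 1" using i(3)[of e] assms(1) by simp
    moreover have "t * e j = 0" using j(3)[of e] assms(3) by simp
    ultimately show False using \<open>i = j\<close> s by simp
  qed
  have sq: "(dot a e)\<^sup>2 = a i * a i" "(dot a f)\<^sup>2 = a j * a j"
  proof -
    have "(dot a e)\<^sup>2 = (s * s) * (a i * a i)" "(dot a f)\<^sup>2 = (t * t) * (a j * a j)"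
      by (simp_all add: i(3) j(3) power2_eq_square)
    then show "(dot a e)\<^sup>2 = a i * a i" "(dot a f)\<^sup>2 = a j * a j" by (simp_all add: i(2) j(2))
  qed
  have "card ({..<5} - {i, j}) = 3" using i(1) j(1) \<open>i \<noteq> j\<close> by (simp add: card_Diff_subset)
  then obtain x y z where "{..<5} - {i, j} = {x, y, z}" "x \<noteq> y" "x \<noteq> z" "y \<noteq> z"
    by (auto simp: card_3_iff)
  then have "(\<Sum>l\<in>{..<5} - {i, j}. a l * a l) = a x * a x + a y * a y + a z * a z" by simp
  \<comment> \<open>The coordinates outside \<open>i\<close> and \<open>j\<close> would carry 7 or
    28 as three squares. The summands 1, 1, 1, 2 of the witnesses contribute 7; they contribute 28
    when the coordinates of \<open>a\<close> are doubled to clear denominators.\<close>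
  with assms(4) sq dot_split2[OF i(1) j(1) \<open>i \<noteq> j\<close>, of a a]
  show False using three_squares_ne_7[of "a x" "a y" "a z"] three_squares_ne_28[of "a x" "a y" "a z"]
    by auto
qed

lemma square_cong_mod4: "4 dvd (x::int) * x - x mod 2"
proof -
  define u e where "u = x div 2" and "e = x mod 2"
  have "x = 2 * u + e" by (simp add: u_def e_def)
  moreover have "e * e = e" by (auto simp: e_def mod2_eq_if)
  ultimately have "x * x - e = 4 * (u * u + u * e)" by (simp add: algebra_simps)
  then show ?thesis by (simp add: e_def)
qed

text \<open>A square is congruent to its parity modulo 4, so the number of odd entries is 0 or
  4.\<close>

lemma four_squares_eq_4_parity:
  fixes w x y z :: int
  assumes "w * w + x * x + y * y + z * z = 4"
  shows "even (w + x)"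
proof -
  have "4 dvd (w * w - w mod 2) + (x * x - x mod 2) + (y * y - y mod 2) + (z * z - z mod 2)"
    by (intro dvd_add square_cong_mod4)
  also have "(w * w - w mod 2) + (x * x - x mod 2) + (y * y - y mod 2) + (z * z - z mod 2) =
    4 - (w mod 2 + x mod 2 + y mod 2 + z mod 2)"
    using assms by simp
  finally show ?thesis by presburger
qed

lemma five_indices:
  assumes "i < 5" "j < 5" "k < (5::nat)" "i \<noteq> j" "i \<noteq> k" "j \<noteq> k"
  obtains l m where "\<And>a b. dot a b = a i * b i + a j * b j + a k * b k + a l * b l + a m * b m"
proof -
  have "card ({..<5} - {i, j, k}) = 2" using assms by (simp add: card_Diff_subset)
  then obtain l m where "{..<5} - {i, j, k} = {l, m}" "l \<noteq> m" by (auto simp: card_2_iff)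
  then have set: "{..<5} = {i, j, k, l, m}" and "l \<notin> {i, j, k}" "m \<notin> {i, j, k}" using assms by auto
  with assms \<open>l \<noteq> m\<close> have "dot a b = a i * b i + a j * b j + a k * b k + a l * b l + a m * b m" for a b
    unfolding dot_def set by auto
  with that show ?thesis by blast
qed

text \<open>Removing the coordinate of \<open>e\<close> leaves four coordinates in which
  \<open>a\<close> has norm 4 and \<open>d\<close> is a root. The entries of a vector of norm 4
  there all have the same parity, so its inner product with a root is even.\<close>

lemma no_unit_and_root_vector:
  assumes "dot e e = 1" "dot d d = 2" "dot e d = 0" "odd (dot a d)"
    and "dot a a - (dot a e)\<^sup>2 = 4"
  shows False
proof -
  obtain i s where i: "i < 5" "s * s = 1" "\<And>a. dot a e = s * a i" "e i = s" using dot_norm1[OF assms(1)] by blast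
  obtain j k u v where d: "j < 5" "k < 5" "j \<noteq> k" "u * u = 1" "v * v = 1"
    "\<And>a. dot a d = u * a j + v * a k" "d j = u" "d k = v" using dot_norm2[OF assms(2)] by blast
  have nz: "s \<noteq> 0" "u \<noteq> 0" "v \<noteq> 0" using i(2) d(4,5) by auto
  have "d i = 0" using i(3)[of d] assms(3) nz by (simp add: dot_commute)
  then have "i \<noteq> j" "i \<noteq> k" using d(7,8) nz by auto
  then obtain l m where lm: "\<And>a b. dot a b = a i * b i + a j * b j + a k * b k + a l * b l + a m * b m"
    using five_indices[OF i(1) d(1,2)] d(3) by metis
  have "(dot a e)\<^sup>2 = (s * s) * (a i * a i)" by (simp add: i(3) power2_eq_square)
  then have "a j * a j + a k * a k + a l * a l + a m * a m = 4"
    using assms(5) lm[of a a] i(2) by simp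
  then have "even (a j + a k)" using four_squares_eq_4_parity by blast
  moreover have "odd (u * u)" "odd (v * v)" using d(4,5) by simp_all
  ultimately have "even (dot a d)" using d(6)[of a] by auto
  with assms(4) show False by simp
qed

lemma two_squares_ne: "(x::int) * x + y * y \<notin> {6, 12, 14}"
proof
  assume *: "x * x + y * y \<in> {6, 12, 14}"
  have mod8: "(x * x mod 8 + y * y mod 8) mod 8 = (x * x + y * y) mod 8" by (rule mod_add_eq)
  from * consider "(x * x + y * y) mod 8 = 6" | "x * x + y * y = 12" by auto
  then show False
  proof cases
    case 1
    then have "(x * x mod 8 + y * y mod 8) mod 8 = 6" using mod8 by simp
    with square_mod8[of x] square_mod8[of y] show False by auto
  next
    case 2
    then have "(x * x mod 8 + y * y mod 8) mod 8 = 4" using mod8 by simp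
    with square_mod8[of x] square_mod8[of y]
    have "x * x mod 8 \<in> {0, 4} \<and> y * y mod 8 \<in> {0, 4}" by auto
    then have "even x \<and> even y"
      using even_if_square_mod8[of x] even_if_square_mod8[of y] by metis
    then obtain u v where "x = 2 * u" "y = 2 * v" by (meson evenE)
    with 2 have eq: "u * u + v * v = 3" by simp
    have "(u * u mod 8 + v * v mod 8) mod 8 = (u * u + v * v) mod 8" by (rule mod_add_eq)
    also have "\<dots> = 3" by (simp add: eq)
    finally show False using square_mod8[of u] square_mod8[of v] by auto
  qed
qed

text \<open>In the four coordinates left by \<open>e\<close>, the root \<open>b\<close> prescribes
  the sum 4 of two signed entries \<open>x\<close> and \<open>y\<close>. Their squares add up to 8
  plus twice the square of \<open>x - 2\<close>, which leaves 14, 12 or 6 for the last two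
  coordinates, and none of these is a sum of two squares.\<close>

lemma no_root_and_unit_vector:
  assumes "dot b b = 2" "dot e e = 1" "dot b e = 0" "dot a b = 4"
    and "dot a a - (dot a e)\<^sup>2 = 22"
  shows False
proof -
  obtain i s where i: "i < 5" "s * s = 1" "\<And>a. dot a e = s * a i" "e i = s" using dot_norm1[OF assms(2)] by blast
  obtain j k u v where b: "j < 5" "k < 5" "j \<noteq> k" "u * u = 1" "v * v = 1"
    "\<And>a. dot a b = u * a j + v * a k" "b j = u" "b k = v" using dot_norm2[OF assms(1)] by blast
  have nz: "s \<noteq> 0" "u \<noteq> 0" "v \<noteq> 0" using i(2) b(4,5) by auto
  have "b i = 0" using i(3)[of b] assms(3) nz by (simp add: dot_commute)
  then have "i \<noteq> j" "i \<noteq> k" using b(7,8) nz by auto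
  then obtain l m where lm: "\<And>a b. dot a b = a i * b i + a j * b j + a k * b k + a l * b l + a m * b m"
    using five_indices[OF i(1) b(1,2)] b(3) by metis
  define x y where "x = u * a j" and "y = v * a k"
  have xy: "x + y = 4" using b(6)[of a] assms(4) by (simp add: x_def y_def)
  have "x * x = (u * u) * (a j * a j)" "y * y = (v * v) * (a k * a k)" by (simp_all add: x_def y_def)
  then have sq: "x * x = a j * a j" "y * y = a k * a k" by (simp_all add: b(4,5))
  have "(dot a e)\<^sup>2 = (s * s) * (a i * a i)" by (simp add: i(3) power2_eq_square)
  then have eq: "x * x + y * y + (a l * a l + a m * a m) = 22"
    using assms(5) lm[of a a] i(2) sq by simp
  have "a l * a l + a m * a m \<ge> 0" by simp
  with eq have le: "x * x + y * y \<le> 22" by linarith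
  have y: "y = 4 - x" using xy by simp
  have "2 * ((x - 2) * (x - 2)) = x * x + y * y - 8" unfolding y by (simp add: algebra_simps)
  with le have le7: "(x - 2) * (x - 2) \<le> 7" by linarith
  have "\<bar>x - 2\<bar> < 3"
  proof (rule ccontr)
    assume "\<not> ?thesis"
    then have "3 * 3 \<le> \<bar>x - 2\<bar> * \<bar>x - 2\<bar>" by (intro mult_mono) auto
    with le7 show False by simp
  qed
  then consider "x = 0" | "x = 1" | "x = 2" | "x = 3" | "x = 4" by linarith
  then have "a l * a l + a m * a m \<in> {6, 12, 14}" using eq y by cases simp_all
  with two_squares_ne show False by blast
qed

text \<open>Half the difference \<open>e\<close> and half the sum \<open>f\<close> of
  \<open>c\<close> and \<open>d\<close> are orthogonal with norms 1 and 3, and \<open>a\<close> has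
  inner products 2 and 3 with them. Bessel's inequality then gives 4 + 9/3 as a lower bound.\<close>

lemma no_norm_4_pair:
  assumes "\<And>i. i < 5 \<Longrightarrow> even (c i - d i)" "dot c c = 4" "dot d d = 4" "dot c d = 2"
    and "dot a c = 5" "dot a d = 1"
  shows "dot a a \<ge> 7"
proof -
  obtain e where e: "\<And>a. dot a (\<lambda>i. c i - d i) = 2 * dot a e"
      "dot (\<lambda>i. c i - d i) (\<lambda>i. c i - d i) = 4 * dot e e" "\<And>i. i < 5 \<Longrightarrow> c i - d i = 2 * e i"
    using dot_half[of "\<lambda>i. c i - d i"] assms(1) by blast
  have ee: "dot e e = 1" using e(2) assms(2-4) by (simp add: dot_linear dot_commute[of d c])
  have ae: "dot a e = 2" using e(1)[of a] assms(5,6) by (simp add: dot_linear)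
  have de: "dot d e = -1" using e(1)[of d] assms(3,4) by (simp add: dot_linear dot_commute[of d c])
  define f b where "f = (\<lambda>i. d i + e i)" and "b = (\<lambda>i. a i - 2 * e i)"
  have "dot f f = 3" using assms(3) ee de by (simp add: f_def dot_linear dot_commute[of e d])
  moreover have "dot b f = 3" unfolding f_def b_def
    using ee de ae assms(6) by (simp add: dot_linear dot_commute[of e d])
  ultimately have "9 \<le> dot b b * 3" using dot_Cauchy_Schwarz[of b f] by simp
  moreover have "dot b b = dot a a - 4" using ee ae by (simp add: b_def dot_linear dot_commute[of e a])
  ultimately show ?thesis by simp
qed

lemma mult_ge: "(m::int) \<le> x \<Longrightarrow> 0 \<le> p \<Longrightarrow> m * p \<le> p * x"
  by (subst mult.commute[of p]) (rule mult_right_mono)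

lemma dvd_ranges:
  fixes x y :: int
  assumes "4 dvd x - y" "even x" "x \<ge> 1" "y \<ge> 1"
  shows "x \<ge> 2" "y \<ge> 2" "y = 2 \<Longrightarrow> x = 2 \<or> x = 6 \<or> x \<ge> 10" "y = 4 \<Longrightarrow> x = 4 \<or> x \<ge> 8"
    "y = 2 \<or> y = 4 \<or> y = 6 \<or> y \<ge> 8"
  using assms by presburger+

section \<open>Coordinate vectors of five squares\<close>

text \<open>In the lemmas \<open>no_rep\<close>, the entries of \<open>a\<close>, \<open>b\<close>, \<open>c\<close>, \<open>d\<close> are, up to fixed denominators, the
  coefficients of \<open>1\<close>, \<open>sqrt q\<close>, \<open>sqrt p\<close>, \<open>sqrt r\<close> in five algebraic integers, where
  \<open>p = g k\<close>, \<open>q = h k\<close>, \<open>r = g h\<close>. Modulo 4, one has \<open>(q, p, r) = (3, 2, 2)\<close> in case A,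
  \<open>(1, 2, 2)\<close> or \<open>(1, 3, 3)\<close> in case B, and \<open>(1, 1, 1)\<close> in case C; up to permuting
  \<open>g\<close>, \<open>h\<close>, \<open>k\<close> there is no other case. The next lemma treats \<open>b = 0\<close> for the sums
  \<open>3 + f\<^sup>2 + (1 + f)\<^sup>2 + (N + sqrt p)\<^sup>2\<close> with \<open>f = (sqrt p + sqrt r) / 2\<close>.\<close>

lemma no_rank_three_rep:
  assumes cd: "\<And>i. i < 5 \<Longrightarrow> even (c i - d i)"
    and N: "N = 1 \<and> r \<ge> p + 8 \<or> N = 2 \<and> r \<ge> p + 4" and p: "p \<ge> 6"
    and norm: "4 * dot a a + p * dot c c + r * dot d d = 16 + 4 * N\<^sup>2 + 6 * p + 2 * r"
    and ip: "dot c d = 2" "dot a c = 2 * N + 1" "dot a d = (1::int)"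
  shows False
proof -
  define z x y where "z = dot a a" and "x = dot c c" and "y = dot d d"
  note defs = z_def[symmetric] x_def[symmetric] y_def[symmetric]
  have mod4: "4 dvd x - y" unfolding x_def y_def using cd by (rule dot_self_cong_mod4)
  have "even x" using dot_cong_mod2[of c d c] cd ip(1) by (simp add: defs)
  have "x \<noteq> 0" "y \<noteq> 0" using dot_zero(1)[of c d] dot_zero(2)[of d a] ip by (auto simp: defs)
  then have "x \<ge> 1" "y \<ge> 1" using dot_self_nonneg[of c] dot_self_nonneg[of d] by (simp_all add: defs)
  note rng = dvd_ranges[OF mod4 \<open>even x\<close> this]
  have cs: "(2 * N + 1)\<^sup>2 \<le> z * x" using dot_Cauchy_Schwarz[of a c] by (simp add: ip defs)
  have "z \<noteq> 0" using dot_zero(1)[of a d] ip by (auto simp: defs)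
  then have z: "z \<ge> 1" using dot_self_nonneg[of a] by (simp add: defs)
  note norm = norm[unfolded defs]
  have N': "N = 1 \<or> N = 2" and r: "r \<ge> p + 4" using N by auto
  have rp: "r \<ge> 0" "p \<ge> 0" using r p by auto
  \<comment> \<open>These norms belong to the six squares themselves, where
    \<open>a = (1,1,1,0,1,N)\<close>, \<open>c = (0,0,0,1,1,2)\<close> and
    \<open>d = (0,0,0,1,1,0)\<close>. Half of \<open>c - d\<close> is a unit vector orthogonal to
    the root \<open>d\<close>.\<close>
  have noZ6: False if "x = 6" "y = 2" "z = 4 + N\<^sup>2"
  proof -
    obtain e where e: "\<And>a. dot a (\<lambda>i. c i - d i) = 2 * dot a e"
      "dot (\<lambda>i. c i - d i) (\<lambda>i. c i - d i) = 4 * dot e e" "\<And>i. i < 5 \<Longrightarrow> c i - d i = 2 * e i"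
      using dot_half[of "\<lambda>i. c i - d i"] cd by blast
    have "4 * dot e e = x - 2 * dot c d + y" using e(2)
      by (simp add: dot_linear dot_commute[of d c] x_def y_def)
    then have "dot e e = 1" using ip(1) that by simp
    moreover have "2 * dot d e = dot d c - y" using e(1)[of d] by (simp add: dot_linear y_def)
    then have "dot e d = 0" using ip(1) that by (simp add: dot_commute[of d c] dot_commute[of d e])
    moreover have "2 * dot a e = dot a c - dot a d" using e(1)[of a] by (simp add: dot_linear)
    then have "dot a e = N" using ip by simp
    ultimately show False
      using no_unit_and_root_vector[of e d a] ip(3) that by (simp add: defs)
  qed
  from rng(5) consider "y = 2" | "y = 4" | "y = 6" | "y \<ge> 8" by blast
  then show False
  proof cases
    case 1
    with norm have eq: "p * x + 4 * z = 16 + 4 * N\<^sup>2 + 6 * p" by simp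
    consider "x = 2" | "x = 6" | "x \<ge> 10" using rng(3) 1 by blast
    then show False
    proof cases
      assume "x = 2"
      with 1 ip(1) have "dot a d = dot a c" using dot_same[of c d a] by (simp add: defs)
      with ip N' show False by auto
    next
      assume "x = 6"
      with eq have "z = 4 + N\<^sup>2" by simp
      with noZ6 1 \<open>x = 6\<close> show False by blast
    next
      assume "x \<ge> 10"
      have "10 * p \<le> p * x" by (rule mult_ge[OF \<open>x \<ge> 10\<close> rp(2)])
      have N2: "N = 2"
      proof (rule ccontr)
        assume "N \<noteq> 2"
        with N' eq have "p * x + 4 * z = 20 + 6 * p" by auto
        with \<open>10 * p \<le> p * x\<close> p z show False by linarith
      qed
      have "x < 11"
      proof (rule ccontr)
        assume "\<not> x < 11"
        then have "11 * p \<le> p * x" using rp by (intro mult_ge) auto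
        with eq p z N2 show False by simp
      qed
      with \<open>x \<ge> 10\<close> have "x = 10" by simp
      with eq N2 p have "z \<le> 2" by simp
      with cs N2 \<open>x = 10\<close> show False by simp
    qed
  next
    case 2
    with rng have x: "x = 4 \<or> x \<ge> 8" by blast
    from 2 norm have eq: "p * x + 4 * z + 2 * r = 16 + 4 * N\<^sup>2 + 6 * p" by simp
    show False
    proof (cases "x = 4")
      case True
      \<comment> \<open>The gap between \<open>r\<close> and \<open>p\<close> bounds
        \<open>z\<close>. Cauchy-Schwarz for \<open>a\<close> and \<open>c\<close> suffices when
        \<open>N = 1\<close>; for \<open>N = 2\<close> the sharper bound 7 is required.\<close>
      with eq N have "N = 1 \<and> z \<le> 1 \<or> N = 2 \<and> z \<le> 6" by auto
      then show False
      proof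
        assume "N = 1 \<and> z \<le> 1"
        with cs True show False by simp
      next
        assume N2: "N = 2 \<and> z \<le> 6"
        have "dot a a \<ge> 7" using cd True 2 ip N2 by (intro no_norm_4_pair) (simp_all add: defs)
        with N2 show False by (simp add: defs)
      qed
    next
      case False
      with x have P8: "8 * p \<le> p * x" using rp by (intro mult_ge) auto
      from N' eq have "p * x + 4 * z + 2 * r \<le> 32 + 6 * p" by auto
      with P8 r p z show False by linarith
    qed
  next
    case 3
    with norm have eq: "p * x + 4 * z + 4 * r = 16 + 4 * N\<^sup>2 + 6 * p" by simp
    from 3 mod4 \<open>x \<ge> 1\<close> \<open>even x\<close> have "x = 2 \<or> x \<ge> 6" by presburger
    then show False
    proof
      assume "x = 2"
      with eq N have "N = 1 \<and> z \<le> 0 \<or> N = 2 \<and> z \<le> 4" by auto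
      with cs \<open>x = 2\<close> show False by auto
    next
      assume "x \<ge> 6"
      then have P6: "6 * p \<le> p * x" using rp by (intro mult_ge) auto
      from N' eq have "p * x + 4 * z + 4 * r \<le> 32 + 6 * p" by auto
      with P6 r p z show False by linarith
    qed
  next
    case 4
    have RP: "8 * r \<le> r * y" "2 * p \<le> p * x" using 4 rng rp by (auto intro!: mult_ge)
    from N' norm have "4 * z + p * x + r * y \<le> 32 + 6 * p + 2 * r" by auto
    with RP r p z show False by linarith
  qed
qed

lemma dot_unit_abs_le:
  assumes "dot b b = 1" "dot c c = 1"
  shows "dot b c \<in> {-1, 0, 1}"
  using dot_abs_le[of b c 1] assms by auto

lemma dot_root_abs_le:
  assumes "dot b b = 2" "dot c c = 2"
  shows "\<bar>dot b c\<bar> \<le> 2"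
  using dot_abs_le[of b c 2] assms by simp

lemma dot_unit_odd:
  assumes "dot c c = 1" "dot d d = 1" "odd (dot c d)"
  shows "dot c d = 1 \<or> dot c d = -1"
  using dot_unit_abs_le[OF assms(1,2)] assms(3) by auto

lemma dot_root_even:
  assumes "dot c c = 2" "dot d d = 2" "even (dot c d)"
  shows "dot c d = 2 \<or> dot c d = 0 \<or> dot c d = -2"
  using dot_root_abs_le[OF assms(1,2)] assms(3) by presburger

section \<open>Case A: five squares are impossible\<close>

text \<open>General witness \<open>1, 1, 1, 2, 1 + sqrt q, 1 + f\<close>, whose coordinate vectors
  have norms 9, 1, 1, 1; \<open>g\<close> stands for half of the even factor. The constant 36 is 4
  times 9, and with all radicands at least 10 this surplus cannot pay for longer \<open>b\<close>,
  \<open>c\<close>, \<open>d\<close>.\<close>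

lemma no_rep_A1:
  assumes cd: "\<And>i. i < 5 \<Longrightarrow> even (c i - d i)"
    and norm: "4 * dot a a + 4 * q * dot b b + p * dot c c + r * dot d d = 36 + 4 * q + p + r"
    and ip: "2 * dot a b + g * dot c d = 2 + g" "dot a c + h * dot b d = 1" "dot a d + k * dot b c = 1"
    and "odd g" "g \<ge> 3" "h > k" "q \<ge> 10" "p \<ge> 10" "r \<ge> 10"
  shows False
proof -
  define z w x y where "z = dot a a" and "w = dot b b" and "x = dot c c" and "y = dot d d"
  note defs = z_def[symmetric] w_def[symmetric] x_def[symmetric] y_def[symmetric]
  note norm = norm[unfolded defs]
  have z: "z \<ge> 0" by (simp add: z_def dot_self_nonneg)
  have odd: "odd (dot c d)"
  proof
    assume "even (dot c d)"
    then have "even (2 * dot a b + g * dot c d)" by simp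
    with ip(1) \<open>odd g\<close> show False by simp
  qed
  have "odd x" using dot_cong_mod2[of c d c] cd odd by (simp add: defs)
  have mod4: "4 dvd x - y" unfolding x_def y_def using cd by (rule dot_self_cong_mod4)
  have "x \<ge> 0" "y \<ge> 0" by (simp_all add: x_def y_def dot_self_nonneg)
  with \<open>odd x\<close> mod4 have xy: "x \<ge> 1" "y \<ge> 1" "x < 5 \<Longrightarrow> y < 5 \<Longrightarrow> x = 1 \<and> y = 1 \<or> x = 3 \<and> y = 3"
    by presburger+
  \<comment> \<open>With \<open>b = 0\<close> the first relation makes \<open>g\<close> a divisor of
    2. For \<open>g = 1\<close> this is no contradiction, so that value gets a witness of its
    own.\<close>
  have "w \<noteq> 0"
  proof
    assume "w = 0"
    then have "dot a b = 0" using dot_zero(2) by (simp add: w_def)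
    with ip(1) have "g * dot c d = g + 2" by simp
    then have "g dvd g + 2" by (metis dvd_triv_left)
    then have "g dvd 2" by (simp add: dvd_add_right_iff)
    with \<open>g \<ge> 3\<close> show False by (simp add: zdvd_not_zless)
  qed
  then have "w \<ge> 1" using dot_self_nonneg[of b] by (simp add: defs)
  have P: "p \<le> p * x" "r \<le> r * y" "q \<le> q * w"
    using mult_ge[OF xy(1), of p] mult_ge[OF xy(2), of r] mult_ge[OF \<open>w \<ge> 1\<close>, of q] assms by simp_all
  have "w < 2"
  proof (rule ccontr)
    assume "\<not> w < 2"
    then have "2 * q \<le> q * w" using \<open>q \<ge> 10\<close> by (intro mult_ge) auto
    with P norm z \<open>q \<ge> 10\<close> show False by simp
  qed
  with \<open>w \<ge> 1\<close> have w: "w = 1" by simp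
  have "x < 5"
  proof (rule ccontr)
    assume "\<not> x < 5"
    then have "5 * p \<le> p * x" using \<open>p \<ge> 10\<close> by (intro mult_ge) auto
    with P norm z w \<open>p \<ge> 10\<close> show False by simp
  qed
  moreover have "y < 5"
  proof (rule ccontr)
    assume "\<not> y < 5"
    then have "5 * r \<le> r * y" using \<open>r \<ge> 10\<close> by (intro mult_ge) auto
    with P norm z w \<open>r \<ge> 10\<close> show False by simp
  qed
  ultimately have "x = 1 \<and> y = 1 \<or> x = 3 \<and> y = 3" by (rule xy(3))
  then have xy: "x = 1" "y = 1" using norm z w \<open>p \<ge> 10\<close> \<open>r \<ge> 10\<close> by auto
  with norm w have "z = 9" by simp
  from xy odd have "dot c d = 1 \<or> dot c d = -1" by (intro dot_unit_odd) (simp_all add: defs)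
  then show False
  proof
    assume 1: "dot c d = 1"
    then have "dot v d = dot v c" for v using dot_same[of c d v] xy by (simp add: defs)
    \<comment> \<open>Once \<open>d\<close> acts as \<open>c\<close>, the last two relations differ
      by \<open>(h - k) * dot b c\<close>. So \<open>b\<close> and \<open>c\<close> are orthonormal,
      and 9 - 1 - 1 = 7 remains for three coordinates.\<close>
    with ip 1 have "dot a b = 1" "dot a c + h * dot b c = 1" "dot a c + k * dot b c = 1" by simp_all
    then have "h * dot b c = k * dot b c" by linarith
    with \<open>h > k\<close> have "dot b c = 0" by simp
    moreover have "dot a c = 1" using \<open>dot b c = 0\<close> \<open>dot a c + h * dot b c = 1\<close> by simp
    ultimately show False using no_two_unit_vectors[of b c a] w xy \<open>z = 9\<close> \<open>dot a b = 1\<close>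
      by (simp add: defs)
  next
    assume "dot c d = -1"
    with ip(1) have "dot a b = 1 + g" by simp
    moreover have "(dot a b)\<^sup>2 \<le> 9" using dot_Cauchy_Schwarz[of a b] \<open>z = 9\<close> w by (simp add: defs)
    moreover have "4\<^sup>2 \<le> (1 + g)\<^sup>2" using \<open>g \<ge> 3\<close> by (intro power_mono) auto
    ultimately show False by simp
  qed
qed

text \<open>If all entries of \<open>c\<close> were even, those of \<open>d\<close> would be too,
  and \<open>dot a d + k * dot b c\<close> would be even. So both vectors have an odd entry and
  positive norm, and parity lifts the bound from 1 to 2.\<close>

lemma norms_ge_2:
  assumes cd: "\<And>i. i < 5 \<Longrightarrow> even (c i - d i)"
    and "even (dot c d)" "odd (dot a d + k * dot b c)"
  shows "even (dot c c)" "4 dvd dot c c - dot d d" "dot c c \<ge> 2" "dot d d \<ge> 2"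
proof -
  show ev: "even (dot c c)" using dot_cong_mod2[of c d c] cd assms(2) by simp
  show mod4: "4 dvd dot c c - dot d d" using cd by (rule dot_self_cong_mod4)
  have "\<exists>i<5. odd (c i)"
  proof (rule ccontr)
    assume "\<not> ?thesis"
    then have c: "even (c i)" if "i < 5" for i using that by blast
    then have d: "even (d i)" if "i < 5" for i using cd that by auto
    from dot_even[OF c] dot_even[OF d] assms(3) show False by auto
  qed
  then obtain i where i: "i < 5" "odd (c i)" by blast
  then have "odd (d i)" using cd by auto
  with i have "dot c c \<ge> 1" "dot d d \<ge> 1" by (auto intro: dot_odd_ge_1)
  with ev mod4 show "dot c c \<ge> 2" "dot d d \<ge> 2" by presburger+
qed

text \<open>For the even factor 2, with witness \<open>1, 1, 1, f, 1 + f, 2 + sqrt p\<close>. A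
  nonzero \<open>b\<close> would cost at least \<open>4 * q\<close>, while beyond the unavoidable
  \<open>2 * p + 2 * r\<close> only \<open>32 + 4 * p\<close> is available. This forces
  \<open>b = 0\<close>.\<close>

lemma no_rep_A2:
  assumes cd: "\<And>i. i < 5 \<Longrightarrow> even (c i - d i)"
    and norm: "4 * dot a a + 4 * q * dot b b + p * dot c c + r * dot d d = 32 + 6 * p + 2 * r"
    and ip: "2 * dot a b + dot c d = 2" "dot a c + h * dot b d = 5" "dot a d + k * dot b c = 1"
    and "p \<ge> 6" "r \<ge> p + 4" "q \<ge> p + 9"
  shows False
proof -
  have "dot c d = 2 * (1 - dot a b)" using ip(1) by simp
  then have even: "even (dot c d)" by simp
  note ge = norms_ge_2[of c d a k b, OF cd even]
  have "dot c c \<ge> 2" "dot d d \<ge> 2" using ge(3,4) ip(3) by simp_all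
  then have P: "2 * p \<le> p * dot c c" "2 * r \<le> r * dot d d" using assms by (simp_all add: mult_ge)
  have "dot b b < 1"
  proof (rule ccontr)
    assume "\<not> dot b b < 1"
    then have "1 * q \<le> q * dot b b" using assms by (intro mult_ge) auto
    with P norm dot_self_nonneg[of a] assms show False by linarith
  qed
  then have b: "dot b b = 0" using dot_self_nonneg[of b] by simp
  show False
    using cd by (rule no_rank_three_rep[of c d 2 p r a]) (use norm ip dot_zero[OF b] b assms in auto)
qed

text \<open>For the factors \<open>6, h, 1\<close>, so \<open>p = 6\<close>, \<open>q = h\<close>,
  \<open>r = 6 * h\<close>; the radicand 6 is below the bound of the general witness. Size alone
  permits \<open>dot b b = 1\<close> for some \<open>h\<close>, and that branch is closed by the
  inner products.\<close>

lemma no_rep_A3: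
  assumes cd: "\<And>i. i < 5 \<Longrightarrow> even (c i - d i)"
    and norm: "4 * dot a a + 4 * h * dot b b + 6 * dot c c + 6 * h * dot d d = 56 + 12 * h"
    and ip: "2 * dot a b + 3 * dot c d = 6" "dot a c + h * dot b d = 3" "dot a d + dot b c = 1"
    and "h \<ge> 7"
  shows False
proof -
  define z w x y where "z = dot a a" and "w = dot b b" and "x = dot c c" and "y = dot d d"
  note defs = z_def[symmetric] w_def[symmetric] x_def[symmetric] y_def[symmetric]
  note norm = norm[unfolded defs]
  have nonneg: "z \<ge> 0" "w \<ge> 0" by (simp_all add: z_def w_def dot_self_nonneg)
  have even: "even (dot c d)" using ip(1) by presburger
  note ge = norms_ge_2[of c d a 1 b, OF cd even, unfolded defs]
  have ge: "even x" "4 dvd x - y" "x \<ge> 2" "y \<ge> 2" using ge ip(3) by simp_all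
  have H: "0 \<le> h * w" using nonneg \<open>h \<ge> 7\<close> by simp
  have "y < 4"
  proof (rule ccontr)
    assume "\<not> y < 4"
    then have "4 * h \<le> h * y" using \<open>h \<ge> 7\<close> by (intro mult_ge) auto
    with norm nonneg H ge \<open>h \<ge> 7\<close> show False by simp
  qed
  with ge have y: "y = 2" by presburger
  with norm have eq: "4 * z + 4 * (h * w) + 6 * x = 56" by simp
  have "w < 2"
  proof (rule ccontr)
    assume "\<not> w < 2"
    then have "2 * h \<le> h * w" using \<open>h \<ge> 7\<close> by (intro mult_ge) auto
    with eq nonneg ge \<open>h \<ge> 7\<close> show False by simp
  qed
  with nonneg consider "w = 0" | "w = 1" by linarith
  then show False
  proof cases
    case 1
    then have b: "dot b b = 0" by (simp add: w_def)
    show False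
      using cd by (rule no_rank_three_rep[of c d 1 6 "6 * h" a])
        (use norm ip dot_zero[OF b] 1 \<open>h \<ge> 7\<close> in \<open>auto simp: defs\<close>)
  next
    case 2
    with eq have "4 * z + 4 * h + 6 * x = 56" by simp
    with ge \<open>h \<ge> 7\<close> nonneg y have x: "x = 2" by presburger
    with eq 2 have z: "z = 11 - h" by simp
    have cs: "(dot a b)\<^sup>2 \<le> z" using dot_Cauchy_Schwarz[of a b] 2 by (simp add: defs)
    from x y even have "dot c d = 2 \<or> dot c d = 0 \<or> dot c d = -2"
      by (intro dot_root_even) (simp_all add: defs)
    then show False
    proof (elim disjE)
      assume 1: "dot c d = 2"
      then have "dot v d = dot v c" for v using dot_same[of c d v] x y by (simp add: defs)
      with ip have "dot a c + h * dot b c = 3" "dot a c + dot b c = 1" by simp_all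
      then have "(h - 1) * dot b c = 2" by (simp add: algebra_simps)
      then have "h - 1 dvd 2" by (metis dvd_triv_left)
      with \<open>h \<ge> 7\<close> show False by (simp add: zdvd_not_zless)
    next
      assume "dot c d = 0"
      with ip(1) have "dot a b = 3" by simp
      with cs z \<open>h \<ge> 7\<close> show False by simp
    next
      assume "dot c d = -2"
      with ip(1) have "dot a b = 6" by simp
      with cs z \<open>h \<ge> 7\<close> show False by simp
    qed
  qed
qed

text \<open>For the small radicand \<open>q = 7\<close>, with \<open>g\<close> again half of the
  even factor. The witness \<open>1, 1, 1, f, 1 + f, 1 + sqrt q\<close> has norms 5, 1, 2, 2 with
  \<open>c = d\<close> orthogonal to \<open>b\<close>, so the obstruction is a unit vector beside a
  root.\<close>

lemma no_rep_A4:
  assumes cd: "\<And>i. i < 5 \<Longrightarrow> even (c i - d i)"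
    and norm: "4 * dot a a + 28 * dot b b + 2 * g * dot c c + 14 * g * dot d d = 48 + 32 * g"
    and ip: "2 * dot a b + g * dot c d = 2 + 2 * g" "dot a c + 7 * dot b d = 1" "dot a d + dot b c = 1"
    and "odd g" "g \<ge> 5"
  shows False
proof -
  define z w x y where "z = dot a a" and "w = dot b b" and "x = dot c c" and "y = dot d d"
  note defs = z_def[symmetric] w_def[symmetric] x_def[symmetric] y_def[symmetric]
  note norm = norm[unfolded defs]
  have nonneg: "z \<ge> 0" "w \<ge> 0" by (simp_all add: z_def w_def dot_self_nonneg)
  have "g * dot c d = 2 * (1 + g - dot a b)" using ip(1) by simp
  then have "even (g * dot c d)" by (metis dvd_triv_left)
  with \<open>odd g\<close> have even: "even (dot c d)" by simp
  note ge = norms_ge_2[of c d a 1 b, OF cd even, unfolded defs]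
  have ge: "even x" "4 dvd x - y" "x \<ge> 2" "y \<ge> 2" using ge ip(3) by simp_all
  have G: "2 * g \<le> g * x" "2 * g \<le> g * y" using ge \<open>g \<ge> 5\<close> by (simp_all add: mult_ge)
  have w: "w \<noteq> 0"
  proof
    assume "w = 0"
    then have "dot a b = 0" using dot_zero(2) by (simp add: w_def)
    with ip(1) have "g * dot c d = g * 2 + 2" by simp
    then have "g dvd g * 2 + 2" by (metis dvd_triv_left)
    then have "g dvd 2" by (simp add: dvd_add_right_iff)
    with \<open>g \<ge> 5\<close> show False by (simp add: zdvd_not_zless)
  qed
  have "y < 4"
  proof (rule ccontr)
    assume "\<not> y < 4"
    then have "4 * g \<le> g * y" using \<open>g \<ge> 5\<close> by (intro mult_ge) auto
    with norm nonneg G \<open>g \<ge> 5\<close> show False by simp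
  qed
  with ge have y: "y = 2" by presburger
  have "x < 6"
  proof (rule ccontr)
    assume "\<not> x < 6"
    then have "6 * g \<le> g * x" using \<open>g \<ge> 5\<close> by (intro mult_ge) auto
    with norm nonneg y w \<open>g \<ge> 5\<close> show False by simp
  qed
  with ge y have x: "x = 2" by presburger
  with norm y have "z + 7 * w = 12" by simp
  with nonneg w have "w = 1" "z = 5" by presburger+
  have cs: "(dot a b)\<^sup>2 \<le> 5" using dot_Cauchy_Schwarz[of a b] \<open>w = 1\<close> \<open>z = 5\<close> by (simp add: defs)
  have "(dot a b)\<^sup>2 \<ge> 5\<^sup>2" if "dot a b \<ge> 5" using that by (intro power_mono) auto
  with cs have ab: "dot a b < 5" by (auto simp: not_less[symmetric])
  from x y even have "dot c d = 2 \<or> dot c d = 0 \<or> dot c d = -2"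
    by (intro dot_root_even) (simp_all add: defs)
  then show False
  proof (elim disjE)
    assume 1: "dot c d = 2"
    then have "dot v d = dot v c" for v using dot_same[of c d v] x y by (simp add: defs)
    with ip 1 have "dot a c + 7 * dot b c = 1" "dot a c + dot b c = 1" "dot a b = 1" by simp_all
    then have "dot b c = 0" "dot a c = 1" by simp_all
    then show False using no_unit_and_root_vector[of b c a] \<open>w = 1\<close> \<open>z = 5\<close> x \<open>dot a b = 1\<close>
      by (simp add: defs)
  next
    assume "dot c d = 0"
    with ip(1) ab \<open>g \<ge> 5\<close> show False by simp
  next
    assume "dot c d = -2"
    with ip(1) ab \<open>g \<ge> 5\<close> show False by simp
  qed
qed

lemma odd_coordinate:
  fixes c d :: "nat \<Rightarrow> int"
  assumes "\<And>i. i < 5 \<Longrightarrow> even (c i - d i)" "i < 5" "odd (d i)"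
  shows "dot c c \<ge> 1" "dot d d \<ge> 1"
proof -
  have "odd (c i)" using assms(1)[OF assms(2)] assms(3) by simp
  with assms show "dot c c \<ge> 1" "dot d d \<ge> 1" by (blast intro: dot_odd_ge_1)+
qed

lemma even_imp_cong:
  fixes c d :: "nat \<Rightarrow> int"
  assumes "\<And>i. i < 5 \<Longrightarrow> even (c i - d i)" "\<And>i. i < 5 \<Longrightarrow> even (d i)" "i < 5"
  shows "even (c i)"
  using assms(1,2)[OF assms(3)] by simp

lemma dot_self_even_ge_4:
  assumes "\<And>i. i < 5 \<Longrightarrow> even (d i)" "dot d d \<noteq> 0"
  shows "dot d d \<ge> 4"
proof -
  obtain d' where "\<And>a. dot a d = 2 * dot a d'" "dot d d = 4 * dot d' d'"
    "\<And>i. i < 5 \<Longrightarrow> d i = 2 * d' i"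
    using dot_half[of d] assms(1) by blast
  with assms(2) dot_self_nonneg[of d'] show ?thesis by simp
qed

lemma dot_zero_imp_even:
  assumes "\<And>i. i < 5 \<Longrightarrow> even (c i - d i)" "dot d d = 0"
  shows "\<And>i. i < 5 \<Longrightarrow> even (c i)"
  using assms(1) dot_self_eq_0D[OF assms(2)] by force

section \<open>Case B: five squares are impossible\<close>

text \<open>General witness \<open>1, 1, 1, 2, (1 + sqrt q) / 2, 1 + f\<close>. Clearing the
  denominator 2 gives \<open>a\<close> the norm 33 = 4 + 4 + 4 + 16 + 1 + 4, of which 33 - 1 - 4 =
  28 lies outside two unit vectors. The bounds \<open>g \<ge> 2\<close> and \<open>k \<ge> 2\<close>
  keep \<open>b\<close>, \<open>c\<close> and \<open>d\<close> nonzero.\<close>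

lemma no_rep_B1:
  assumes cd: "\<And>i. i < 5 \<Longrightarrow> even (c i - d i)" and ab: "\<And>i. i < 5 \<Longrightarrow> even (a i - b i)"
    and norm: "dot a a + q * dot b b + p * dot c c + r * dot d d = 33 + q + p + r"
    and ip: "dot a b + g * dot c d = 1 + g" "dot a c + h * dot b d = 2" "dot a d + k * dot b c = 2"
    and "g \<ge> 2" "k \<ge> 2" "h > k" "q \<ge> 17" "p \<ge> 10" "r \<ge> 10" "p + r \<ge> 34" "g = 2 \<Longrightarrow> k \<noteq> 3"
  shows False
proof -
  define z w x y where "z = dot a a" and "w = dot b b" and "x = dot c c" and "y = dot d d"
  note defs = z_def[symmetric] w_def[symmetric] x_def[symmetric] y_def[symmetric]
  note norm = norm[unfolded defs]
  have z: "z \<ge> 0" by (simp add: z_def dot_self_nonneg)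
  have mod4: "4 dvd x - y" unfolding x_def y_def using cd by (rule dot_self_cong_mod4)
  have "y \<noteq> 0"
  proof
    assume "y = 0"
    then have d: "dot d d = 0" by (simp add: y_def)
    have "even (dot b c)" using dot_even[OF dot_zero_imp_even[OF cd d]] .
    then obtain t where "dot b c = 2 * t" by (rule evenE)
    with ip(3) dot_zero(2)[OF d] have "k * t = 1" by simp
    with \<open>k \<ge> 2\<close> show False by (simp add: zmult_eq_1_iff)
  qed
  moreover have "x \<noteq> 0"
  proof
    assume "x = 0"
    then have c: "dot c c = 0" by (simp add: x_def)
    have dc: "even (d i - c i)" if "i < 5" for i using cd[OF that] by simp
    have "even (dot b d)" using dot_even[OF dot_zero_imp_even[OF dc c]] .
    then obtain t where "dot b d = 2 * t" by (rule evenE)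
    with ip(2) dot_zero(2)[OF c] have "h * t = 1" by simp
    with \<open>k \<ge> 2\<close> \<open>h > k\<close> show False by (simp add: zmult_eq_1_iff)
  qed
  ultimately have xy: "x \<ge> 1" "y \<ge> 1"
    using dot_self_nonneg[of c] dot_self_nonneg[of d] by (simp_all add: defs)
  have "w \<noteq> 0"
  proof
    assume "w = 0"
    then have "dot a b = 0" using dot_zero(2) by (simp add: w_def)
    with ip(1) have "g * dot c d = g * 1 + 1" by simp
    then have "g dvd g * 1 + 1" by (metis dvd_triv_left)
    then have "g dvd 1" by (simp add: dvd_add_right_iff)
    with \<open>g \<ge> 2\<close> show False by simp
  qed
  then have "w \<ge> 1" using dot_self_nonneg[of b] by (simp add: defs)
  have P: "p \<le> p * x" "r \<le> r * y" "q \<le> q * w"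
    using mult_ge[OF xy(1), of p] mult_ge[OF xy(2), of r] mult_ge[OF \<open>w \<ge> 1\<close>, of q] assms by simp_all
  have "x < 5"
  proof (rule ccontr)
    assume "\<not> x < 5"
    then have "5 * p \<le> p * x" using \<open>p \<ge> 10\<close> by (intro mult_ge) auto
    with P norm z \<open>p \<ge> 10\<close> show False by linarith
  qed
  moreover have "y < 5"
  proof (rule ccontr)
    assume "\<not> y < 5"
    then have "5 * r \<le> r * y" using \<open>r \<ge> 10\<close> by (intro mult_ge) auto
    with P norm z \<open>r \<ge> 10\<close> show False by linarith
  qed
  ultimately have "x = y" using xy mod4 by presburger
  have "x < 2"
  proof (rule ccontr)
    assume "\<not> x < 2"
    then have "2 * p \<le> p * x" "2 * r \<le> r * y" using \<open>x = y\<close> \<open>p \<ge> 10\<close> \<open>r \<ge> 10\<close>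
      by (auto intro!: mult_ge)
    with P norm z \<open>p + r \<ge> 34\<close> show False by linarith
  qed
  with \<open>x = y\<close> xy have xy: "x = 1" "y = 1" by simp_all
  have odd: "odd (dot c d)" using dot_cong_mod2[of c d c] cd xy by (simp add: defs)
  from xy odd have cd1: "dot c d = 1 \<or> dot c d = -1" by (intro dot_unit_odd) (simp_all add: defs)
  then have "odd (dot a b)" using ip(1) by auto
  then have "odd w" using dot_cong_mod2[of a b b] ab by (simp add: dot_commute[of b a] defs)
  have "w < 3"
  proof (rule ccontr)
    assume "\<not> w < 3"
    then have "3 * q \<le> q * w" using \<open>q \<ge> 17\<close> by (intro mult_ge) auto
    with P norm z \<open>q \<ge> 17\<close> show False by linarith
  qed
  with \<open>w \<ge> 1\<close> \<open>odd w\<close> have w: "w = 1" by presburger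
  with norm xy have "z = 33" by simp
  from cd1 show False
  proof
    assume 1: "dot c d = 1"
    then have "dot v d = dot v c" for v using dot_same[of c d v] xy by (simp add: defs)
    with ip 1 have "dot a b = 1" "dot a c + h * dot b c = 2" "dot a c + k * dot b c = 2" by simp_all
    then have "h * dot b c = k * dot b c" by linarith
    with \<open>h > k\<close> have "dot b c = 0" by simp
    moreover have "dot a c = 2" using \<open>dot b c = 0\<close> \<open>dot a c + h * dot b c = 2\<close> by simp
    ultimately show False using no_two_unit_vectors[of b c a] w xy \<open>z = 33\<close> \<open>dot a b = 1\<close>
      by (simp add: defs)
  next
    \<comment> \<open>The branch \<open>d = - c\<close> survives these comparisons only for
      \<open>g = 2\<close>, \<open>k = 3\<close>, \<open>h = 7\<close>, the triple of the
      exceptional field.\<close>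
    assume m1: "dot c d = -1"
    then have opp: "dot v d = - dot v c" for v using dot_opp[of c d v] xy by (simp add: defs)
    have "dot b c \<in> {-1, 0, 1}" using w xy by (intro dot_unit_abs_le) (simp_all add: defs)
    moreover have eqs: "dot a b = 1 + 2 * g" "dot a c - h * dot b c = 2" "k * dot b c - dot a c = 2"
      using ip opp m1 by simp_all
    ultimately have bc: "dot b c = -1" "h - k = 4" using \<open>h > k\<close> by auto
    have "(1 + 2 * g)\<^sup>2 \<le> 33"
      using dot_Cauchy_Schwarz[of a b] \<open>z = 33\<close> w eqs(1) by (simp add: defs)
    moreover have "7\<^sup>2 \<le> (1 + 2 * g)\<^sup>2" if "g \<ge> 3" using that by (intro power_mono) auto
    ultimately have "g = 2" using \<open>g \<ge> 2\<close> by force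
    have "dot a c = - dot a b" using dot_opp[of b c a] bc w xy by (simp add: defs)
    with eqs bc \<open>g = 2\<close> have "k = 3" by simp
    with \<open>g = 2\<close> assms show False by simp
  qed
qed

text \<open>For the factors \<open>2, h, 3\<close>, so \<open>p = 6\<close>,
  \<open>q = 3 * h\<close>, \<open>r = 2 * h\<close>, with witness
  \<open>1, 1, 1, f, 1 + f, 1 + sqrt p\<close>. The intended solution has \<open>b = 0\<close>; a
  nonzero \<open>b\<close> fits the size comparison only for \<open>h = 11\<close>.\<close>

lemma no_rep_B2:
  assumes cd: "\<And>i. i < 5 \<Longrightarrow> even (c i - d i)" and ab: "\<And>i. i < 5 \<Longrightarrow> even (a i - b i)"
    and norm: "dot a a + 3 * h * dot b b + 6 * dot c c + 2 * h * dot d d = 56 + 4 * h"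
    and ip: "dot a b + 2 * dot c d = 4" "dot a c + h * dot b d = 6" "dot a d + 3 * dot b c = 2"
    and "h \<ge> 11" "odd h"
  shows False
proof -
  define z w x y where "z = dot a a" and "w = dot b b" and "x = dot c c" and "y = dot d d"
  note defs = z_def[symmetric] w_def[symmetric] x_def[symmetric] y_def[symmetric]
  note norm = norm[unfolded defs]
  have nonneg: "z \<ge> 0" "w \<ge> 0" "x \<ge> 0" "y \<ge> 0"
    by (simp_all add: z_def w_def x_def y_def dot_self_nonneg)
  have "dot a b = 2 * (2 - dot c d)" using ip(1) by simp
  then have "even (dot a b)" by simp
  then have "even w" using dot_cong_mod2[of a b b] ab by (simp add: dot_commute[of b a] defs)
  have y0: "y \<noteq> 0"
  proof
    assume "y = 0"
    then have "dot a d = 0" using dot_zero(2) by (simp add: y_def)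
    with ip(3) have "3 dvd (2 :: int)" by (metis add_0 dvd_triv_left)
    then show False by simp
  qed
  have H: "0 \<le> h * w" using nonneg \<open>h \<ge> 11\<close> by simp
  have "\<exists>i<5. odd (d i)"
  proof (rule ccontr)
    assume "\<not> ?thesis"
    then have d: "even (d i)" if "i < 5" for i using that by blast
    have c: "even (c i)" if "i < 5" for i using cd d that by (rule even_imp_cong)
    have "y \<ge> 4" using dot_self_even_ge_4[of d] d y0 by (simp add: y_def)
    then have Y: "4 * h \<le> h * y" using \<open>h \<ge> 11\<close> by (intro mult_ge) auto
    have "w < 1"
    proof (rule ccontr)
      assume "\<not> w < 1"
      then have "1 * h \<le> h * w" using \<open>h \<ge> 11\<close> by (intro mult_ge) auto
      with norm Y nonneg \<open>h \<ge> 11\<close> show False by simp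
    qed
    moreover have "x < 4" using norm Y nonneg H \<open>h \<ge> 11\<close> by linarith
    then have "x = 0" using dot_self_even_ge_4[of c] c by (auto simp: x_def)
    ultimately show False using ip(2) dot_zero[of b d] dot_zero(2)[of c a] nonneg
      by (simp add: defs)
  qed
  then obtain i where "i < 5" "odd (d i)" by blast
  then have xy: "x \<ge> 1" "y \<ge> 1" using odd_coordinate[of c d i] cd by (auto simp: defs)
  have Y: "1 * h \<le> h * y" using xy \<open>h \<ge> 11\<close> by (intro mult_ge) auto
  show False
  proof (cases "w = 0")
    case True
    then have b: "dot b b = 0" by (simp add: w_def)
    \<comment> \<open>Since \<open>a\<close> and \<open>b\<close> are congruent modulo 2,
      \<open>b = 0\<close> allows \<open>a\<close> to be halved, which restores the scaling of the
      rank three lemma.\<close>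
    have "even (a i)" if "i < 5" for i using dot_zero_imp_even[OF ab b that] .
    then obtain a' where a': "\<And>v. dot v a = 2 * dot v a'" "dot a a = 4 * dot a' a'"
      "\<And>i. i < 5 \<Longrightarrow> a i = 2 * a' i"
      using dot_half[of a] by blast
    have "dot a c = 2 * dot a' c" "dot a d = 2 * dot a' d"
      using a'(1)[of c] a'(1)[of d] by (simp_all add: dot_commute)
    then show False using norm ip dot_zero[OF b] True \<open>h \<ge> 11\<close> a'(2)
      by (intro no_rank_three_rep[of c d 1 6 "2 * h" a', OF cd]) (auto simp: defs)
  next
    case False
    with nonneg \<open>even w\<close> have "w \<ge> 2" by presburger
    then have W: "2 * h \<le> h * w" using \<open>h \<ge> 11\<close> by (intro mult_ge) auto
    with norm Y nonneg xy have "4 * h \<le> 50" by linarith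
    with \<open>h \<ge> 11\<close> \<open>odd h\<close> have h: "h = 11" by presburger
    with norm have norm: "z + 33 * w + 6 * x + 22 * y = 100" by simp
    have "w = 2" using norm \<open>w \<ge> 2\<close> xy nonneg by linarith
    moreover have "y = 1" using norm \<open>w = 2\<close> xy nonneg by linarith
    ultimately have "x \<le> 2" "z \<le> 6" using norm xy nonneg by linarith+
    have "z * x \<le> 6 * 2" using \<open>x \<le> 2\<close> \<open>z \<le> 6\<close> nonneg by (intro mult_mono) auto
    then have "\<bar>dot a c\<bar> \<le> 4" by (intro dot_abs_le) (simp_all add: defs)
    moreover have "dot a c + 11 * dot b d = 6" using ip(2) h by simp
    \<comment> \<open>The integers congruent to 6 modulo 11 nearest to 0 are 6 and -5.\<close>
    moreover have "u + 11 * v \<noteq> 6" if "\<bar>u\<bar> \<le> 4" for u v :: int using that by presburger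
    ultimately show False by blast
  qed
qed

text \<open>For \<open>g = 1\<close>, so \<open>p = k\<close>, \<open>q = h * k\<close>,
  \<open>r = h\<close>, with witness \<open>1, 1, 1, f, 1 + f, 2 + sqrt p\<close>. A nonzero
  \<open>b\<close> costs \<open>h * k\<close>, which is affordable only for \<open>h = 11\<close>,
  \<open>k = 7\<close>.\<close>

lemma no_rep_B3:
  assumes cd: "\<And>i. i < 5 \<Longrightarrow> even (c i - d i)" and ab: "\<And>i. i < 5 \<Longrightarrow> even (a i - b i)"
    and norm: "dot a a + h * k * dot b b + k * dot c c + h * dot d d = 32 + 6 * k + 2 * h"
    and ip: "dot a b + dot c d = 2" "dot a c + h * dot b d = 10" "dot a d + k * dot b c = 2"
    and "k \<ge> 7" "h \<ge> k + 4"
  shows False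
proof -
  define z w x y where "z = dot a a" and "w = dot b b" and "x = dot c c" and "y = dot d d"
  note defs = z_def[symmetric] w_def[symmetric] x_def[symmetric] y_def[symmetric]
  note norm = norm[unfolded defs]
  have nonneg: "z \<ge> 0" "w \<ge> 0" "x \<ge> 0" "y \<ge> 0"
    by (simp_all add: z_def w_def x_def y_def dot_self_nonneg)
  \<comment> \<open>The comparison \<open>h * k + k + h \<le> 32 + 6 * k + 2 * h\<close> is
    equivalent to an upper bound 37 for this product.\<close>
  have hk: "(h - 5) * (k - 1) = h * k - h - 5 * k + 5" by (simp add: algebra_simps)
  have hk6: "(h - 5) * 6 \<le> (h - 5) * (k - 1)" using assms by (intro mult_left_mono) auto
  show False
  proof (cases "w = 0")
    case True
    then have b: "dot b b = 0" by (simp add: w_def)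
    have "even (a i)" if "i < 5" for i using dot_zero_imp_even[OF ab b that] .
    then obtain a' where a': "\<And>v. dot v a = 2 * dot v a'" "dot a a = 4 * dot a' a'"
      "\<And>i. i < 5 \<Longrightarrow> a i = 2 * a' i"
      using dot_half[of a] by blast
    have "dot a c = 2 * dot a' c" "dot a d = 2 * dot a' d"
      using a'(1)[of c] a'(1)[of d] by (simp_all add: dot_commute)
    then show False using norm ip dot_zero[OF b] True assms a'(2)
      by (intro no_rank_three_rep[of c d 2 k h a', OF cd]) (auto simp: defs)
  next
    case False
    with nonneg have "w \<ge> 1" by simp
    then have W: "1 * (h * k) \<le> h * k * w" using assms by (intro mult_ge) auto
    have y0: "y \<noteq> 0"
    proof
      assume "y = 0"
      then have d: "dot d d = 0" by (simp add: y_def)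
      have "even (dot b c)" using dot_even[OF dot_zero_imp_even[OF cd d]] .
      then obtain t where "dot b c = 2 * t" by (rule evenE)
      with ip(3) dot_zero(2)[OF d] have "k * t = 1" by simp
      with \<open>k \<ge> 7\<close> show False by (simp add: zmult_eq_1_iff)
    qed
    have X: "0 \<le> k * x" using nonneg assms by simp
    have "\<exists>i<5. odd (d i)"
    proof (rule ccontr)
      assume "\<not> ?thesis"
      then have d: "even (d i)" if "i < 5" for i using that by blast
      have "y \<ge> 4" using dot_self_even_ge_4[of d] d y0 by (simp add: y_def)
      then have Y: "4 * h \<le> h * y" using assms by (intro mult_ge) auto
      have "7 * h + 5 * k - 35 \<le> h * k" using hk6 hk by (simp add: left_diff_distrib)
      with W Y X norm nonneg \<open>k \<ge> 7\<close> \<open>h \<ge> k + 4\<close> show False by linarith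
    qed
    then obtain i where "i < 5" "odd (d i)" by blast
    then have xy: "x \<ge> 1" "y \<ge> 1" using odd_coordinate[of c d i] cd by (auto simp: defs)
    have XY: "1 * k \<le> k * x" "1 * h \<le> h * y" using xy assms by (auto intro!: mult_ge)
    have "(h - 5) * (k - 1) \<le> 37" using W XY norm nonneg hk by linarith
    with hk6 have "(h - 5) * 6 \<le> 37" by (rule order_trans)
    with assms have hk: "h = 11" "k = 7" by presburger+
    with norm have eq: "z + 77 * w + 7 * x + 11 * y = 96" by simp
    then have "w = 1" "x = 1" "y = 1" using \<open>w \<ge> 1\<close> xy nonneg by linarith+
    with eq have "z = 1" by simp
    with \<open>y = 1\<close> have "\<bar>dot a d\<bar> \<le> 1" by (intro dot_abs_le) (simp_all add: defs)
    moreover have "dot a d + 7 * dot b c = 2" using ip(3) hk by simp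
    moreover have "u + 7 * v \<noteq> 2" if "\<bar>u\<bar> \<le> 1" for u v :: int using that by presburger
    ultimately show False by blast
  qed
qed

text \<open>For \<open>k = 1\<close>, so \<open>r = p * q\<close>, which is large enough to force
  \<open>d = 0\<close>; then \<open>c\<close> is twice a unit vector \<open>c'\<close>. The witness
  \<open>1, 1, 1, (1 + sqrt q) / 2, (3 + sqrt q) / 2, 1 + sqrt p\<close> gives \<open>a\<close>,
  \<open>b\<close>, \<open>c'\<close> the norms 26, 2, 1, and removing the coordinate of
  \<open>c'\<close> leaves 26 - 4 = 22.\<close>

lemma no_rep_B4:
  assumes cd: "\<And>i. i < 5 \<Longrightarrow> even (c i - d i)" and ab: "\<And>i. i < 5 \<Longrightarrow> even (a i - b i)"
    and norm: "dot a a + q * dot b b + p * dot c c + p * q * dot d d = 26 + 2 * q + 4 * p"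
    and ip: "dot a b + p * dot c d = 4" "dot a c + q * dot b d = 4" "dot a d + dot b c = 0"
    and "p \<ge> 6" "q \<ge> 13"
  shows False
proof -
  define z w x y where "z = dot a a" and "w = dot b b" and "x = dot c c" and "y = dot d d"
  note defs = z_def[symmetric] w_def[symmetric] x_def[symmetric] y_def[symmetric]
  note norm = norm[unfolded defs]
  have nonneg: "z \<ge> 0" "w \<ge> 0" "x \<ge> 0" "y \<ge> 0"
    by (simp_all add: z_def w_def x_def y_def dot_self_nonneg)
  have WX: "0 \<le> q * w" "0 \<le> p * x" using nonneg assms by simp_all
  have pq: "(p - 2) * 13 \<le> (p - 2) * q" using assms by (intro mult_left_mono) auto
  have "y < 1"
  proof (rule ccontr)
    assume "\<not> y < 1"
    then have "1 * (p * q) \<le> p * q * y" using assms by (intro mult_ge) auto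
    moreover have "p * 13 - 26 \<le> p * q - 2 * q" using pq by (simp add: left_diff_distrib)
    ultimately show False using norm WX nonneg \<open>p \<ge> 6\<close> by linarith
  qed
  with nonneg have "y = 0" by simp
  then have d: "dot d d = 0" by (simp add: y_def)
  have "even (c i)" if "i < 5" for i using dot_zero_imp_even[OF cd d that] .
  then obtain c' where c': "\<And>v. dot v c = 2 * dot v c'" "dot c c = 4 * dot c' c'"
    "\<And>i. i < 5 \<Longrightarrow> c i = 2 * c' i"
    using dot_half[of c] by blast
  define x' where "x' = dot c' c'"
  have eqs: "dot a b = 4" "dot a c' = 2" "dot b c' = 0"
    using ip dot_zero[OF d] c'(1)[of a] c'(1)[of b] by simp_all
  have norm': "z + q * w + 4 * (p * x') = 26 + 2 * q + 4 * p"
    using norm c'(2) \<open>y = 0\<close> by (simp add: x_def x'_def)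
  have "even w" using dot_cong_mod2[of a b b] ab eqs(1) by (simp add: dot_commute[of b a] defs)
  have "x' \<noteq> 0" using dot_zero(2)[of c' a] eqs by (auto simp: x'_def)
  then have "x' \<ge> 1" using dot_self_nonneg[of c'] by (simp add: x'_def)
  then have P: "1 * p \<le> p * x'" using assms by (intro mult_ge) auto
  have "w \<noteq> 0" using dot_zero(2)[of b a] eqs by (auto simp: w_def)
  with \<open>even w\<close> nonneg have "w = 2 \<or> w \<ge> 4" by presburger
  have cs: "16 \<le> z * w" using dot_Cauchy_Schwarz[of a b] eqs by (simp add: defs)
  have "w = 2"
  proof (rule ccontr)
    assume "w \<noteq> 2"
    with \<open>w = 2 \<or> w \<ge> 4\<close> have "4 * q \<le> q * w" using assms by (intro mult_ge) auto
    with norm' P \<open>q \<ge> 13\<close> nonneg have "z = 0" by linarith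
    with cs show False by simp
  qed
  have "x' < 2"
  proof (rule ccontr)
    assume "\<not> x' < 2"
    then have "2 * p \<le> p * x'" using assms by (intro mult_ge) auto
    moreover have "z + 4 * (p * x') = 26 + 4 * p" using norm' \<open>w = 2\<close> by simp
    ultimately have "z \<le> 2" using \<open>p \<ge> 6\<close> by linarith
    with cs \<open>w = 2\<close> show False by simp
  qed
  with \<open>x' \<ge> 1\<close> have "x' = 1" by simp
  with norm' \<open>w = 2\<close> have "z = 26" by simp
  then show False using no_root_and_unit_vector[of b c' a] \<open>w = 2\<close> \<open>x' = 1\<close> eqs
    by (simp add: defs x'_def)
qed

section \<open>Case C: five squares are impossible\<close>

text \<open>The branch \<open>d = 0\<close>, with coordinates in halves. The last square of the
  witness is that of \<open>(N + sqrt p) / 2\<close>, and 29 is 28 = 4 + 4 + 4 + 16 plus the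
  contribution 1 of \<open>(1 + sqrt q) / 2\<close>. If \<open>b\<close> and \<open>c\<close> have
  norms 1 and 2 in some order, the norm of \<open>a\<close> is 1 modulo 4, while the congruence
  between the vectors demands 3.\<close>

lemma no_rep_even_C:
  assumes abc: "\<And>i. i < 5 \<Longrightarrow> even (a i - (b i + c i))"
    and norm: "dot a a + q * dot b b + p * dot c c = 29 + N\<^sup>2 + p + q"
    and ip: "dot a b = 1" "dot a c = N" "dot b c = 0"
    and "4 dvd p - 1" "4 dvd q - 1" "odd N" "2 * p > 29 + N\<^sup>2" "q > p"
  shows False
proof -
  define z w x where "z = dot a a" and "w = dot b b" and "x = dot c c"
  note defs = z_def[symmetric] w_def[symmetric] x_def[symmetric]
  note norm = norm[unfolded defs]
  have p: "p \<ge> 0" using assms(9) zero_le_power2[of N] by linarith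
  have "N \<noteq> 0" using \<open>odd N\<close> by auto
  have z: "z \<ge> 0" by (simp add: z_def dot_self_nonneg)
  have "w \<noteq> 0" using dot_zero(2)[of b a] ip by (auto simp: w_def)
  then have "w \<ge> 1" using dot_self_nonneg[of b] by (simp add: w_def)
  have "x \<noteq> 0" using dot_zero(2)[of c a] ip \<open>N \<noteq> 0\<close> by (auto simp: x_def)
  then have "x \<ge> 1" using dot_self_nonneg[of c] by (simp add: x_def)
  have P: "1 * q \<le> q * w" "1 * p \<le> p * x" using mult_ge[OF \<open>w \<ge> 1\<close>, of q] mult_ge[OF \<open>x \<ge> 1\<close>, of p] p \<open>q > p\<close> by simp_all
  have "x < 3"
  proof (rule ccontr)
    assume "\<not> x < 3"
    then have "3 * p \<le> p * x" using p by (intro mult_ge) auto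
    with P norm z assms show False by linarith
  qed
  have "w < 3"
  proof (rule ccontr)
    assume "\<not> w < 3"
    then have "3 * q \<le> q * w" using p \<open>q > p\<close> by (intro mult_ge) auto
    with P norm z assms show False by linarith
  qed
  have "4 dvd dot a a - dot (\<lambda>i. b i + c i) (\<lambda>i. b i + c i)"
    using abc by (rule dot_self_cong_mod4)
  then have mod4: "4 dvd z - (w + x)" using ip(3)
    by (simp add: dot_linear dot_commute[of c b] defs add.commute diff_diff_eq)
  obtain m where "N = 2 * m + 1" using \<open>odd N\<close> by (rule oddE)
  then have "N\<^sup>2 = 4 * (m * m + m) + 1" by (simp add: power2_eq_square algebra_simps)
  then have N4: "4 dvd N\<^sup>2 - 1" by simp
  from \<open>w \<ge> 1\<close> \<open>w < 3\<close> \<open>x \<ge> 1\<close> \<open>x < 3\<close>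
  consider "w = 1" "x = 1" | "w = 1" "x = 2" | "w = 2" "x = 1" | "w = 2" "x = 2" by linarith
  then show False
  proof cases
    case 1
    with norm have "z = 29 + N\<^sup>2" by simp
    with 1 ip show False using no_two_unit_vectors[of b c a] by (simp add: defs)
  next
    case 2
    with norm have "z = 29 + N\<^sup>2 - p" by simp
    with 2 mod4 N4 \<open>4 dvd p - 1\<close> show False by presburger
  next
    case 3
    with norm have "z = 29 + N\<^sup>2 - q" by simp
    with 3 mod4 N4 \<open>4 dvd q - 1\<close> show False by presburger
  next
    case 4
    with norm have "z = 29 + N\<^sup>2 - q - p" by simp
    with z assms show False by linarith
  qed
qed

lemma dot_scaled:
  assumes "\<forall>i<5. b i = s * b' i" "\<forall>i<5. c i = t * c' i"
  shows "dot b c = s * t * dot b' c'"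
proof -
  have "dot b c = dot (\<lambda>i. s * b' i) (\<lambda>i. t * c' i)" using assms by (intro dot_cong) auto
  then show ?thesis by (simp add: dot_linear)
qed

lemma dot_double:
  assumes "\<forall>i<5. b i = 2 * b' i" "\<forall>i<5. c i = 2 * c' i"
  shows "dot b c = 4 * dot b' c'"
  using dot_scaled[OF assms] by simp

text \<open>A necessary condition for \<open>(a + b sqrt q + c sqrt p + d sqrt r) / 4\<close> to be integral in
  case C.\<close>

definition quarter_integral :: "int \<Rightarrow> int \<Rightarrow> int \<Rightarrow> int \<Rightarrow> bool" where
  "quarter_integral a b c d \<longleftrightarrow> odd a \<and> odd b \<and> odd c \<and> odd d \<or>
     even a \<and> even b \<and> even c \<and> even d \<and> 4 dvd a + b + c + d"

lemma quarter_integral_halves: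
  fixes a b c d :: "nat \<Rightarrow> int"
  assumes "\<And>i. i < 5 \<Longrightarrow> quarter_integral (a i) (b i) (c i) (d i)" "\<And>i. i < 5 \<Longrightarrow> even (d i)"
  obtains a' b' c' d' where "\<forall>i<5. a i = 2 * a' i" "\<forall>i<5. b i = 2 * b' i"
    "\<forall>i<5. c i = 2 * c' i" "\<forall>i<5. d i = 2 * d' i"
    "\<forall>i<5. even (a' i + b' i + c' i + d' i)"
proof -
  define a' b' c' d' where "a' = (\<lambda>i. a i div 2)" and "b' = (\<lambda>i. b i div 2)"
    and "c' = (\<lambda>i. c i div 2)" and "d' = (\<lambda>i. d i div 2)"
  note defs = a'_def b'_def c'_def d'_def
  have ev: "even (a i)" "even (b i)" "even (c i)" "even (d i)" and four: "4 dvd a i + b i + c i + d i"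
    if "i < 5" for i using assms(1,2)[OF that] by (auto simp: quarter_integral_def)
  have "even (a' i + b' i + c' i + d' i)" if "i < 5" for i
    using ev[OF that] four[OF that] unfolding defs by presburger
  moreover have "a i = 2 * a' i" "b i = 2 * b' i" "c i = 2 * c' i" "d i = 2 * d' i" if "i < 5" for i
    using ev[OF that] by (simp_all add: defs)
  ultimately show ?thesis using that[of a' b' c' d'] by simp
qed

lemma odd_square_mod8: "odd (x::int) \<Longrightarrow> 8 dvd x * x - 1"
proof -
  assume "odd x"
  then obtain m where m: "x = 2 * m + 1" by (rule oddE)
  have "even (m * (m + 1))" by simp
  then obtain t where "m * (m + 1) = 2 * t" by (rule evenE)
  then have "x * x - 1 = 8 * t" unfolding m by (simp add: algebra_simps)
  then show ?thesis by simp
qed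

text \<open>Odd coordinates have squares 1 modulo 8, and the expression reduces to
  \<open>p + q + r - 3\<close>; even coordinates have halves with even sum. Summed over five
  squares, this lets the rational part of the total decide the parity of
  \<open>dot d d\<close>.\<close>

lemma quarter_norm_mod8:
  assumes "quarter_integral a b c d" "odd p" "odd q" "odd r" "8 dvd p + q + r - 3"
  shows "8 dvd a * a + q * (b * b) + p * (c * c) + r * (d * d) - 4 * (d * d)"
proof (cases "odd d")
  case True
  with assms(1) have "8 dvd a * a - 1" "8 dvd b * b - 1" "8 dvd c * c - 1" "8 dvd d * d - 1"
    by (auto simp: quarter_integral_def odd_square_mod8)
  then have "8 dvd (a * a - 1) + q * (b * b - 1) + p * (c * c - 1) + (r - 4) * (d * d - 1) + (p + q + r - 3)"
    using assms(5) by (intro dvd_add dvd_mult)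
  then show ?thesis by (simp add: algebra_simps)
next
  case False
  with assms(1) have "even a" "even b" "even c" "even d" and 4: "4 dvd a + b + c + d"
    by (auto simp: quarter_integral_def)
  then obtain a' b' c' d' where *: "a = 2 * a'" "b = 2 * b'" "c = 2 * c'" "d = 2 * d'" by (meson evenE)
  have "even (a' + b' + c' + d')" using 4 unfolding * by presburger
  then have "even (a' * a' + q * (b' * b') + p * (c' * c') + (r - 4) * (d' * d'))"
    using assms(2-4) by auto
  then obtain t where "a' * a' + q * (b' * b') + p * (c' * c') + (r - 4) * (d' * d') = 2 * t" by (rule evenE)
  then have "a * a + q * (b * b) + p * (c * c) + r * (d * d) - 4 * (d * d) = 8 * t"
    unfolding * by (simp add: algebra_simps)
  then show ?thesis by simp
qed

lemma dot_quarter_even: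
  assumes "\<And>i. i < 5 \<Longrightarrow> quarter_integral (a i) (b i) (c i) (d i)"
    and "odd p" "odd q" "odd r" "8 dvd p + q + r - 3"
    and "8 dvd dot a a + q * dot b b + p * dot c c + r * dot d d"
  shows "even (dot d d)"
proof -
  have "8 dvd (\<Sum>i<5. a i * a i + q * (b i * b i) + p * (c i * c i) + r * (d i * d i) - 4 * (d i * d i))"
    using assms by (intro dvd_sum quarter_norm_mod8) auto
  then have "8 dvd dot a a + q * dot b b + p * dot c c + r * dot d d - 4 * dot d d"
    by (simp add: dot_def sum.distrib sum_subtractf sum_distrib_left)
  from dvd_diff[OF assms(6) this] have "8 dvd 4 * dot d d" by simp
  moreover have "even n" if "8 dvd 4 * n" for n :: int using that by presburger
  ultimately show ?thesis by blast
qed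

text \<open>For \<open>k = 1\<close>, so \<open>r = p * q\<close>, which is too large for a nonzero
  \<open>d\<close>; the witness is
  \<open>1, 1, 1, 2, (1 + sqrt q) / 2, (1 + sqrt p) / 2\<close>.\<close>

lemma no_rep_C1:
  assumes qi: "\<And>i. i < 5 \<Longrightarrow> quarter_integral (a i) (b i) (c i) (d i)"
    and norm: "dot a a + q * dot b b + p * dot c c + p * q * dot d d = 120 + 4 * p + 4 * q"
    and ip: "dot a b + p * dot c d = 4" "dot a c + q * dot b d = 4" "dot a d + dot b c = 0"
    and "4 dvd p - 1" "4 dvd q - 1" "p \<ge> 17" "q > p"
  shows False
proof -
  have nonneg: "0 \<le> dot a a" "0 \<le> q * dot b b" "0 \<le> p * dot c c" "0 \<le> dot d d"
    using \<open>p \<ge> 17\<close> \<open>q > p\<close> by (simp_all add: dot_self_nonneg)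
  have "(p - 4) * 13 \<le> (p - 4) * (q - 4)" using assms by (intro mult_left_mono) auto
  then have pq: "17 * p + 4 * q - 68 \<le> p * q" by (simp add: algebra_simps)
  have "dot d d < 1"
  proof (rule ccontr)
    assume "\<not> dot d d < 1"
    then have "1 * (p * q) \<le> p * q * dot d d" using assms by (intro mult_ge) auto
    with norm nonneg pq \<open>p \<ge> 17\<close> show False by linarith
  qed
  with nonneg have d: "dot d d = 0" by simp
  have evd: "even (d i)" if "i < 5" for i using dot_self_eq_0D[OF d that] by simp
  obtain a' b' c' d' where h: "\<forall>i<5. a i = 2 * a' i" "\<forall>i<5. b i = 2 * b' i"
    "\<forall>i<5. c i = 2 * c' i" "\<forall>i<5. d i = 2 * d' i"
    "\<forall>i<5. even (a' i + b' i + c' i + d' i)"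
    by (rule quarter_integral_halves[of a b c d, OF qi evd])
  have "even (a' i - (b' i + c' i))" if "i < 5" for i
    using h(4)[rule_format, OF that] h(5)[rule_format, OF that] dot_self_eq_0D[OF d that] by auto
  then show False
    using norm ip dot_zero[OF d] d assms
    by (intro no_rep_even_C[of a' b' c' q p 1])
      (simp_all add: dot_double[OF h(1,1)] dot_double[OF h(2,2)] dot_double[OF h(3,3)]
        dot_double[OF h(1,2)] dot_double[OF h(1,3)] dot_double[OF h(2,3)])
qed

text \<open>For \<open>p = 13\<close> and \<open>k = 1\<close>, where \<open>2 * p\<close> does not
  exceed 29 + 1 as the unit vector argument with \<open>N = 1\<close> requires. The witness
  \<open>1, 1, 1, (1 + sqrt q) / 2, (3 + sqrt q) / 2, (1 + sqrt p) / 2\<close> has norms 23, 2, 1 in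
  halves, and 23 - 1 = 22 gives the obstruction with a root and a unit vector.\<close>

lemma no_rep_C3:
  assumes qi: "\<And>i. i < 5 \<Longrightarrow> quarter_integral (a i) (b i) (c i) (d i)"
    and norm: "dot a a + q * dot b b + 13 * dot c c + 13 * q * dot d d = 144 + 8 * q"
    and ip: "dot a b + 13 * dot c d = 16" "dot a c + q * dot b d = 4" "dot a d + dot b c = 0"
    and "4 dvd q - 1" "q \<ge> 17"
  shows False
proof -
  have nonneg: "0 \<le> dot a a" "0 \<le> q * dot b b" "0 \<le> dot c c" "0 \<le> dot d d"
    using \<open>q \<ge> 17\<close> by (simp_all add: dot_self_nonneg)
  have "8 dvd 144 + 8 * q" by simp
  then have "8 dvd dot a a + q * dot b b + 13 * dot c c + 13 * q * dot d d" by (simp only: norm)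
  moreover have "8 dvd 13 + q + 13 * q - 3" "odd q" using \<open>4 dvd q - 1\<close> by presburger+
  \<comment> \<open>For small \<open>q\<close> the size comparison admits
    \<open>dot d d = 1\<close>, so parity is needed to reach \<open>d = 0\<close>.\<close>
  ultimately have ev: "even (dot d d)" using qi by (intro dot_quarter_even[of a b c d 13 q "13 * q"]) auto
  have "dot d d < 2"
  proof (rule ccontr)
    assume "\<not> dot d d < 2"
    then have "2 * (13 * q) \<le> 13 * q * dot d d" using assms by (intro mult_ge) auto
    with norm nonneg \<open>q \<ge> 17\<close> show False by linarith
  qed
  with nonneg ev have d: "dot d d = 0" by presburger
  have evd: "even (d i)" if "i < 5" for i using dot_self_eq_0D[OF d that] by simp
  obtain a' b' c' d' where h: "\<forall>i<5. a i = 2 * a' i" "\<forall>i<5. b i = 2 * b' i"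
    "\<forall>i<5. c i = 2 * c' i" "\<forall>i<5. d i = 2 * d' i"
    "\<forall>i<5. even (a' i + b' i + c' i + d' i)"
    by (rule quarter_integral_halves[of a b c d, OF qi evd])
  have abc: "even (a' i - (b' i + c' i))" if "i < 5" for i
    using h(4)[rule_format, OF that] h(5)[rule_format, OF that] dot_self_eq_0D[OF d that] by auto
  define z w x where "z = dot a' a'" and "w = dot b' b'" and "x = dot c' c'"
  note defs = z_def[symmetric] w_def[symmetric] x_def[symmetric]
  note dd = dot_double[OF h(1,1)] dot_double[OF h(2,2)] dot_double[OF h(3,3)]
        dot_double[OF h(1,2)] dot_double[OF h(1,3)] dot_double[OF h(2,3)]
  have eqs: "dot a' b' = 4" "dot a' c' = 1" "dot b' c' = 0" "z + q * w + 13 * x = 36 + 2 * q"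
    using norm ip dot_zero[OF d] d by (simp_all add: dd defs)
  have "even w" "odd x"
    using dot_cong_mod2[of a' "\<lambda>i. b' i + c' i" b'] dot_cong_mod2[of a' "\<lambda>i. b' i + c' i" c'] abc eqs
    by (simp_all add: dot_linear dot_commute[of b' a'] dot_commute[of c' a'] dot_commute[of c' b'] defs)
  have nn: "z \<ge> 0" "w \<ge> 0" "x \<ge> 0" by (simp_all add: z_def w_def x_def dot_self_nonneg)
  with \<open>odd x\<close> have "x \<ge> 1" by presburger
  have "w \<noteq> 0" using dot_zero(2)[of b' a'] eqs by (auto simp: w_def)
  have "w < 3"
  proof (rule ccontr)
    assume "\<not> w < 3"
    with \<open>even w\<close> have "w \<ge> 4" by presburger
    then have "4 * q \<le> q * w" using assms by (intro mult_ge) auto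
    with eqs(4) nn \<open>x \<ge> 1\<close> \<open>q \<ge> 17\<close> show False by linarith
  qed
  with nn \<open>w \<noteq> 0\<close> \<open>even w\<close> have "w = 2" by presburger
  with eqs(4) have "z + 13 * x = 36" by simp
  with nn \<open>odd x\<close> \<open>x \<ge> 1\<close> have "x = 1" by presburger
  with \<open>z + 13 * x = 36\<close> have "z = 23" by simp
  then show False using no_root_and_unit_vector[of b' c' a'] \<open>w = 2\<close> \<open>x = 1\<close> eqs by (simp add: defs)
qed

text \<open>For \<open>k \<ge> 3\<close> the radicand \<open>r\<close> need not be large compared
  with \<open>q\<close>, so genuine quarters, with all coordinates odd, cannot be excluded by size
  alone. The witness therefore ends with \<open>(3 + sqrt p) / 2\<close>, and the resulting value 12
  in the second relation serves to exclude them.\<close>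

lemma no_rep_C2:
  assumes qi: "\<And>i. i < 5 \<Longrightarrow> quarter_integral (a i) (b i) (c i) (d i)"
    and norm: "dot a a + q * dot b b + p * dot c c + r * dot d d = 152 + 4 * p + 4 * q"
    and ip: "dot a b + g * dot c d = 4" "dot a c + h * dot b d = 12" "dot a d + k * dot b c = 0"
    and pqr: "p = g * k" "q = h * k" "r = g * h"
    and ghk: "k \<ge> 3" "g \<ge> k + 4" "h \<ge> g + 4" "4 dvd g - k" "4 dvd h - k" "odd k"
  shows False
proof -
  have hg: "(k + 4) * h \<le> g * h" "g * k + 4 * k \<le> h * k"
    using ghk mult_right_mono[of "g + 4" h k] by (auto intro: mult_right_mono simp: algebra_simps)
  have gk: "7 * 3 \<le> g * k" "7 * 11 \<le> g * h" using ghk by (intro mult_mono; simp)+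
  have p: "p \<ge> 21" and r: "r \<ge> 77" "r \<ge> q + 4 * h" and q: "q \<ge> p + 12"
    using hg gk ghk pqr by (auto simp: algebra_simps)
  have mod4: "4 dvd p - 1" "4 dvd q - 1"
  proof -
    have "4 dvd k * k - 1" using odd_square_mod8[OF \<open>odd k\<close>] by presburger
    moreover have "4 dvd (g - k) * k" "4 dvd (h - k) * k" using ghk by simp_all
    ultimately have "4 dvd (g - k) * k + (k * k - 1)" "4 dvd (h - k) * k + (k * k - 1)" by (simp_all add: dvd_add)
    then show "4 dvd p - 1" "4 dvd q - 1" by (simp_all add: pqr algebra_simps)
  qed
  define z w x y where "z = dot a a" and "w = dot b b" and "x = dot c c" and "y = dot d d"
  note defs = z_def[symmetric] w_def[symmetric] x_def[symmetric] y_def[symmetric]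
  note norm' = norm[unfolded defs]
  have nonneg: "z \<ge> 0" "w \<ge> 0" "x \<ge> 0" "y \<ge> 0"
    by (simp_all add: z_def w_def x_def y_def dot_self_nonneg)
  show False
  proof (cases "\<forall>i<5. even (d i)")
    case True
    then have evd: "\<And>i. i < 5 \<Longrightarrow> even (d i)" by blast
    obtain a' b' c' d' where h: "\<forall>i<5. a i = 2 * a' i" "\<forall>i<5. b i = 2 * b' i"
      "\<forall>i<5. c i = 2 * c' i" "\<forall>i<5. d i = 2 * d' i"
      "\<forall>i<5. even (a' i + b' i + c' i + d' i)"
      by (rule quarter_integral_halves[of a b c d, OF qi evd])
    note dd = dot_double[OF h(1,1)] dot_double[OF h(2,2)] dot_double[OF h(3,3)] dot_double[OF h(4,4)]
        dot_double[OF h(1,2)] dot_double[OF h(1,3)] dot_double[OF h(1,4)]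
        dot_double[OF h(2,3)] dot_double[OF h(2,4)] dot_double[OF h(3,4)]
    have eqs: "dot a' a' + q * dot b' b' + p * dot c' c' + r * dot d' d' = 38 + p + q"
      "dot a' b' + g * dot c' d' = 1" "dot a' c' + h * dot b' d' = 3" "dot a' d' + k * dot b' c' = 0"
      using norm ip by (simp_all add: dd)
    have nn: "0 \<le> dot a' a'" "0 \<le> dot b' b'" "0 \<le> dot c' c'" "0 \<le> dot d' d'" "0 \<le> q * dot b' b'"
      using q p by (simp_all add: dot_self_nonneg)
    show False
    proof (cases "dot d' d' = 0")
      case d: True
      then have d0: "d' i = 0" if "i < 5" for i using dot_self_eq_0D that by blast
      have "dot b' c' = 0" using eqs(4) dot_zero[OF d] \<open>k \<ge> 3\<close> by simp
      moreover have "even (a' i - (b' i + c' i))" if "i < 5" for i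
        using h(5)[rule_format, OF that] d0[OF that] by auto
      ultimately show False using eqs dot_zero[OF d] d mod4 p q
        by (intro no_rep_even_C[of a' b' c' q p 3]) simp_all
    next
      case False
      with nn have "1 * r \<le> r * dot d' d'" using r by (intro mult_ge) auto
      moreover have "dot b' b' \<noteq> 0"
      proof
        assume "dot b' b' = 0"
        then have "g * dot c' d' = 1" using eqs(2) dot_zero(2)[of b' a'] by simp
        with ghk show False by (simp add: zmult_eq_1_iff)
      qed
      with nn have "1 * q \<le> q * dot b' b'" using q p by (intro mult_ge) auto
      moreover have "dot c' c' \<noteq> 0"
      proof
        assume "dot c' c' = 0"
        then have "h * dot b' d' = 3" using eqs(3) dot_zero(2)[of c' a'] by simp
        then have "h dvd 3" by (metis dvd_triv_left)
        with ghk show False by (simp add: zdvd_not_zless)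
      qed
      with nn have "1 * p \<le> p * dot c' c'" using p by (intro mult_ge) auto
      ultimately show False using eqs(1) nn r by linarith
    qed
  next
    case False
    then obtain i where i: "i < 5" "odd (d i)" by blast
    then have odd: "odd (a i)" "odd (b i)" "odd (c i)" using qi[OF i(1)] by (auto simp: quarter_integral_def)
    have bd: "even (b i - d i)" and cd: "even (c i - d i)" and bc: "even (b i - c i)" if "i < 5" for i
      using qi[OF that] by (auto simp: quarter_integral_def)
    obtain s t where st: "g - k = 4 * s" "h - k = 4 * t" using ghk by (meson dvdE)
    then have "g = k + 4 * s" "h = k + 4 * t" by simp_all
    \<comment> \<open>Since \<open>g\<close>, \<open>h\<close>, \<open>k\<close> agree modulo 4,
      each linear term of the expansion around \<open>k\<close> occurs twice, which yields a
      congruence modulo 8.\<close>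
    then have "p + q + r - 3 = 3 * (k * k - 1) + 8 * (s * k + t * k + 2 * (s * t))"
      by (simp add: pqr algebra_simps)
    moreover have "8 dvd 3 * (k * k - 1) + 8 * (s * k + t * k + 2 * (s * t))"
      by (rule dvd_add[OF dvd_mult[OF odd_square_mod8[OF \<open>odd k\<close>]] dvd_triv_left])
    ultimately have "8 dvd p + q + r - 3" by metis
    have "odd g" "odd h" using \<open>g = _\<close> \<open>h = _\<close> \<open>odd k\<close> by simp_all
    then have odds: "odd p" "odd q" "odd r" using \<open>odd k\<close> by (simp_all add: pqr)
    then have "8 dvd 152 + 4 * p + 4 * q" by presburger
    then have "8 dvd dot a a + q * dot b b + p * dot c c + r * dot d d" by (simp only: norm)
    with qi odds \<open>8 dvd p + q + r - 3\<close> have "even y"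
      unfolding y_def by (intro dot_quarter_even[of a b c d p q r]) auto
    have "4 dvd w - y" "4 dvd x - y" unfolding w_def x_def y_def
      using bd cd by (auto intro: dot_self_cong_mod4)
    moreover have "z \<ge> 1" "w \<ge> 1" "x \<ge> 1" "y \<ge> 1"
      unfolding z_def w_def x_def y_def using i odd by (blast intro: dot_odd_ge_1)+
    ultimately have ge: "w \<ge> 2" "x \<ge> 2" "y \<ge> 2" and cong: "y < 4 \<Longrightarrow> y = 2" "y = 2 \<Longrightarrow> w < 6 \<Longrightarrow> w = 2"
      "y = 2 \<Longrightarrow> x = 2 \<or> x = 6 \<or> x \<ge> 10" using \<open>even y\<close> by presburger+
    have evs: "even (dot b d)" "even (dot c d)" "even (dot b c)"
    proof -
      have "even w" using \<open>even y\<close> \<open>4 dvd w - y\<close> by presburger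
      then show "even (dot b d)" "even (dot c d)" "even (dot b c)"
        using dot_cong_mod2[of b d d, OF bd] dot_cong_mod2[of c d d, OF cd]
          dot_cong_mod2[of b c b, OF bc] \<open>even y\<close>
        by (simp_all add: dot_commute[of d b] dot_commute[of d c] defs)
    qed
    have W: "2 * q \<le> q * w" "2 * p \<le> p * x" "2 * r \<le> r * y" using ge p q r by (auto intro!: mult_ge)
    have "y < 4"
    proof (rule ccontr)
      assume "\<not> y < 4"
      then have "4 * r \<le> r * y" using r by (intro mult_ge) auto
      with W norm' nonneg p q r ghk show False by linarith
    qed
    with cong have y: "y = 2" by blast
    have "w < 6"
    proof (rule ccontr)
      assume "\<not> w < 6"
      then have "6 * q \<le> q * w" using p q by (intro mult_ge) auto
      with W norm' nonneg p q r show False by linarith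
    qed
    with cong y have w: "w = 2" by blast
    with norm' y have norm2: "z + p * x + 2 * r = 152 + 4 * p + 2 * q" by simp
    from cong(3)[OF y] have "x = 2 \<or> x \<ge> 6" by linarith
    have bd2: "dot b d = 2 \<or> dot b d = 0 \<or> dot b d = -2" 
      using w y evs by (intro dot_root_even) (simp_all add: defs)
    have same: "dot v d = dot v b" if "dot b d = 2" for v using dot_same[of b d v] w y that by (simp add: defs)
    have opp: "dot v d = - dot v b" if "dot b d = -2" for v using dot_opp[of b d v] w y that by (simp add: defs)
    show False
    proof (cases "x = 2")
      case x: True
      have cd2: "dot c d = 2 \<or> dot c d = 0 \<or> dot c d = -2" and bc2: "dot b c = 2 \<or> dot b c = 0 \<or> dot b c = -2"
        using dot_root_even[of c d] dot_root_even[of b c] w x y evs by (simp_all add: defs)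
      from bd2 consider "dot b d = 2" | "dot b d = -2" | "dot b d = 0" by blast
      then show False
      proof cases
        case 1
        with same ip have "dot a b + g * dot b c = 4" "dot a b + k * dot b c = 0"
          by (simp_all add: dot_commute[of c b])
        then have "g * dot b c - k * dot b c = 4" by linarith
        \<comment> \<open>\<open>dot b c\<close> is even and \<open>g - k\<close> is at least 4, so
          a nonzero product would be at least 8 in absolute value.\<close>
        then have "(g - k) * dot b c = 4" by (simp add: left_diff_distrib)
        with bc2 \<open>g \<ge> k + 4\<close> show False by auto
      next
        case 2
        with opp ip have "dot a b - g * dot b c = 4" "- dot a b + k * dot b c = 0"
          by (simp_all add: dot_commute[of c b])
        then have "k * dot b c - g * dot b c = 4" by linarith
        then have "(g - k) * dot b c = -4" by (simp add: left_diff_distrib)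
        with bc2 \<open>g \<ge> k + 4\<close> show False by auto
      next
        case 3
        with ip have ac: "dot a c = 12" by simp
        have "dot c d = dot d c" by (rule dot_commute)
        \<comment> \<open>If \<open>c\<close> acts as \<open>b\<close> or \<open>- b\<close>, then
          \<open>dot a c\<close> is 4 or -4. This contradicts the value 12 caused by
          \<open>(3 + sqrt p) / 2\<close>.\<close>
        consider "dot b c = 2" | "dot b c = -2" | "dot b c = 0" using bc2 by blast
        then show False
        proof cases
          case 1
          then have "dot v c = dot v b" for v using dot_same[of b c v] w x by (simp add: defs)
          then have "dot a c = dot a b" "dot d c = dot d b" by simp_all
          with ip ac 3 show False by (simp add: dot_commute[of c d] dot_commute[of d b])
        next
          case 2
          then have "dot v c = - dot v b" for v using dot_opp[of b c v] w x by (simp add: defs)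
          then have "dot a c = - dot a b" "dot d c = - dot d b" by simp_all
          with ip ac 3 show False by (simp add: dot_commute[of c d] dot_commute[of d b])
        next
          case bc0: 3
          with ip have ad: "dot a d = 0" by simp
          have "dot c d = 0"
            using cd2 dot_same[of c d a] dot_opp[of c d a] x y ad ac by (auto simp: defs)
          \<comment> \<open>Now \<open>b\<close>, \<open>c\<close>, \<open>d\<close> are pairwise
            orthogonal roots with the same two odd positions, one more than a plane can hold.
            Arithmetically: \<open>b + c\<close> and \<open>b + d\<close> have even entries, yet
            their inner product is 2.\<close>
          have "2 * 2 dvd (b i + c i) * (b i + d i)" if "i < 5" for i
            using bc[OF that] bd[OF that] by (intro mult_dvd_mono) auto
          then have "4 dvd dot (\<lambda>i. b i + c i) (\<lambda>i. b i + d i)"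
            unfolding dot_def by (intro dvd_sum) simp
          moreover have "dot (\<lambda>i. b i + c i) (\<lambda>i. b i + d i) = 2"
            using w 3 bc0 \<open>dot c d = 0\<close> by (simp add: dot_linear dot_commute[of c b] defs)
          ultimately show False by simp
        qed
      qed
    next
      case False
      with \<open>x = 2 \<or> x \<ge> 6\<close> have x6: "x \<ge> 6" by blast
      then have X: "6 * p \<le> p * x" using p by (intro mult_ge) auto
      with norm2 \<open>z \<ge> 1\<close> have "2 * p + 2 * r \<le> 151 + 2 * q" by linarith
      \<comment> \<open>Only the radicands 21, 33, 77 pass the comparison. There
        \<open>x = 6\<close> and \<open>z = 22\<close>, and Cauchy-Schwarz gives 132, less than the
        square 144 of 12.\<close>
      have small: "k = 3 \<and> g = 7 \<and> h = 11"
      proof -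
        have le: "p + (g - k) * h \<le> 75"
          using \<open>2 * p + 2 * r \<le> 151 + 2 * q\<close> by (simp add: pqr algebra_simps)
        have "g - k < 8"
        proof (rule ccontr)
          assume "\<not> g - k < 8"
          then have "8 * 11 \<le> (g - k) * h" using ghk by (intro mult_mono) auto
          with le p show False by simp
        qed
        with ghk have g: "g = k + 4" by presburger
        with le p have h13: "h \<le> 13" by simp
        with ghk g have "k \<le> 5" by simp
        with ghk have "k = 3 \<or> k = 5" by presburger
        then show ?thesis
        proof
          assume "k = 3"
          with g ghk h13 show ?thesis by presburger
        next
          assume "k = 5"
          with g ghk le have "45 + 4 * h \<le> 75" by (simp add: pqr)
          with \<open>k = 5\<close> g ghk show ?thesis by simp
        qed
      qed
      then have num: "p = 21" "q = 33" "r = 77" by (simp_all add: pqr)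
      with norm2 have eq: "z + 21 * x = 148" by simp
      with x6 \<open>z \<ge> 1\<close> cong(3)[OF y] False have "x = 6" by linarith
      with eq have "z = 22" by simp
      have "\<bar>dot a c\<bar> \<le> 12" using \<open>x = 6\<close> \<open>z = 22\<close> by (intro dot_abs_le) (simp_all add: defs)
      have cs: "(dot a c)\<^sup>2 \<le> 132" using dot_Cauchy_Schwarz[of a c] \<open>x = 6\<close> \<open>z = 22\<close> by (simp add: defs)
      from bd2 consider "dot b d = 2" | "dot b d = -2" | "dot b d = 0" by blast
      then show False
      proof cases
        case 1
        with same ip small have "dot a b + 7 * dot b c = 4" "dot a b + 3 * dot b c = 0"
          by (simp_all add: dot_commute[of c b])
        then have "dot b c = 1" by simp
        with evs show False by simp
      next
        case 2
        with ip(2) small have "dot a c = 34" by simp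
        with cs show False by simp
      next
        case 3
        with ip(2) have "dot a c = 12" by simp
        with cs show False by simp
      qed
    qed
  qed
qed

section \<open>Algebraic integers and quadratic extensions\<close>

lemma algebraic_int_if_eigenvalue:
  fixes z :: "'a :: field_char_0"
  assumes "A \<in> carrier_mat n n" "eigenvalue (map_mat of_int A) z"
  shows "algebraic_int z"
proof -
  have "poly (char_poly (map_mat of_int A)) z = 0"
    using assms eigenvalue_root_char_poly[of "map_mat of_int A" n z] by auto
  then have "poly (map_poly of_int (char_poly A)) z = 0"
    by (simp only: of_int_hom.char_poly_hom[OF assms(1)])
  moreover have "lead_coeff (char_poly A) = 1" using degree_monic_char_poly[OF assms(1)] by auto
  ultimately show ?thesis unfolding algebraic_int_altdef_ipoly by blast
qed

text \<open>The generators form an eigenvector of the integer matrix that describes multiplication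
  by \<open>z\<close>, so \<open>z\<close> is a root of its monic characteristic polynomial.\<close>

lemma algebraic_int_if_stable:
  fixes z :: "'a :: field_char_0" and v :: "nat \<Rightarrow> 'a"
  assumes "i0 < n" "v i0 \<noteq> 0"
    and "\<And>i. i < n \<Longrightarrow> \<exists>c. z * v i = (\<Sum>j<n. of_int (c j) * v j)"
  shows "algebraic_int z"
proof -
  obtain C where C: "\<And>i. i < n \<Longrightarrow> z * v i = (\<Sum>j<n. of_int (C i j) * v j)"
    using assms(3) by metis
  define A where "A = mat n n (\<lambda>(i, j). C i j)"
  have "eigenvector (map_mat of_int A) (vec n v) z"
    unfolding eigenvector_def
  proof (intro conjI)
    show "vec n v \<noteq> 0\<^sub>v (dim_row (map_mat of_int A))"
    proof
      assume "vec n v = 0\<^sub>v (dim_row (map_mat of_int A))"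
      then have "vec n v $ i0 = 0\<^sub>v n $ i0" by (simp add: A_def)
      with assms(1,2) show False by simp
    qed
    show "map_mat of_int A *\<^sub>v vec n v = z \<cdot>\<^sub>v vec n v"
      by (rule eq_vecI) (auto simp: A_def C scalar_prod_def lessThan_atLeast0 intro!: sum.cong)
  qed (simp add: A_def)
  then have "eigenvalue (map_mat of_int A) z" unfolding eigenvalue_def by blast
  moreover have "A \<in> carrier_mat n n" by (simp add: A_def)
  ultimately show ?thesis by (intro algebraic_int_if_eigenvalue)
qed

lemma algebraic_int_relation:
  fixes x :: "'a :: field_char_0"
  assumes "algebraic_int x"
  obtains n c where "n > 0" "x ^ n = (\<Sum>i<n. of_int (c i) * x ^ i)"
proof -
  obtain p :: "int poly" where p: "poly (map_poly of_int p) x = 0" "lead_coeff p = 1"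
    using assms unfolding algebraic_int_altdef_ipoly by blast
  have "degree p > 0"
  proof (rule ccontr)
    assume "\<not> ?thesis"
    with p(2) have "p = 1" by (metis degree_eq_zeroE lead_coeff_pCons(2) gr0I one_pCons)
    with p(1) show False by simp
  qed
  moreover have "x ^ degree p = (\<Sum>i<degree p. of_int (- coeff p i) * x ^ i)"
  proof -
    have "0 = (\<Sum>i\<le>degree p. of_int (coeff p i) * x ^ i)"
      using p(1) by (simp add: poly_altdef degree_map_poly coeff_map_poly)
    also have "\<dots> = (\<Sum>i<degree p. of_int (coeff p i) * x ^ i) + x ^ degree p"
      using p(2) by (simp add: lessThan_Suc_atMost[symmetric])
    finally show ?thesis by (simp add: sum_negf add_eq_0_iff)
  qed
  ultimately show ?thesis by (rule that)
qed

text \<open>The products \<open>x ^ i * y ^ j\<close> below the degrees of the two monic relations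
  span a finitely generated additive group. It is stable under multiplication by \<open>x\<close>
  and by \<open>y\<close>, because the top powers reduce, hence also under \<open>x + y\<close> and
  \<open>x * y\<close>.\<close>

lemma algebraic_int_add_mult:
  fixes x y :: "'a :: field_char_0"
  assumes "algebraic_int x" "algebraic_int y"
  shows "algebraic_int (x + y)" "algebraic_int (x * y)"
proof -
  interpret int: Modules.module "\<lambda>(n :: int) (x :: 'a). of_int n * x"
    by standard (simp_all add: algebra_simps)
  obtain n c where n: "n > 0" "x ^ n = (\<Sum>i<n. of_int (c i) * x ^ i)"
    using algebraic_int_relation[OF assms(1)] by blast
  obtain m d where m: "m > 0" "y ^ m = (\<Sum>i<m. of_int (d i) * y ^ i)"
    using algebraic_int_relation[OF assms(2)] by blast
  define S where "S = (\<lambda>(i, j). x ^ i * y ^ j) ` ({..<n} \<times> {..<m})"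
  have S: "x ^ i * y ^ j \<in> int.span S" if "i < n" "j < m" for i j
    using that by (auto intro!: int.span_base simp: S_def)
  have stable_x: "x * u \<in> int.span S" if "u \<in> int.span S" for u
    using that
  proof (induction rule: int.span_induct_alt)
    case (step k u v)
    then obtain i j where u: "u = x ^ i * y ^ j" "i < n" "j < m" by (auto simp: S_def)
    have "x * u \<in> int.span S"
    proof (cases "Suc i < n")
      case True
      with u S[of "Suc i" j] show ?thesis by (simp add: mult_ac)
    next
      case False
      with u have "Suc i = n" by simp
      then have "x * u = x ^ n * y ^ j" using u(1) by (auto simp: mult_ac)
      also have "\<dots> = (\<Sum>i<n. of_int (c i) * (x ^ i * y ^ j))"
        by (simp add: n(2) sum_distrib_left sum_distrib_right mult_ac)
      also have "\<dots> \<in> int.span S" using S u(3) by (intro int.span_sum int.span_scale) auto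
      finally show ?thesis .
    qed
    then have "of_int k * (x * u) + x * v \<in> int.span S"
      using step by (intro int.span_add int.span_scale) auto
    then show ?case by (simp add: algebra_simps)
  qed (simp add: int.span_zero)
  have stable_y: "y * u \<in> int.span S" if "u \<in> int.span S" for u
    using that
  proof (induction rule: int.span_induct_alt)
    case (step k u v)
    then obtain i j where u: "u = x ^ i * y ^ j" "i < n" "j < m" by (auto simp: S_def)
    have "y * u \<in> int.span S"
    proof (cases "Suc j < m")
      case True
      with u S[of i "Suc j"] show ?thesis by (simp add: mult_ac)
    next
      case False
      with u have "Suc j = m" by simp
      then have "y * u = y ^ m * x ^ i" using u(1) by (auto simp: mult_ac)
      also have "\<dots> = (\<Sum>j<m. of_int (d j) * (x ^ i * y ^ j))"
        by (simp add: m(2) sum_distrib_left sum_distrib_right mult_ac)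
      also have "\<dots> \<in> int.span S" using S u(2) by (intro int.span_sum int.span_scale) auto
      finally show ?thesis .
    qed
    then have "of_int k * (y * u) + y * v \<in> int.span S"
      using step by (intro int.span_add int.span_scale) auto
    then show ?case by (simp add: algebra_simps)
  qed (simp add: int.span_zero)
  have fin: "finite S" by (simp add: S_def)
  then obtain f where f: "bij_betw f {..<card S} S"
    using ex_bij_betw_nat_finite by (auto simp: lessThan_atLeast0)
  \<comment> \<open>The generator 1 guarantees that the eigenvector is nonzero.\<close>
  have "1 \<in> S" using n(1) m(1) by (force simp: S_def image_iff)
  then obtain i0 where i0: "i0 < card S" "f i0 = 1"
    using f by (metis bij_betw_imp_surj_on imageE lessThan_iff)
  have alg: "algebraic_int z" if "\<And>u. u \<in> int.span S \<Longrightarrow> z * u \<in> int.span S" for z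
  proof (rule algebraic_int_if_stable[of i0 "card S" f])
    fix i assume "i < card S"
    then have "f i \<in> S" using f by (auto simp: bij_betw_def)
    then have "z * f i \<in> int.span S" using that int.span_base by blast
    then obtain u where "z * f i = (\<Sum>v\<in>S. of_int (u v) * v)"
      by (auto simp: int.span_finite[OF fin])
    also have "\<dots> = (\<Sum>j<card S. of_int (u (f j)) * f j)"
      by (rule sum.reindex_bij_betw[OF f, symmetric])
    finally show "\<exists>c. z * f i = (\<Sum>j<card S. of_int (c j) * f j)"
      by (intro exI[of _ "\<lambda>j. u (f j)"])
  qed (use i0 in auto)
  show "algebraic_int (x + y)"
    using stable_x stable_y by (intro alg) (simp add: distrib_right int.span_add)
  show "algebraic_int (x * y)"
    using stable_x stable_y by (intro alg) (simp add: mult.assoc)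
qed

section \<open>Subfields, quadratic extensions and conjugation\<close>

lemma is_subfieldD:
  assumes "is_subfield F"
  shows "0 \<in> F" "1 \<in> F" "x \<in> F \<Longrightarrow> y \<in> F \<Longrightarrow> x + y \<in> F" "x \<in> F \<Longrightarrow> y \<in> F \<Longrightarrow> x * y \<in> F"
    "x \<in> F \<Longrightarrow> - x \<in> F" "x \<in> F \<Longrightarrow> inverse x \<in> F"
    "x \<in> F \<Longrightarrow> y \<in> F \<Longrightarrow> x - y \<in> F" "x \<in> F \<Longrightarrow> y \<in> F \<Longrightarrow> x / y \<in> F"
proof -
  from assms show *: "0 \<in> F" "1 \<in> F" "\<And>x y. x \<in> F \<Longrightarrow> y \<in> F \<Longrightarrow> x + y \<in> F"
    "\<And>x y. x \<in> F \<Longrightarrow> y \<in> F \<Longrightarrow> x * y \<in> F" "\<And>x. x \<in> F \<Longrightarrow> - x \<in> F" "\<And>x. x \<in> F \<Longrightarrow> inverse x \<in> F"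
    by (auto simp: is_subfield_def)
  show "x \<in> F \<Longrightarrow> y \<in> F \<Longrightarrow> x - y \<in> F" using *(3)[of x "- y"] *(5) by simp
  show "x \<in> F \<Longrightarrow> y \<in> F \<Longrightarrow> x / y \<in> F" using *(4)[of x "inverse y"] *(6) by (simp add: divide_inverse)
qed

lemma is_subfield_Rats: "is_subfield (\<rat> :: 'a :: field_char_0 set)"
  by (auto simp: is_subfield_def)

lemma is_subfield_Inter: "(\<And>F. F \<in> \<F> \<Longrightarrow> is_subfield F) \<Longrightarrow> is_subfield (\<Inter>\<F>)"
  unfolding is_subfield_def by blast

lemma Ints_subset_subfield:
  fixes F :: "'a :: field_char_0 set"
  assumes "is_subfield F" shows "of_int n \<in> F"
proof -
  have "of_nat m \<in> F" for m by (induction m) (auto intro: is_subfieldD[OF assms])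
  then show ?thesis by (cases n rule: int_cases2) (auto intro: is_subfieldD(5)[OF assms])
qed

lemma Rats_subset_subfield:
  fixes F :: "'a :: field_char_0 set"
  assumes "is_subfield F" shows "\<rat> \<subseteq> F"
  by (auto elim!: Rats_cases' intro!: is_subfieldD(8)[OF assms] Ints_subset_subfield[OF assms])

lemma is_subfield_rat_adjoin: "is_subfield (rat_adjoin S)"
  unfolding rat_adjoin_def by (rule hull_in) (auto intro: is_subfield_Inter)

definition adjoin :: "real set \<Rightarrow> real \<Rightarrow> real set" where
  "adjoin F s = {y + z * s |y z. y \<in> F \<and> z \<in> F}"

lemma adjoinI: "y \<in> F \<Longrightarrow> z \<in> F \<Longrightarrow> y + z * s \<in> adjoin F s"
  by (auto simp: adjoin_def)

lemma is_subfield_adjoin: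
  assumes F: "is_subfield F" and s: "s * s \<in> F"
  shows "is_subfield (adjoin F s)"
proof -
  note f = is_subfieldD[OF F]
  have "inverse (y + z * s) \<in> adjoin F s" if yz: "y \<in> F" "z \<in> F" for y z
  \<comment> \<open>When \<open>y = z * s\<close> the conjugate \<open>y - z * s\<close> vanishes
    and cannot rationalise the denominator, but then the element is simply
    \<open>2 * y\<close>.\<close>
  proof (cases "y = z * s")
    case True
    then have "inverse (y + z * s) = inverse (2 * y) + 0 * s" by simp
    moreover have "2 * y \<in> F" using yz f(3)[of y y] by simp
    ultimately show ?thesis using f(1,6) by (metis adjoinI)
  next
    case False
    define N where "N = y * y - z * z * (s * s)"
    have "N \<in> F" unfolding N_def
      by (intro f(7)[OF f(4)[OF yz(1) yz(1)] f(4)[OF f(4)[OF yz(2) yz(2)] s]])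
    have N: "(y + z * s) * (y - z * s) = N" by (simp add: N_def algebra_simps)
    have "inverse (y + z * s) = y * inverse N + - z * inverse N * s"
    proof (cases "y + z * s = 0")
      case True
      with N show ?thesis by simp
    next
      case nz: False
      with False N have "N \<noteq> 0" by auto
      with nz N False show ?thesis by (simp add: field_simps)
    qed
    moreover have "y * inverse N \<in> F" "- z * inverse N \<in> F" using yz \<open>N \<in> F\<close> by (auto intro!: f)
    ultimately show ?thesis using adjoinI by metis
  qed
  moreover have "(y + z * s) * (u + v * s) \<in> adjoin F s" if "y \<in> F" "z \<in> F" "u \<in> F" "v \<in> F" for y z u v
  proof -
    have "(y + z * s) * (u + v * s) = (y * u + z * v * (s * s)) + (y * v + z * u) * s"
      by (simp add: algebra_simps)
    then show ?thesis using that s by (metis adjoinI f(3,4))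
  qed
  moreover have "(y + z * s) + (u + v * s) \<in> adjoin F s" if "y \<in> F" "z \<in> F" "u \<in> F" "v \<in> F" for y z u v
  proof -
    have "(y + z * s) + (u + v * s) = (y + u) + (z + v) * s" by (simp add: algebra_simps)
    then show ?thesis using that by (metis adjoinI f(3))
  qed
  moreover have "- (y + z * s) \<in> adjoin F s" if "y \<in> F" "z \<in> F" for y z
  proof -
    have "- (y + z * s) = - y + - z * s" by simp
    then show ?thesis using that by (metis adjoinI f(5))
  qed
  moreover have "0 \<in> adjoin F s" "1 \<in> adjoin F s"
    using adjoinI[of 0 F 0 s] adjoinI[of 1 F 0 s] f(1,2) by simp_all
  ultimately show ?thesis unfolding is_subfield_def adjoin_def by auto
qed

lemma rat_adjoin_insert2:
  assumes "s * s \<in> \<rat>" "t * t \<in> \<rat>"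
  shows "rat_adjoin {s, t} = adjoin (adjoin \<rat> s) t"
proof
  have sub: "\<rat> \<subseteq> adjoin \<rat> s" using adjoinI[of _ \<rat> 0 s] by fastforce
  have F: "is_subfield (adjoin \<rat> s)" by (intro is_subfield_adjoin is_subfield_Rats assms)
  have "t * t \<in> adjoin \<rat> s" using assms sub by blast
  then have "is_subfield (adjoin (adjoin \<rat> s) t)" by (intro is_subfield_adjoin F)
  moreover have "s \<in> adjoin (adjoin \<rat> s) t"
    using adjoinI[of s "adjoin \<rat> s" 0 t] adjoinI[of 0 \<rat> 1 s] is_subfieldD(1)[OF F] by simp
  moreover have "t \<in> adjoin (adjoin \<rat> s) t"
    using adjoinI[of 0 "adjoin \<rat> s" 1 t] is_subfieldD(1,2)[OF F] by simp
  ultimately show "rat_adjoin {s, t} \<subseteq> adjoin (adjoin \<rat> s) t"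
    unfolding rat_adjoin_def by (intro hull_minimal) auto
next
  note f = is_subfieldD[OF is_subfield_rat_adjoin[of "{s, t}"]]
  have "s \<in> rat_adjoin {s, t}" "t \<in> rat_adjoin {s, t}" by (auto simp: rat_adjoin_def intro: hull_inc)
  moreover have "\<rat> \<subseteq> rat_adjoin {s, t}" by (rule Rats_subset_subfield[OF is_subfield_rat_adjoin])
  ultimately show "adjoin (adjoin \<rat> s) t \<subseteq> rat_adjoin {s, t}"
    by (auto simp: adjoin_def intro!: f)
qed

text \<open>Horner's scheme evaluates the polynomial at both points with the same \<open>u\<close>
  and \<open>v\<close>, differing only in the sign of \<open>v * s\<close>. As \<open>s\<close> is
  not in \<open>F\<close>, a zero at one point forces \<open>v = 0\<close>. This takes the place of
  an automorphism.\<close>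

lemma root_conjugate:
  fixes F :: "real set" and f :: "int poly"
  assumes F: "is_subfield F" and s: "s * s \<in> F" "s \<notin> F" and yz: "y \<in> F" "z \<in> F"
    and root: "poly (map_poly of_int f) (y + z * s) = 0"
  shows "poly (map_poly of_int f) (y - z * s) = 0"
proof -
  note fi = is_subfieldD[OF F]
  have "\<exists>u\<in>F. \<exists>v\<in>F. poly (map_poly of_int f) (y + z * s) = u + v * s \<and>
      poly (map_poly of_int f) (y - z * s) = u - v * s"
  proof (induction f)
    case 0
    then show ?case using fi(1) by (intro bexI[of _ 0]) auto
  next
    case (pCons a f)
    then obtain u v where uv: "u \<in> F" "v \<in> F" "poly (map_poly of_int f) (y + z * s) = u + v * s"
      "poly (map_poly of_int f) (y - z * s) = u - v * s" by blast
    have "of_int a + (y * u + z * v * (s * s)) \<in> F" "y * v + z * u \<in> F"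
      using fi(4)[OF fi(4)[OF yz(2) uv(2)] s(1)] uv yz
      by (auto intro!: fi(3) fi(4)[of y] fi(4)[of z u] Ints_subset_subfield[OF F])
    moreover have P: "poly (map_poly of_int (pCons a f)) w = of_int a + w * poly (map_poly of_int f) w"
      for w :: real by (simp add: of_int_hom.map_poly_pCons_hom)
    have "poly (map_poly of_int (pCons a f)) (y + z * s) =
        (of_int a + (y * u + z * v * (s * s))) + (y * v + z * u) * s"
      unfolding P uv(3) by (simp add: algebra_simps)
    moreover have "poly (map_poly of_int (pCons a f)) (y - z * s) =
        (of_int a + (y * u + z * v * (s * s))) - (y * v + z * u) * s"
      unfolding P uv(4) by (simp add: algebra_simps)
    ultimately show ?case by blast
  qed
  then obtain u v where uv: "u \<in> F" "v \<in> F" "poly (map_poly of_int f) (y + z * s) = u + v * s"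
    "poly (map_poly of_int f) (y - z * s) = u - v * s" by blast
  have "v = 0"
  proof (rule ccontr)
    assume "v \<noteq> 0"
    with uv(3) root have "s = - u / v" by (simp add: field_simps add_eq_0_iff)
    with uv s(2) show False by (auto intro!: fi)
  qed
  with uv root show ?thesis by simp
qed

lemma sqrt_squarefree_irrational:
  assumes "squarefree n" "n > (1 :: int)"
  shows "sqrt (of_int n) \<notin> \<rat>"
proof
  assume "sqrt (of_int n) \<in> \<rat>"
  moreover have "algebraic_int (sqrt (of_int n))" by auto
  ultimately have "sqrt (of_int n) \<in> \<int>" using rational_algebraic_int_is_int by blast
  then obtain m where m: "sqrt (of_int n) = of_int m" by (rule Ints_cases)
  then have "real_of_int n = (of_int m)\<^sup>2" using assms(2) by (metis less_imp_le of_int_0_le_iff order_trans zero_le_one real_sqrt_pow2)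
  then have "n = m\<^sup>2" by (metis of_int_eq_iff of_int_power)
  with assms(1) have "m dvd 1" by (auto simp: squarefree_def)
  then have "\<bar>m\<bar> = 1" by simp
  then have "m\<^sup>2 = 1" by (metis one_power2 power2_abs)
  with \<open>n = m\<^sup>2\<close> assms(2) show False by simp
qed

text \<open>The square of \<open>t * sqrt n\<close> is rational and integral, hence an integer, so
  the square of the denominator of \<open>t\<close> divides \<open>n\<close>.\<close>

lemma squarefree_rational_multiple:
  fixes t :: real and n :: int
  assumes "squarefree n" "t \<in> \<rat>" "algebraic_int (t * sqrt (of_int n))" "n > 0"
  shows "t \<in> \<int>"
proof -
  obtain a b where ab: "b > 0" "coprime a b" "t = of_int a / of_int b"
    using assms(2) by (rule Rats_cases')
  have "algebraic_int ((t * sqrt (of_int n)) * (t * sqrt (of_int n)))"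
    by (rule algebraic_int_add_mult(2)[OF assms(3,3)])
  also have "(t * sqrt (of_int n)) * (t * sqrt (of_int n)) = t * t * of_int n"
    using assms(4) by simp
  finally have "t * t * of_int n \<in> \<int>" using assms(2) by (intro rational_algebraic_int_is_int) auto
  then obtain m where "t * t * of_int n = of_int m" by (rule Ints_cases)
  then have "real_of_int (a * a * n) = of_int (m * (b * b))" using ab by (simp add: field_simps)
  then have "a * a * n = m * (b * b)" by (simp only: of_int_eq_iff)
  then have "b * b dvd (a * a) * n" by (metis dvd_triv_right)
  moreover have "coprime (b * b) (a * a)" using ab(2) by (simp add: coprime_commute)
  ultimately have "b * b dvd n" by (simp add: coprime_dvd_mult_right_iff)
  with assms(1) have "b dvd 1" unfolding squarefree_def by (metis power2_eq_square)
  with ab show ?thesis by simp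
qed

section \<open>Biquadratic fields\<close>

text \<open>Every real biquadratic field is generated by \<open>sqrt (g k)\<close> and \<open>sqrt (h k)\<close> for such \<open>g\<close>, \<open>h\<close>,
  \<open>k\<close>; the third radicand is \<open>g h\<close>, and all three play the same role.\<close>

locale biquadratic =
  fixes g h k :: int
  assumes pos: "g > 0" "h > 0" "k > 0"
    and squarefree: "squarefree (g * h * k)"
    and nontrivial: "g * h \<noteq> 1" "g * k \<noteq> 1" "h * k \<noteq> 1"
begin

definition p :: int where "p = g * k"
definition q :: int where "q = h * k"
definition r :: int where "r = g * h"
definition sp :: real where "sp = sqrt p"
definition sq :: real where "sq = sqrt q"
definition sr :: real where "sr = sqrt r"

lemma squarefree_pqr: "squarefree p" "squarefree q" "squarefree r"
  unfolding p_def q_def r_def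
  by (rule squarefree_mono[OF _ squarefree], simp)+

lemma pqr_gt_1: "p > 1" "q > 1" "r > 1"
proof -
  have "p > 0" "q > 0" "r > 0" using pos by (simp_all add: p_def q_def r_def)
  with nontrivial show "p > 1" "q > 1" "r > 1" unfolding p_def q_def r_def by linarith+
qed

lemma sqrt_products:
  "sp * sp = p" "sq * sq = q" "sr * sr = r"
  "sp * sq = k * sr" "sq * sp = k * sr" "sp * sr = g * sq" "sr * sp = g * sq"
  "sq * sr = h * sp" "sr * sq = h * sp"
proof -
  show "sp * sp = p" "sq * sq = q" "sr * sr = r"
    using pqr_gt_1 by (simp_all add: sp_def sq_def sr_def)
  show "sp * sq = k * sr" "sq * sp = k * sr" "sp * sr = g * sq" "sr * sp = g * sq"
    "sq * sr = h * sp" "sr * sq = h * sp"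
    using pos by (simp_all add: sp_def sq_def sr_def p_def q_def r_def real_sqrt_mult)
qed

lemma irrational: "sp \<notin> \<rat>" "sq \<notin> \<rat>" "sr \<notin> \<rat>"
  unfolding sp_def sq_def sr_def
  using squarefree_pqr pqr_gt_1 by (simp_all add: sqrt_squarefree_irrational)

text \<open>Squaring \<open>u + v * sq\<close> leaves a mixed term that must be rational, so
  \<open>u\<close> or \<open>v\<close> is 0. Then \<open>sr\<close> or \<open>sp\<close>,
  respectively, would be rational.\<close>

lemma sp_notin_adjoin: "sp \<notin> adjoin \<rat> sq"
proof
  assume "sp \<in> adjoin \<rat> sq"
  then obtain u v where uv: "u \<in> \<rat>" "v \<in> \<rat>" "sp = u + v * sq" by (auto simp: adjoin_def)
  have "sp * sp = u * u + v * v * (sq * sq) + 2 * u * v * sq"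
    unfolding uv(3) by (simp add: algebra_simps)
  then have eq: "2 * u * v * sq = p - u * u - v * v * q" by (simp add: sqrt_products)
  have "u * v = 0"
  proof (rule ccontr)
    assume "u * v \<noteq> 0"
    with eq have "sq = (p - u * u - v * v * q) / (2 * u * v)" by (simp add: field_simps)
    moreover have "(p - u * u - v * v * q) / (2 * u * v) \<in> \<rat>" using uv(1,2) by simp
    ultimately show False using irrational by simp
  qed
  then consider "v = 0" | "u = 0" by auto
  then show False
  proof cases
    case 1
    with uv irrational show False by simp
  next
    case 2
    with uv have "sp * sq = v * q" using sqrt_products(2) by (metis add_0 mult.assoc)
    then have "sr = v * q / k" using pos sqrt_products(4) by (simp add: field_simps)
    with uv(2) irrational show False by simp
  qed
qed

lemma independent:
  assumes "a \<in> \<rat>" "b \<in> \<rat>" "c \<in> \<rat>" "d \<in> \<rat>" "a + b * sq + c * sp + d * sr = 0"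
  shows "a = 0" "b = 0" "c = 0" "d = 0"
proof -
  have sqq: "sq * sq \<in> \<rat>" by (simp add: sqrt_products)
  note f = is_subfieldD[OF is_subfield_adjoin[OF is_subfield_Rats sqq]]
  have irr: "u = 0 \<and> v = 0" if uv: "u \<in> \<rat>" "v \<in> \<rat>" "u + v * sq = 0" for u v
  proof -
    have "v = 0"
    proof (rule ccontr)
      assume "v \<noteq> 0"
      with uv have "sq = - u / v" by (simp add: field_simps add_eq_0_iff)
      with uv irrational show False by simp
    qed
    with uv show ?thesis by simp
  qed
  have "sr = sp * sq / k" using sqrt_products(4) pos by simp
  with assms(5) have eq: "(a + b * sq) + (c + d / k * sq) * sp = 0" by (simp add: algebra_simps)
  have in1: "a + b * sq \<in> adjoin \<rat> sq" "c + d / k * sq \<in> adjoin \<rat> sq"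
    using assms by (intro adjoinI; simp)+
  have 0: "c + d / k * sq = 0"
  proof (rule ccontr)
    assume nz: "c + d / k * sq \<noteq> 0"
    with eq have "sp = - (a + b * sq) / (c + d / k * sq)" by (simp add: field_simps add_eq_0_iff)
    moreover have "- (a + b * sq) / (c + d / k * sq) \<in> adjoin \<rat> sq"
      by (rule f(8)[OF f(5)[OF in1(1)] in1(2)])
    ultimately show False using sp_notin_adjoin by metis
  qed
  with irr[of c "d / k"] assms pos show "c = 0" "d = 0" by auto
  from 0 eq irr[of a b] assms show "a = 0" "b = 0" by auto
qed

lemma conjugate:
  assumes "a \<in> \<rat>" "b \<in> \<rat>" "c \<in> \<rat>" "d \<in> \<rat>" "algebraic_int (a + b * sq + c * sp + d * sr)"
  shows "algebraic_int (a + b * sq - c * sp - d * sr)"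
proof -
  have sqq: "sq * sq \<in> \<rat>" by (simp add: sqrt_products)
  have sr: "sr = sp * sq / k" using sqrt_products(4) pos by simp
  have eq: "a + b * sq + c * sp + d * sr = (a + b * sq) + (c + d / k * sq) * sp"
    "a + b * sq - c * sp - d * sr = (a + b * sq) - (c + d / k * sq) * sp"
    unfolding sr by (simp_all add: algebra_simps)
  obtain f :: "int poly" where f: "poly (map_poly of_int f) (a + b * sq + c * sp + d * sr) = 0" "lead_coeff f = 1"
    using assms(5) unfolding algebraic_int_altdef_ipoly by blast
  have "real_of_int p + 0 * sq \<in> adjoin \<rat> sq" by (rule adjoinI) simp_all
  then have "sp * sp \<in> adjoin \<rat> sq" by (simp add: sqrt_products)
  moreover have "a + b * sq \<in> adjoin \<rat> sq" "c + d / k * sq \<in> adjoin \<rat> sq"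
    using assms by (intro adjoinI; simp)+
  ultimately have "poly (map_poly of_int f) ((a + b * sq) - (c + d / k * sq) * sp) = 0"
    using f(1)[unfolded eq]
    by (rule root_conjugate[OF is_subfield_adjoin[OF is_subfield_Rats sqq] _ sp_notin_adjoin])
  with f(2) show ?thesis unfolding eq algebraic_int_altdef_ipoly by blast
qed

end

lemma biquadratic_perm:
  assumes "biquadratic g h k"
  shows "biquadratic h g k" "biquadratic k g h" "biquadratic g k h" "biquadratic h k g" "biquadratic k h g"
  using assms by (auto simp: biquadratic_def mult_ac)


section \<open>Traces and norms of algebraic integers\<close>

text \<open>A quarter of the expression is the product of the two conjugates, hence a rational
  algebraic integer.\<close>

lemma four_dvd_of_half_norm:
  fixes A B n :: int and s :: real
  assumes "algebraic_int ((real_of_int A + B * s) / 2)" "algebraic_int ((real_of_int A - B * s) / 2)"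
    and "s * s = real_of_int n"
  shows "4 dvd A * A - n * (B * B)"
proof -
  have "algebraic_int (((real_of_int A + B * s) / 2) * ((real_of_int A - B * s) / 2))"
    by (rule algebraic_int_add_mult(2)[OF assms(1,2)])
  also have "((real_of_int A + B * s) / 2) * ((real_of_int A - B * s) / 2) =
      (real_of_int A * A - real_of_int B * B * (s * s)) / 4"
    by (simp add: field_simps)
  also have "\<dots> = (of_int (A * A - n * (B * B)) :: real) / 4" by (simp add: assms(3))
  finally have "algebraic_int ((of_int (A * A - n * (B * B)) :: real) / 4)" .
  then have "(of_int (A * A - n * (B * B)) :: real) / 4 \<in> \<int>"
    by (intro rational_algebraic_int_is_int) auto
  then obtain m where "(of_int (A * A - n * (B * B)) :: real) / 4 = of_int m" by (rule Ints_cases)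
  then have "(of_int (A * A - n * (B * B)) :: real) = of_int (4 * m)" by simp
  then have "A * A - n * (B * B) = 4 * m" by (simp only: of_int_eq_iff)
  then show ?thesis by simp
qed

context biquadratic
begin

text \<open>Permuting \<open>g\<close>, \<open>h\<close>, \<open>k\<close> permutes the three square
  roots, so a single sign change yields the other two.\<close>

lemma conjugates:
  assumes "a \<in> \<rat>" "b \<in> \<rat>" "c \<in> \<rat>" "d \<in> \<rat>" "algebraic_int (a + b * sq + c * sp + d * sr)"
  shows "algebraic_int (a + b * sq - c * sp - d * sr)" "algebraic_int (a - b * sq + c * sp - d * sr)"
    "algebraic_int (a - b * sq - c * sp + d * sr)"
proof -
  have bq: "biquadratic g h k" by unfold_locales
  show "algebraic_int (a + b * sq - c * sp - d * sr)" by (rule conjugate[OF assms])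
  interpret S: biquadratic h g k by (rule biquadratic_perm(1)[OF bq])
  have "S.sp = sq" "S.sq = sp" "S.sr = sr"
    by (simp_all add: S.sp_def S.sq_def S.sr_def sp_def sq_def sr_def S.p_def S.q_def S.r_def
        p_def q_def r_def mult.commute)
  with S.conjugate[of a c b d] assms show "algebraic_int (a - b * sq + c * sp - d * sr)"
    by (simp add: algebra_simps)
  interpret T: biquadratic k g h by (rule biquadratic_perm(2)[OF bq])
  have "T.sp = sq" "T.sq = sr" "T.sr = sp"
    by (simp_all add: T.sp_def T.sq_def T.sr_def sp_def sq_def sr_def T.p_def T.q_def T.r_def
        p_def q_def r_def mult.commute)
  with T.conjugate[of a d b c] assms show "algebraic_int (a - b * sq - c * sp + d * sr)"
    by (simp add: algebra_simps)
qed

text \<open>Signed sums of the four conjugates isolate \<open>4 * a\<close>,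
  \<open>4 * b * sq\<close>, \<open>4 * c * sp\<close>, \<open>4 * d * sr\<close>, and
  square-freeness makes the rational factors integers. The conjugates are then paired: sums of pairs
  are relative traces, whose norms give three divisibilities, and \<open>x * x1\<close> is the
  relative norm, which supplies \<open>U\<close> and \<open>V\<close>.\<close>

lemma integral_form:
  assumes rat: "a \<in> \<rat>" "b \<in> \<rat>" "c \<in> \<rat>" "d \<in> \<rat>" and alg: "algebraic_int (a + b * sq + c * sp + d * sr)"
  obtains A B C D U V :: int where "4 * a = A" "4 * b = B" "4 * c = C" "4 * d = D"
    "4 dvd A * A - q * (B * B)" "4 dvd A * A - p * (C * C)" "4 dvd A * A - r * (D * D)"
    "A * A + q * (B * B) - p * (C * C) - r * (D * D) = 8 * U" "A * B - g * (C * D) = 4 * V"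
    "4 dvd U * U - q * (V * V)"
proof -
  define x x1 x2 x3 where "x = a + b * sq + c * sp + d * sr" and "x1 = a + b * sq - c * sp - d * sr"
    and "x2 = a - b * sq + c * sp - d * sr" and "x3 = a - b * sq - c * sp + d * sr"
  note xs = x_def x1_def x2_def x3_def
  have ai: "algebraic_int x" "algebraic_int x1" "algebraic_int x2" "algebraic_int x3"
    using alg conjugates[OF rat alg] by (simp_all add: xs)
  note ring = algebraic_int_add_mult algebraic_int_minus
  have sums: "algebraic_int ((x + x1) + (x2 + x3))" "algebraic_int ((x + x1) + - (x2 + x3))"
    "algebraic_int ((x + x2) + - (x1 + x3))" "algebraic_int ((x + x3) + - (x1 + x2))"
    by (intro ring ai)+
  have "algebraic_int (4 * a)" "algebraic_int (4 * b * sq)" "algebraic_int (4 * c * sp)" "algebraic_int (4 * d * sr)"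
    using sums by (simp_all add: xs algebra_simps)
  then have "4 * a \<in> \<int>" "4 * b \<in> \<int>" "4 * c \<in> \<int>" "4 * d \<in> \<int>"
    using rat squarefree_pqr pqr_gt_1 unfolding sp_def sq_def sr_def
    by (auto intro: rational_algebraic_int_is_int squarefree_rational_multiple)
  then obtain A B C D :: int where ABCD: "4 * a = A" "4 * b = B" "4 * c = C" "4 * d = D"
    by (auto elim!: Ints_cases)
  have abcd: "a = A / 4" "b = B / 4" "c = C / 4" "d = D / 4" using ABCD by simp_all
  have traces: "x + x1 = (A + B * sq) / 2" "x2 + x3 = (A - B * sq) / 2"
    "x + x2 = (A + C * sp) / 2" "x1 + x3 = (A - C * sp) / 2"
    "x + x3 = (A + D * sr) / 2" "x1 + x2 = (A - D * sr) / 2"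
    by (simp_all add: xs abcd field_simps)
  have traces_ai: "algebraic_int (x + x1)" "algebraic_int (x2 + x3)" "algebraic_int (x + x2)"
    "algebraic_int (x1 + x3)" "algebraic_int (x + x3)" "algebraic_int (x1 + x2)"
    by (intro ring ai)+
  have dvds: "4 dvd A * A - q * (B * B)" "4 dvd A * A - p * (C * C)" "4 dvd A * A - r * (D * D)"
    using traces_ai unfolding traces by (auto intro!: four_dvd_of_half_norm simp: sqrt_products)
  define U' V' where "U' = A * A + q * (B * B) - p * (C * C) - r * (D * D)" and "V' = A * B - g * (C * D)"
  have norms: "x * x1 = (U' + 2 * V' * sq) / 16" "x2 * x3 = (U' - 2 * V' * sq) / 16"
  proof -
    have "x * x1 = (a * a + b * b * (sq * sq) - c * c * (sp * sp) - d * d * (sr * sr)) +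
        2 * a * b * sq - 2 * c * d * (sp * sr)"
      "x2 * x3 = (a * a + b * b * (sq * sq) - c * c * (sp * sp) - d * d * (sr * sr)) -
        2 * a * b * sq + 2 * c * d * (sp * sr)"
      by (simp_all add: xs algebra_simps)
    then show "x * x1 = (U' + 2 * V' * sq) / 16" "x2 * x3 = (U' - 2 * V' * sq) / 16"
      unfolding sqrt_products abcd by (simp_all add: U'_def V'_def field_simps)
  qed
  have norm_ai: "algebraic_int (x * x1)" "algebraic_int (x2 * x3)" by (intro ring ai)+
  have "algebraic_int (x * x1 + x2 * x3)" "algebraic_int (x * x1 + - (x2 * x3))"
    by (intro ring ai)+
  then have "algebraic_int (U' / 8)" "algebraic_int (V' / 4 * sqrt q)"
    unfolding norms sq_def by (simp_all add: field_simps)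
  then have "U' / 8 \<in> \<int>" "V' / 4 \<in> \<int>"
    using squarefree_pqr pqr_gt_1 by (auto intro: rational_algebraic_int_is_int squarefree_rational_multiple)
  then obtain U V :: int where UV: "U' / 8 = U" "V' / 4 = V" by (auto elim!: Ints_cases)
  then have "real_of_int U' = of_int (8 * U)" "real_of_int V' = of_int (4 * V)" by simp_all
  then have UV': "U' = 8 * U" "V' = 4 * V" by (simp_all only: of_int_eq_iff)
  have "(real_of_int U' + 2 * real_of_int V' * sq) / 16 = (U + V * sq) / 2"
    "(real_of_int U' - 2 * real_of_int V' * sq) / 16 = (U - V * sq) / 2"
    unfolding UV' by (simp_all add: field_simps)
  with norm_ai have "4 dvd U * U - q * (V * V)"
    unfolding norms by (intro four_dvd_of_half_norm[of U V sq q]) (simp_all add: sqrt_products)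
  with that ABCD dvds UV' show ?thesis unfolding U'_def V'_def by blast
qed

end

lemma algebraic_int_if_square:
  fixes x :: real
  assumes "algebraic_int (x * x)"
  shows "algebraic_int x"
proof -
  have "algebraic_int (sqrt (x * x))" using assms by (rule algebraic_int_sqrt)
  then show ?thesis by simp
qed

lemma algebraic_int_half_one_plus_sqrt:
  fixes s :: real
  assumes "s * s = of_int n" "4 dvd n - 1"
  shows "algebraic_int ((1 + s) / 2)"
proof -
  obtain m where "n - 1 = 4 * m" using assms(2) by (rule dvdE)
  then have n: "real_of_int n = 1 + 4 * of_int m" by (metis add.commute diff_add_cancel of_int_1 of_int_add of_int_mult of_int_numeral)
  \<comment> \<open>The minimal relation is \<open>X^2 - X - m = 0\<close> with
    \<open>n = 1 + 4 * m\<close>.\<close>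
  have "poly (map_poly of_int [:- m, -1, 1:]) ((1 + s) / 2) = (s * s - (1 + 4 * of_int m)) / 4"
    by (simp add: field_simps)
  also have "\<dots> = 0" by (simp add: assms(1) n)
  finally show ?thesis unfolding algebraic_int_altdef_ipoly by (intro exI[of _ "[:- m, -1, 1:]"]) simp
qed

lemma pythagoras_number_ge:
  assumes "is_sum_of_n_squares R m \<alpha>" and "\<And>n. n < N \<Longrightarrow> \<not> is_sum_of_n_squares R n \<alpha>"
  shows "pythagoras_number R \<ge> enat N"
proof -
  have "sq_length R \<alpha> \<ge> N"
  proof (rule ccontr)
    assume "\<not> ?thesis"
    moreover have "is_sum_of_n_squares R (sq_length R \<alpha>) \<alpha>"
      unfolding sq_length_def using assms(1) by (rule LeastI)
    ultimately show False using assms(2) by auto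
  qed
  moreover have "\<alpha> \<in> sums_of_squares R" using assms(1) by (auto simp: sums_of_squares_def)
  ultimately show ?thesis unfolding pythagoras_number_def by (intro SUP_upper2[of \<alpha>]) auto
qed

lemma is_sum_of_n_squares_mono:
  assumes "is_sum_of_n_squares R n \<alpha>" "n \<le> m" "0 \<in> R"
  shows "is_sum_of_n_squares R m \<alpha>"
proof -
  obtain x where x: "\<forall>i<n. x i \<in> R" "\<alpha> = (\<Sum>i<n. (x i)\<^sup>2)"
    using assms(1) by (auto simp: is_sum_of_n_squares_def)
  define y where "y = (\<lambda>i. if i < n then x i else 0)"
  have "(\<Sum>i<m. (y i)\<^sup>2) = (\<Sum>i<n. (y i)\<^sup>2)"
    using assms(2) by (intro sum.mono_neutral_right) (auto simp: y_def)
  then have "\<alpha> = (\<Sum>i<m. (y i)\<^sup>2)" using x(2) by (simp add: y_def)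
  moreover have "\<forall>i<m. y i \<in> R" using x(1) assms(3) by (auto simp: y_def)
  ultimately show ?thesis unfolding is_sum_of_n_squares_def by blast
qed

text \<open>Padding with zeros turns fewer squares into five, so it is enough to exclude exactly
  five.\<close>

lemma pythagoras_number_ge_6:
  assumes "x0 \<in> R" "x1 \<in> R" "x2 \<in> R" "x3 \<in> R" "x4 \<in> R" "x5 \<in> R" "0 \<in> R"
    and "\<not> is_sum_of_n_squares R 5 (x0\<^sup>2 + x1\<^sup>2 + x2\<^sup>2 + x3\<^sup>2 + x4\<^sup>2 + x5\<^sup>2)"
  shows "pythagoras_number R \<ge> 6"
proof -
  define x where "x = (\<lambda>i :: nat. [x0, x1, x2, x3, x4, x5] ! i)"
  have "(\<Sum>i<6. (x i)\<^sup>2) = x0\<^sup>2 + x1\<^sup>2 + x2\<^sup>2 + x3\<^sup>2 + x4\<^sup>2 + x5\<^sup>2"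
    by (simp add: x_def eval_nat_numeral)
  moreover have "\<forall>i<6. x i \<in> R" using assms by (auto simp: x_def less_Suc_eq eval_nat_numeral)
  ultimately have "is_sum_of_n_squares R 6 (x0\<^sup>2 + x1\<^sup>2 + x2\<^sup>2 + x3\<^sup>2 + x4\<^sup>2 + x5\<^sup>2)"
    unfolding is_sum_of_n_squares_def by metis
  then have "pythagoras_number R \<ge> enat 6"
    by (rule pythagoras_number_ge) (use assms(7,8) is_sum_of_n_squares_mono[of R _ _ 5] in auto)
  then show ?thesis by (simp add: numeral_eq_enat)
qed

section \<open>Congruences for integral coordinates in the three cases\<close>

lemma mult_square_cong_mod4:
  assumes "4 dvd q - c"
  shows "4 dvd q * (b * b) - c * (b mod (2 :: int))"
proof -
  have "4 dvd (q - c) * (b * b) + c * (b * b - b mod 2)"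
    by (rule dvd_add[OF dvd_mult2[OF assms] dvd_mult[OF square_cong_mod4]])
  then show ?thesis by (simp add: algebra_simps)
qed

lemma square_dvd_cases:
  assumes "4 dvd A * A - p * (C * C)" "4 dvd p - e"
  shows "e = 1 \<Longrightarrow> even A \<longleftrightarrow> even (C :: int)" "e = 2 \<or> e = 3 \<Longrightarrow> even A \<and> even C"
proof -
  have "4 dvd (A * A - p * (C * C)) - (A * A - A mod 2) + (p * (C * C) - e * (C mod 2))"
    by (rule dvd_add[OF dvd_diff[OF assms(1) square_cong_mod4] mult_square_cong_mod4[OF assms(2)]])
  then have "4 dvd A mod 2 - e * (C mod 2)" by simp
  then show "e = 1 \<Longrightarrow> even A \<longleftrightarrow> even C" "e = 2 \<or> e = 3 \<Longrightarrow> even A \<and> even C"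
    by (auto simp: mod2_eq_if split: if_splits)
qed

text \<open>Necessary conditions for \<open>x = (A + B sqrt q + C sqrt p + D sqrt r) / 4\<close> to be integral: the
  first three say that the traces of \<open>x\<close> to the quadratic subfields have integral norms, the last
  one that the norm \<open>(U + V sqrt q) / 2\<close> of \<open>x\<close> to the field generated by \<open>sqrt q\<close> is integral.\<close>

definition integral_quad :: "int \<Rightarrow> int \<Rightarrow> int \<Rightarrow> int \<Rightarrow> int \<Rightarrow> int \<Rightarrow> int \<Rightarrow> bool" where
  "integral_quad g h k A B C D \<longleftrightarrow>
     4 dvd A * A - h * k * (B * B) \<and> 4 dvd A * A - g * k * (C * C) \<and> 4 dvd A * A - g * h * (D * D) \<and>
     (\<exists>U V. A * A + h * k * (B * B) - g * k * (C * C) - g * h * (D * D) = 8 * U \<and>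
       A * B - g * (C * D) = 4 * V \<and> 4 dvd U * U - h * k * (V * V))"

text \<open>With \<open>h * k\<close> congruent to 3, the numbers \<open>A\<close>,
  \<open>B\<close>, \<open>U\<close>, \<open>V\<close> are even. Evenness of \<open>g\<close> makes
  the product of the halves \<open>a\<close> and \<open>b\<close> even, and the norm equation modulo
  4 then leaves only \<open>a\<close>, \<open>b\<close> even and \<open>c\<close>, \<open>d\<close>
  of equal parity.\<close>

lemma integral_quad_A:
  assumes "integral_quad g h k A B C D"
    and "even g" "4 dvd g * k - 2" "4 dvd g * h - 2" "4 dvd h * k - 3"
  obtains a b c d where "A = 4 * a" "B = 4 * b" "C = 2 * c" "D = 2 * d" "even (c - d)"
proof -
  from assms(1) obtain U V where d1: "4 dvd A * A - h * k * (B * B)" "4 dvd A * A - g * k * (C * C)"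
    "4 dvd A * A - g * h * (D * D)"
    and UV: "A * A + h * k * (B * B) - g * k * (C * C) - g * h * (D * D) = 8 * U"
       "A * B - g * (C * D) = 4 * V" "4 dvd U * U - h * k * (V * V)"
    unfolding integral_quad_def by blast
  have "even A" "even B" "even C" "even D"
    using square_dvd_cases(2)[OF d1(1) assms(5)] square_dvd_cases(2)[OF d1(2) assms(3)]
      square_dvd_cases(2)[OF d1(3) assms(4)] by simp_all
  then obtain a b c d where *: "A = 2 * a" "B = 2 * b" "C = 2 * c" "D = 2 * d" by (meson evenE)
  have "even U" "even V" using square_dvd_cases(2)[OF UV(3) assms(5)] by simp_all
  then obtain U' V' where UV': "U = 2 * U'" "V = 2 * V'" by (meson evenE)
  have eq: "a * a + h * k * (b * b) - g * k * (c * c) - g * h * (d * d) = 4 * U'" "a * b - g * (c * d) = 2 * V'"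
    using UV unfolding * UV' by (simp_all add: algebra_simps)
  have "a * b = g * (c * d) + 2 * V'" using eq(2) by simp
  then have "even (a * b)" using \<open>even g\<close> by simp
  have "4 dvd (a * a - a mod 2) + (h * k * (b * b) - 3 * (b mod 2)) - (g * k * (c * c) - 2 * (c mod 2))
      - (g * h * (d * d) - 2 * (d mod 2))"
    by (intro dvd_add dvd_diff square_cong_mod4 mult_square_cong_mod4 assms)
  also have "\<dots> = 4 * U' - (a mod 2 + 3 * (b mod 2) - 2 * (c mod 2) - 2 * (d mod 2))"
    using eq(1) by simp
  finally have "4 dvd a mod 2 + 3 * (b mod 2) - 2 * (c mod 2) - 2 * (d mod 2)" by presburger
  with \<open>even (a * b)\<close> have "even a" "even b" "even (c - d)"
    by (auto simp: mod2_eq_if split: if_splits)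
  then obtain a' b' where "a = 2 * a'" "b = 2 * b'" by (meson evenE)
  with * \<open>even (c - d)\<close> show ?thesis by (intro that[of a' b' c d]) simp_all
qed

text \<open>Here \<open>U\<close> and \<open>V\<close> only agree modulo 2. Subtracting the equation
  for \<open>V\<close> from that for \<open>U\<close> completes squares: modulo 4, the square of
  \<open>a - b\<close> equals 2 or -1 times the square of \<open>c - d\<close>, and either way both
  differences are even.\<close>

lemma integral_quad_B:
  assumes "integral_quad g h k A B C D"
    and "4 dvd h * k - 1" "even g \<and> 4 dvd g * k - 2 \<and> 4 dvd g * h - 2 \<or> odd g \<and> 4 dvd g * k - 3 \<and> 4 dvd g * h - 3"
  obtains a b c d where "A = 2 * a" "B = 2 * b" "C = 2 * c" "D = 2 * d" "even (a - b)" "even (c - d)"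
proof -
  from assms(1) obtain U V where d1: "4 dvd A * A - h * k * (B * B)" "4 dvd A * A - g * k * (C * C)"
    "4 dvd A * A - g * h * (D * D)"
    and UV: "A * A + h * k * (B * B) - g * k * (C * C) - g * h * (D * D) = 8 * U"
       "A * B - g * (C * D) = 4 * V" "4 dvd U * U - h * k * (V * V)"
    unfolding integral_quad_def by blast
  have "even A" "even B" "even C" "even D"
    using square_dvd_cases[OF d1(1) assms(2)] square_dvd_cases(2)[OF d1(2), of 2] square_dvd_cases(2)[OF d1(2), of 3]
      square_dvd_cases(2)[OF d1(3), of 2] square_dvd_cases(2)[OF d1(3), of 3] assms(3) by blast+
  then obtain a b c d where *: "A = 2 * a" "B = 2 * b" "C = 2 * c" "D = 2 * d" by (meson evenE)
  have "even U \<longleftrightarrow> even V" using square_dvd_cases(1)[OF UV(3) assms(2)] by simp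
  then have "even (U - V)" by simp
  then obtain W where W: "U = V + 2 * W" by (metis add.commute diff_add_cancel evenE)
  have V: "V = a * b - g * (c * d)" using UV(2) unfolding * by (simp add: algebra_simps)
  have eq: "a * a + h * k * (b * b) - g * k * (c * c) - g * h * (d * d) - 2 * (a * b) + 2 * g * (c * d) = 4 * W"
    using UV(1) unfolding * W V by (simp add: algebra_simps)
  from assms(3) consider (even) "even g" "4 dvd g * k - 2" "4 dvd g * h - 2"
    | (odd) "odd g" "4 dvd g * k - 3" "4 dvd g * h - 3" by blast
  then have "even (a - b) \<and> even (c - d)"
  proof cases
    case even
    then obtain m where g: "g = 2 * m" by (meson evenE)
    have "4 dvd 4 * (W - m * (c * d) + c * d) - (h * k - 1) * (b * b) + (g * k - 2) * (c * c) + (g * h - 2) * (d * d)"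
      by (rule dvd_add[OF dvd_add[OF dvd_diff[OF dvd_triv_left dvd_mult2[OF assms(2)]]
            dvd_mult2[OF even(2)]] dvd_mult2[OF even(3)]])
    also have "\<dots> = (a - b) * (a - b) - 2 * ((c - d) * (c - d))"
      using eq unfolding g by (simp add: algebra_simps)
    finally show ?thesis by (rule square_dvd_cases(2)[of _ _ _ 2]) simp_all
  next
    case odd
    then obtain m where g: "g = 2 * m + 1" by (meson oddE)
    have "4 dvd 4 * (W + c * c + d * d - (m + 1) * (c * d)) - (h * k - 1) * (b * b) + (g * k - 3) * (c * c)
        + (g * h - 3) * (d * d)"
      by (rule dvd_add[OF dvd_add[OF dvd_diff[OF dvd_triv_left dvd_mult2[OF assms(2)]]
            dvd_mult2[OF odd(2)]] dvd_mult2[OF odd(3)]])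
    also have "\<dots> = (a - b) * (a - b) - (-1) * ((c - d) * (c - d))"
      using eq unfolding g by (simp add: algebra_simps)
    finally show ?thesis by (rule square_dvd_cases(2)[of _ _ _ 3]) simp_all
  qed
  with * that show ?thesis by blast
qed

lemma integral_quad_C:
  assumes "integral_quad g h k A B C D"
    and "odd g" "4 dvd h * k - 1" "4 dvd g * k - 1" "4 dvd g * h - 1"
  shows "quarter_integral A B C D"
proof -
  from assms(1) obtain U V where d1: "4 dvd A * A - h * k * (B * B)" "4 dvd A * A - g * k * (C * C)"
    "4 dvd A * A - g * h * (D * D)"
    and UV: "A * A + h * k * (B * B) - g * k * (C * C) - g * h * (D * D) = 8 * U"
       "A * B - g * (C * D) = 4 * V" "4 dvd U * U - h * k * (V * V)"
    unfolding integral_quad_def by blast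
  have ev: "even A \<longleftrightarrow> even B" "even A \<longleftrightarrow> even C" "even A \<longleftrightarrow> even D"
    using square_dvd_cases(1)[OF d1(1) assms(3)] square_dvd_cases(1)[OF d1(2) assms(4)]
      square_dvd_cases(1)[OF d1(3) assms(5)] by simp_all
  show ?thesis
  proof (cases "even A")
    case False
    with ev show ?thesis by (simp add: quarter_integral_def)
  next
    case True
    with ev obtain a b c d where *: "A = 2 * a" "B = 2 * b" "C = 2 * c" "D = 2 * d" by (meson evenE)
    have "even U \<longleftrightarrow> even V" using square_dvd_cases(1)[OF UV(3) assms(3)] by simp
    then have "even (U - V)" by simp
    then obtain W where W: "U = V + 2 * W" by (metis add.commute diff_add_cancel evenE)
    have V: "V = a * b - g * (c * d)" using UV(2) unfolding * by (simp add: algebra_simps)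
    have "a * a + h * k * (b * b) - g * k * (c * c) - g * h * (d * d) = 2 * (a * b - g * (c * d) + 2 * W)"
      using UV(1) unfolding * W V by (simp add: algebra_simps)
    then have "even (a * a + h * k * (b * b) - g * k * (c * c) - g * h * (d * d))" by simp
    moreover have "odd n" if "4 dvd n - 1" for n :: int using that by presburger
    with assms(3-5) have "odd (h * k)" "odd (g * k)" "odd (g * h)" by blast+
    ultimately have "even (a + b + c + d)" by auto
    then have "4 dvd A + B + C + D" unfolding * by presburger
    with True ev show ?thesis by (simp add: quarter_integral_def)
  qed
qed

section \<open>The ring of integers and comparison of coefficients\<close>

context biquadratic
begin

definition K :: "real set" where
  "K = {a + b * sq + c * sp + d * sr |a b c d. a \<in> \<rat> \<and> b \<in> \<rat> \<and> c \<in> \<rat> \<and> d \<in> \<rat>}"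

lemma rat_adjoin_eq_K: "rat_adjoin {sp, sq} = K"
proof -
  have "rat_adjoin {sp, sq} = adjoin (adjoin \<rat> sp) sq"
    by (rule rat_adjoin_insert2) (simp_all add: sqrt_products)
  also have "\<dots> = K"
  proof (intro equalityI subsetI)
    fix x assume "x \<in> adjoin (adjoin \<rat> sp) sq"
    then obtain a c b e where *: "a \<in> \<rat>" "c \<in> \<rat>" "b \<in> \<rat>" "e \<in> \<rat>" "x = (a + c * sp) + (b + e * sp) * sq"
      unfolding adjoin_def by auto
    have "x = a + b * sq + c * sp + e * (sp * sq)" unfolding *(5) by (simp add: algebra_simps)
    then have "x = a + b * sq + c * sp + (e * k) * sr" by (simp add: sqrt_products)
    moreover have "e * k \<in> \<rat>" using * by simp
    ultimately show "x \<in> K" unfolding K_def using * by blast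
  next
    fix x assume "x \<in> K"
    then obtain a b c d where *: "a \<in> \<rat>" "b \<in> \<rat>" "c \<in> \<rat>" "d \<in> \<rat>" "x = a + b * sq + c * sp + d * sr"
      unfolding K_def by auto
    have "sr = sp * sq / k" using sqrt_products(4) pos by simp
    then have "x = (a + c * sp) + (b + d / k * sp) * sq" unfolding *(5) by (simp add: algebra_simps)
    moreover have "a + c * sp \<in> adjoin \<rat> sp" "b + d / k * sp \<in> adjoin \<rat> sp"
      using * by (intro adjoinI; simp)+
    ultimately show "x \<in> adjoin (adjoin \<rat> sp) sq" by (simp add: adjoinI)
  qed
  finally show ?thesis .
qed

lemma is_subfield_K: "is_subfield K"
  using is_subfield_rat_adjoin[of "{sp, sq}"] rat_adjoin_eq_K by simp

lemma sqrt_in_K: "sp \<in> K" "sq \<in> K" "sr \<in> K"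
proof -
  have "sp = 0 + 0 * sq + 1 * sp + 0 * sr" "sq = 0 + 1 * sq + 0 * sp + 0 * sr" "sr = 0 + 0 * sq + 0 * sp + 1 * sr"
    by simp_all
  then show "sp \<in> K" "sq \<in> K" "sr \<in> K" unfolding K_def using Rats_0 Rats_1 by blast+
qed

abbreviation OK :: "real set" where "OK \<equiv> ring_of_integers K"

lemma OK_intros:
  "of_int n \<in> OK" "0 \<in> OK" "1 \<in> OK" "sp \<in> OK" "sq \<in> OK" "sr \<in> OK" "x \<in> OK \<Longrightarrow> y \<in> OK \<Longrightarrow> x + y \<in> OK"
  using is_subfieldD[OF is_subfield_K] Ints_subset_subfield[OF is_subfield_K] sqrt_in_K
  by (auto simp: ring_of_integers_def sp_def sq_def sr_def intro: algebraic_int_add_mult)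

lemma half_in_K: "x \<in> K \<Longrightarrow> x / 2 \<in> K"
  using is_subfieldD(8)[OF is_subfield_K, of x 2] Ints_subset_subfield[OF is_subfield_K, of 2] by simp

lemma half_one_plus_sq_in_OK: "4 dvd q - 1 \<Longrightarrow> (1 + sq) / 2 \<in> OK"
  using algebraic_int_half_one_plus_sqrt[of sq q] is_subfieldD[OF is_subfield_K] half_in_K sqrt_in_K
  by (simp add: ring_of_integers_def sqrt_products)

lemma half_one_plus_sp_in_OK: "4 dvd p - 1 \<Longrightarrow> (1 + sp) / 2 \<in> OK"
  using algebraic_int_half_one_plus_sqrt[of sp p] is_subfieldD[OF is_subfield_K] half_in_K sqrt_in_K
  by (simp add: ring_of_integers_def sqrt_products)

text \<open>The square of the element is \<open>(p + r + 2 * g * sq) / 4\<close>, which the two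
  alternatives write as an integral combination of 1 and \<open>sq\<close>, or of 1 and
  \<open>(1 + sq) / 2\<close>.\<close>

lemma half_sum_in_OK:
  assumes "even g \<and> 4 dvd p + r \<or> 4 dvd q - 1 \<and> 4 dvd p + r - 2 \<and> odd g"
  shows "(sp + sr) / 2 \<in> OK"
proof -
  have sq4: "((sp + sr) / 2) * ((sp + sr) / 2) = (p + r + 2 * g * sq) / 4"
  proof -
    have "((sp + sr) / 2) * ((sp + sr) / 2) = (sp * sp + sr * sr + 2 * (sp * sr)) / 4"
      by (simp add: field_simps)
    then show ?thesis by (simp add: sqrt_products)
  qed
  have sqi: "algebraic_int sq" by (auto simp: sq_def)
  note ring = algebraic_int_add_mult
  from assms have "algebraic_int (((sp + sr) / 2) * ((sp + sr) / 2))"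
  proof
    assume "even g \<and> 4 dvd p + r"
    then obtain m n where "g = 2 * m" "p + r = 4 * n" by (meson dvdE)
    moreover from this(2) have "real_of_int p + real_of_int r = 4 * real_of_int n"
      by (metis of_int_add of_int_mult of_int_numeral)
    ultimately have eq: "((sp + sr) / 2) * ((sp + sr) / 2) = n + m * sq"
      unfolding sq4 by (simp add: field_simps)
    show ?thesis unfolding eq by (intro ring sqi algebraic_int_of_int)
  next
    assume *: "4 dvd q - 1 \<and> 4 dvd p + r - 2 \<and> odd g"
    then have "even ((p + r) div 2 - g)" "even (p + r)" by presburger+
    then obtain n where "(p + r) div 2 - g = 2 * n" by (meson evenE)
    with \<open>even (p + r)\<close> have "p + r = 4 * n + 2 * g" by presburger
    then have "real_of_int p + real_of_int r = 4 * real_of_int n + 2 * real_of_int g"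
      by (metis of_int_add of_int_mult of_int_numeral)
    then have eq: "((sp + sr) / 2) * ((sp + sr) / 2) = n + g * ((1 + sq) / 2)"
      unfolding sq4 by (simp add: field_simps)
    have "algebraic_int ((1 + sq) / 2)"
      using half_one_plus_sq_in_OK * by (simp add: ring_of_integers_def)
    then show ?thesis unfolding eq by (intro ring algebraic_int_of_int)
  qed
  then have "algebraic_int ((sp + sr) / 2)" by (rule algebraic_int_if_square)
  then show ?thesis using half_in_K is_subfieldD[OF is_subfield_K] sqrt_in_K
    by (simp add: ring_of_integers_def)
qed

lemma OK_quad:
  assumes "x \<in> OK"
  obtains A B C D where "integral_quad g h k A B C D" "4 * x = A + B * sq + C * sp + D * sr"
proof -
  from assms obtain a b c d where abcd: "a \<in> \<rat>" "b \<in> \<rat>" "c \<in> \<rat>" "d \<in> \<rat>" "x = a + b * sq + c * sp + d * sr"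
    and "algebraic_int x" unfolding ring_of_integers_def K_def by auto
  then obtain A B C D U V :: int where ABCD: "4 * a = A" "4 * b = B" "4 * c = C" "4 * d = D"
    and "4 dvd A * A - q * (B * B)" "4 dvd A * A - p * (C * C)" "4 dvd A * A - r * (D * D)"
    "A * A + q * (B * B) - p * (C * C) - r * (D * D) = 8 * U" "A * B - g * (C * D) = 4 * V"
    "4 dvd U * U - q * (V * V)"
    using integral_form[of a b c d] by metis
  then have "integral_quad g h k A B C D" unfolding integral_quad_def p_def q_def r_def by blast
  moreover have "4 * x = A + B * sq + C * sp + D * sr"
    unfolding abcd(5) ABCD[symmetric] by (simp add: algebra_simps)
  ultimately show ?thesis by (rule that)
qed

text \<open>The factor 16 clears the common denominator 4 of the squared elements, and independence
  of \<open>1\<close>, \<open>sq\<close>, \<open>sp\<close>, \<open>sr\<close> separates the four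
  coefficients.\<close>

lemma five_squares:
  assumes "is_sum_of_n_squares OK 5 \<alpha>" and "16 * \<alpha> = T + E1 * sq + E2 * sp + E3 * sr"
  obtains A B C D where "\<forall>i<5. integral_quad g h k (A i) (B i) (C i) (D i)"
    "dot A A + q * dot B B + p * dot C C + r * dot D D = T"
    "2 * (dot A B + g * dot C D) = E1" "2 * (dot A C + h * dot B D) = E2" "2 * (dot A D + k * dot B C) = (E3 :: int)"
proof -
  obtain x :: "nat \<Rightarrow> real" where x: "\<forall>i<5. x i \<in> OK" "\<alpha> = (\<Sum>i<5. (x i)\<^sup>2)"
    using assms(1) by (auto simp: is_sum_of_n_squares_def)
  have "\<forall>i. \<exists>A B C D. i < 5 \<longrightarrow> integral_quad g h k A B C D \<and> 4 * x i = A + B * sq + C * sp + D * sr"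
    using x(1) OK_quad by metis
  then obtain A B C D where ABCD: "\<forall>i<5. integral_quad g h k (A i) (B i) (C i) (D i)"
    "\<And>i. i < 5 \<Longrightarrow> 4 * x i = A i + B i * sq + C i * sp + D i * sr" by metis
  have sqr: "16 * (x i)\<^sup>2 = of_int (A i * A i + q * (B i * B i) + p * (C i * C i) + r * (D i * D i))
      + of_int (2 * (A i * B i + g * (C i * D i))) * sq + of_int (2 * (A i * C i + h * (B i * D i))) * sp
      + of_int (2 * (A i * D i + k * (B i * C i))) * sr" if "i < 5" for i
  proof -
    have "16 * (x i)\<^sup>2 = (4 * x i) * (4 * x i)" by (simp add: power2_eq_square)
    also have "\<dots> = (A i * A i + B i * B i * (sq * sq) + C i * C i * (sp * sp) + D i * D i * (sr * sr))
      + 2 * A i * B i * sq + 2 * A i * C i * sp + 2 * A i * D i * sr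
      + 2 * B i * C i * (sp * sq) + 2 * B i * D i * (sq * sr) + 2 * C i * D i * (sp * sr)"
      unfolding ABCD(2)[OF that] by (simp add: algebra_simps)
    finally show ?thesis unfolding sqrt_products by (simp add: algebra_simps)
  qed
  have "16 * \<alpha> = (\<Sum>i<5. 16 * (x i)\<^sup>2)" by (simp add: x(2) sum_distrib_left)
  also have "\<dots> = (\<Sum>i<5. of_int (A i * A i + q * (B i * B i) + p * (C i * C i) + r * (D i * D i))
      + of_int (2 * (A i * B i + g * (C i * D i))) * sq + of_int (2 * (A i * C i + h * (B i * D i))) * sp
      + of_int (2 * (A i * D i + k * (B i * C i))) * sr)"
    using sqr by (intro sum.cong) auto
  also have "\<dots> = of_int (\<Sum>i<5. A i * A i + q * (B i * B i) + p * (C i * C i) + r * (D i * D i))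
      + of_int (\<Sum>i<5. 2 * (A i * B i + g * (C i * D i))) * sq + of_int (\<Sum>i<5. 2 * (A i * C i + h * (B i * D i))) * sp
      + of_int (\<Sum>i<5. 2 * (A i * D i + k * (B i * C i))) * sr"
    unfolding of_int_sum sum_distrib_right by (simp only: sum.distrib)
  also have "\<dots> = of_int (dot A A + q * dot B B + p * dot C C + r * dot D D) + of_int (2 * (dot A B + g * dot C D)) * sq
      + of_int (2 * (dot A C + h * dot B D)) * sp + of_int (2 * (dot A D + k * dot B C)) * sr"
    by (simp only: dot_def sum_distrib_left[symmetric] sum.distrib)
  finally have eq: "of_int (dot A A + q * dot B B + p * dot C C + r * dot D D - T)
      + of_int (2 * (dot A B + g * dot C D) - E1) * sq
      + of_int (2 * (dot A C + h * dot B D) - E2) * sp + of_int (2 * (dot A D + k * dot B C) - E3) * sr = 0"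
    unfolding assms(2) by (simp add: algebra_simps)
  note ind = independent[OF Rats_of_int Rats_of_int Rats_of_int Rats_of_int eq]
  show ?thesis
    by (rule that[OF ABCD(1)]) (use ind in \<open>simp_all only: of_int_eq_0_iff right_minus_eq\<close>)
qed

end

lemma four_dvd_double_diff_2: "4 dvd 2 * x - 2 \<longleftrightarrow> odd (x :: int)"
  by presburger

context biquadratic
begin

lemma five_squares_A:
  assumes "even g" "4 dvd p - 2" "4 dvd r - 2" "4 dvd q - 3"
    and "is_sum_of_n_squares OK 5 \<alpha>" "16 * \<alpha> = T + E1 * sq + E2 * sp + E3 * sr"
  obtains a b c d where "\<forall>i<5. even (c i - d i)"
    "16 * dot a a + 16 * q * dot b b + 4 * p * dot c c + 4 * r * dot d d = T"
    "32 * dot a b + 8 * g * dot c d = E1" "16 * (dot a c + h * dot b d) = E2"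
    "16 * (dot a d + k * dot b c) = (E3 :: int)"
proof -
  obtain A B C D where iq: "\<forall>i<5. integral_quad g h k (A i) (B i) (C i) (D i)"
    and eqs: "dot A A + q * dot B B + p * dot C C + r * dot D D = T"
    "2 * (dot A B + g * dot C D) = E1" "2 * (dot A C + h * dot B D) = E2" "2 * (dot A D + k * dot B C) = E3"
    using five_squares[OF assms(5,6)] by metis
  have "\<forall>i. \<exists>a b c d. i < 5 \<longrightarrow> A i = 4 * a \<and> B i = 4 * b \<and> C i = 2 * c \<and> D i = 2 * d \<and> even (c - d)"
    using iq integral_quad_A[of g h k] assms(1-4) unfolding p_def q_def r_def by metis
  then obtain a b c d where "\<And>i. i < 5 \<longrightarrow> A i = 4 * a i \<and> B i = 4 * b i \<and> C i = 2 * c i \<and>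
      D i = 2 * d i \<and> even (c i - d i)" by metis
  then have *: "\<forall>i<5. A i = 4 * a i" "\<forall>i<5. B i = 4 * b i" "\<forall>i<5. C i = 2 * c i"
    "\<forall>i<5. D i = 2 * d i" "\<forall>i<5. even (c i - d i)" by blast+
  note sc = dot_scaled[OF *(1,1)] dot_scaled[OF *(2,2)] dot_scaled[OF *(3,3)] dot_scaled[OF *(4,4)]
    dot_scaled[OF *(1,2)] dot_scaled[OF *(1,3)] dot_scaled[OF *(1,4)]
    dot_scaled[OF *(2,3)] dot_scaled[OF *(2,4)] dot_scaled[OF *(3,4)]
  show ?thesis
    by (rule that[of c d a b]) (use *(5) eqs in \<open>simp_all add: sc algebra_simps\<close>)
qed

lemma five_squares_B:
  assumes "4 dvd q - 1" "even g \<and> 4 dvd p - 2 \<and> 4 dvd r - 2 \<or> odd g \<and> 4 dvd p - 3 \<and> 4 dvd r - 3"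
    and "is_sum_of_n_squares OK 5 \<alpha>" "16 * \<alpha> = T + E1 * sq + E2 * sp + E3 * sr"
  obtains a b c d where "\<forall>i<5. even (c i - d i)" "\<forall>i<5. even (a i - b i)"
    "4 * dot a a + 4 * q * dot b b + 4 * p * dot c c + 4 * r * dot d d = T"
    "8 * (dot a b + g * dot c d) = E1" "8 * (dot a c + h * dot b d) = E2"
    "8 * (dot a d + k * dot b c) = (E3 :: int)"
proof -
  obtain A B C D where iq: "\<forall>i<5. integral_quad g h k (A i) (B i) (C i) (D i)"
    and eqs: "dot A A + q * dot B B + p * dot C C + r * dot D D = T"
    "2 * (dot A B + g * dot C D) = E1" "2 * (dot A C + h * dot B D) = E2" "2 * (dot A D + k * dot B C) = E3"
    using five_squares[OF assms(3,4)] by metis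
  have "\<forall>i. \<exists>a b c d. i < 5 \<longrightarrow> A i = 2 * a \<and> B i = 2 * b \<and> C i = 2 * c \<and> D i = 2 * d \<and>
      even (a - b) \<and> even (c - d)"
    using iq integral_quad_B[of g h k] assms(1,2) unfolding p_def q_def r_def by metis
  then obtain a b c d where "\<And>i. i < 5 \<longrightarrow> A i = 2 * a i \<and> B i = 2 * b i \<and> C i = 2 * c i \<and>
      D i = 2 * d i \<and> even (a i - b i) \<and> even (c i - d i)" unfolding choice_iff by blast
  then have *: "\<forall>i<5. A i = 2 * a i" "\<forall>i<5. B i = 2 * b i" "\<forall>i<5. C i = 2 * c i"
    "\<forall>i<5. D i = 2 * d i" "\<forall>i<5. even (a i - b i)" "\<forall>i<5. even (c i - d i)" by blast+
  note sc = dot_scaled[OF *(1,1)] dot_scaled[OF *(2,2)] dot_scaled[OF *(3,3)] dot_scaled[OF *(4,4)]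
    dot_scaled[OF *(1,2)] dot_scaled[OF *(1,3)] dot_scaled[OF *(1,4)]
    dot_scaled[OF *(2,3)] dot_scaled[OF *(2,4)] dot_scaled[OF *(3,4)]
  show ?thesis
    by (rule that[of c d a b]) (use *(5,6) eqs in \<open>simp_all add: sc algebra_simps\<close>)
qed

lemma five_squares_C:
  assumes "odd g" "4 dvd q - 1" "4 dvd p - 1" "4 dvd r - 1"
    and "is_sum_of_n_squares OK 5 \<alpha>" "16 * \<alpha> = T + E1 * sq + E2 * sp + E3 * sr"
  obtains a b c d where "\<forall>i<5. quarter_integral (a i) (b i) (c i) (d i)"
    "dot a a + q * dot b b + p * dot c c + r * dot d d = T"
    "2 * (dot a b + g * dot c d) = E1" "2 * (dot a c + h * dot b d) = E2"
    "2 * (dot a d + k * dot b c) = (E3 :: int)"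
proof -
  obtain A B C D where iq: "\<forall>i<5. integral_quad g h k (A i) (B i) (C i) (D i)"
    and eqs: "dot A A + q * dot B B + p * dot C C + r * dot D D = T"
    "2 * (dot A B + g * dot C D) = E1" "2 * (dot A C + h * dot B D) = E2" "2 * (dot A D + k * dot B C) = E3"
    using five_squares[OF assms(5,6)] by metis
  have "quarter_integral (A i) (B i) (C i) (D i)" if "i < 5" for i
    using iq[rule_format, OF that] assms(1-4) unfolding p_def q_def r_def by (intro integral_quad_C)
  then show ?thesis by (intro that[of A B C D]) (use eqs in simp_all)
qed

section \<open>Sums of six squares\<close>

abbreviation f :: real where "f \<equiv> (sp + sr) / 2"

lemma witness_squares:
  "(1 + sq)\<^sup>2 = 1 + 2 * sq + q" "(1 + sp)\<^sup>2 = 1 + 2 * sp + p" "(2 + sp)\<^sup>2 = 4 + 4 * sp + p"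
  "f\<^sup>2 = (p + r + 2 * g * sq) / 4" "(1 + f)\<^sup>2 = 1 + sp + sr + (p + r + 2 * g * sq) / 4"
  "((1 + sq) / 2)\<^sup>2 = (1 + 2 * sq + q) / 4" "((1 + sq) / 2 + 1)\<^sup>2 = (9 + 6 * sq + q) / 4"
  "((1 + sp) / 2)\<^sup>2 = (1 + 2 * sp + p) / 4" "((1 + sp) / 2 + 1)\<^sup>2 = (9 + 6 * sp + p) / 4"
proof -
  have s: "sp\<^sup>2 = p" "sq\<^sup>2 = q" "sr\<^sup>2 = r" "sp * sr = g * sq"
    by (simp_all add: power2_eq_square sqrt_products)
  have ff: "(sp + sr)\<^sup>2 = p + r + 2 * g * sq" using s by (simp add: power2_sum)
  then show "f\<^sup>2 = (p + r + 2 * g * sq) / 4" by (simp add: power_divide)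
  moreover have "(1 + f)\<^sup>2 = 1 + sp + sr + f\<^sup>2" unfolding power2_sum[of 1] by (simp add: field_simps)
  ultimately show "(1 + f)\<^sup>2 = 1 + sp + sr + (p + r + 2 * g * sq) / 4" by simp
  show "(1 + sq)\<^sup>2 = 1 + 2 * sq + q" "(1 + sp)\<^sup>2 = 1 + 2 * sp + p" "(2 + sp)\<^sup>2 = 4 + 4 * sp + p"
    by (simp_all add: power2_sum s)
  have *: "(1 + sq) / 2 + 1 = (3 + sq) / 2" "(1 + sp) / 2 + 1 = (3 + sp) / 2" by simp_all
  show "((1 + sq) / 2)\<^sup>2 = (1 + 2 * sq + q) / 4" "((1 + sq) / 2 + 1)\<^sup>2 = (9 + 6 * sq + q) / 4"
    "((1 + sp) / 2)\<^sup>2 = (1 + 2 * sp + p) / 4" "((1 + sp) / 2 + 1)\<^sup>2 = (9 + 6 * sp + p) / 4"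
    unfolding * power_divide by (simp_all add: power2_sum s)
qed

lemma OK_numeral: "numeral n \<in> OK"
  using OK_intros(1)[of "numeral n"] by simp

lemma pythagoras_A:
  assumes "even g" "4 dvd p - 2" "4 dvd r - 2" "4 dvd q - 3" "k < h"
    and gt: "p \<ge> 6" "r \<ge> p + 4" "q \<ge> 7"
  shows "pythagoras_number OK \<ge> 6"
proof -
  obtain g1 where g: "g = 2 * g1" using \<open>even g\<close> by (rule evenE)
  have "4 dvd p + r" using assms(2,3) by presburger
  with \<open>even g\<close> have f: "f \<in> OK" by (intro half_sum_in_OK) simp
  note mem = OK_intros f OK_numeral
  have p: "p = 2 * (g1 * k)" using g unfolding p_def by simp
  have "odd (g1 * k)" using assms(2) unfolding p four_dvd_double_diff_2 .
  then have odd: "odd g1" "odd k" by simp_all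
  note rep = five_squares_A[OF assms(1-4)]
  note sq = witness_squares power2_eq_square[of "1 :: real"] power2_eq_square[of "2 :: real"]
  have g0: "g1 \<ge> 1" using pos g by simp
  \<comment> \<open>The last alternative meets the bounds of \<open>no_rep_A1\<close>; the first
    three collect the triples with even factor 2, with \<open>p = 6\<close>, or with
    \<open>q = 7\<close>.\<close>
  consider (two) "g1 = 1" | (six) "g1 = 3" "k = 1" | (seven) "q = 7" "g1 \<ge> 5" | (large) "g1 \<ge> 3" "p \<ge> 10" "q \<ge> 10"
  proof -
    have "g1 = 1 \<or> g1 \<ge> 3" using g0 odd(1) by presburger
    moreover have "g1 = 3 \<and> k = 1" if "g1 \<ge> 3" "p < 10"
    proof -
      have k: "k < 2"
      proof (rule ccontr)
        assume "\<not> k < 2"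
        then have "3 * 2 \<le> g1 * k" using that by (intro mult_mono) auto
        with p that show False by simp
      qed
      with pos have "k = 1" by simp
      with p that odd(1) show ?thesis by simp presburger
    qed
    moreover have "q = 7" if "q < 10" using that \<open>q \<ge> 7\<close> assms(4) by presburger
    moreover have "g1 \<ge> 5" if "q = 7" "p \<ge> 10"
    proof -
      have "k < 2"
      proof (rule ccontr)
        assume "\<not> k < 2"
        then have "3 * 3 \<le> h * k" using odd(2) \<open>k < h\<close> by (intro mult_mono) presburger+
        with that show False by (simp add: q_def)
      qed
      with pos have "k = 1" by simp
      with p that show ?thesis by simp
    qed
    ultimately show ?thesis using that by linarith
  qed
  then show ?thesis
  proof cases
    case large
    show ?thesis
    proof (rule pythagoras_number_ge_6[of 1 _ 1 1 2 "1 + sq" "1 + f"])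
      show "\<not> is_sum_of_n_squares OK 5 (1\<^sup>2 + 1\<^sup>2 + 1\<^sup>2 + 2\<^sup>2 + (1 + sq)\<^sup>2 + (1 + f)\<^sup>2)"
      proof
        assume rep5: "is_sum_of_n_squares OK 5 (1\<^sup>2 + 1\<^sup>2 + 1\<^sup>2 + 2\<^sup>2 + (1 + sq)\<^sup>2 + (1 + f)\<^sup>2)"
        have "16 * (1\<^sup>2 + 1\<^sup>2 + 1\<^sup>2 + 2\<^sup>2 + (1 + sq)\<^sup>2 + (1 + f)\<^sup>2) =
            of_int (144 + 16 * q + 4 * p + 4 * r) + of_int (32 + 8 * g) * sq + of_int (16) * sp + of_int (16) * sr"
          unfolding sq by (simp add: field_simps)
        then obtain a b c d where "\<forall>i<5. even (c i - d i)"
          "16 * dot a a + 16 * q * dot b b + 4 * p * dot c c + 4 * r * dot d d = 144 + 16 * q + 4 * p + 4 * r"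
          "32 * dot a b + 8 * g * dot c d = 32 + 8 * g" "16 * (dot a c + h * dot b d) = 16"
          "16 * (dot a d + k * dot b c) = 16"
          by (rule rep[OF rep5])
        then show False using odd(1) large \<open>k < h\<close> gt
          by (intro no_rep_A1[of c d a q b p r g1 h k]) (simp_all add: g)
      qed
    qed (intro mem)+
  next
    case two
    show ?thesis
    proof (rule pythagoras_number_ge_6[of 1 _ 1 1 f "1 + f" "2 + sp"])
      show "\<not> is_sum_of_n_squares OK 5 (1\<^sup>2 + 1\<^sup>2 + 1\<^sup>2 + f\<^sup>2 + (1 + f)\<^sup>2 + (2 + sp)\<^sup>2)"
      proof
        assume rep5: "is_sum_of_n_squares OK 5 (1\<^sup>2 + 1\<^sup>2 + 1\<^sup>2 + f\<^sup>2 + (1 + f)\<^sup>2 + (2 + sp)\<^sup>2)"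
        have "16 * (1\<^sup>2 + 1\<^sup>2 + 1\<^sup>2 + f\<^sup>2 + (1 + f)\<^sup>2 + (2 + sp)\<^sup>2) =
            of_int (128 + 24 * p + 8 * r) + of_int (16 * g) * sq + of_int (80) * sp + of_int (16) * sr"
          unfolding sq by (simp add: field_simps)
        then obtain a b c d where "\<forall>i<5. even (c i - d i)"
          "16 * dot a a + 16 * q * dot b b + 4 * p * dot c c + 4 * r * dot d d = 128 + 24 * p + 8 * r"
          "32 * dot a b + 8 * g * dot c d = 16 * g" "16 * (dot a c + h * dot b d) = 80"
          "16 * (dot a d + k * dot b c) = 16"
          by (rule rep[OF rep5])
        moreover have "q \<ge> p + 9"
        proof -
          have "g = 2" using two g by simp
          then have "p = 2 * k" "r = 2 * h" unfolding p_def r_def by simp_all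
          with gt have k: "k \<ge> 3" "h \<ge> k + 2" by simp_all
          have "(k + 2) * k \<le> h * k" using k by (intro mult_right_mono) auto
          moreover have "3 * 3 \<le> k * k" using k(1) by (intro mult_mono) auto
          ultimately show ?thesis using \<open>p = 2 * k\<close> by (simp add: q_def distrib_right)
        qed
        ultimately show False using two gt
          by (intro no_rep_A2[of c d a q b p r h k]) (simp_all add: g)
      qed
    qed (intro mem)+
  next
    case six
    show ?thesis
    proof (rule pythagoras_number_ge_6[of 1 _ 1 1 f "1 + f" "1 + sp"])
      show "\<not> is_sum_of_n_squares OK 5 (1\<^sup>2 + 1\<^sup>2 + 1\<^sup>2 + f\<^sup>2 + (1 + f)\<^sup>2 + (1 + sp)\<^sup>2)"
      proof
        assume rep5: "is_sum_of_n_squares OK 5 (1\<^sup>2 + 1\<^sup>2 + 1\<^sup>2 + f\<^sup>2 + (1 + f)\<^sup>2 + (1 + sp)\<^sup>2)"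
        have "16 * (1\<^sup>2 + 1\<^sup>2 + 1\<^sup>2 + f\<^sup>2 + (1 + f)\<^sup>2 + (1 + sp)\<^sup>2) =
            of_int (80 + 24 * p + 8 * r) + of_int (16 * g) * sq + of_int (48) * sp + of_int (16) * sr"
          unfolding sq by (simp add: field_simps)
        then obtain a b c d where "\<forall>i<5. even (c i - d i)"
          "16 * dot a a + 16 * q * dot b b + 4 * p * dot c c + 4 * r * dot d d = 80 + 24 * p + 8 * r"
          "32 * dot a b + 8 * g * dot c d = 16 * g" "16 * (dot a c + h * dot b d) = 48"
          "16 * (dot a d + k * dot b c) = 16"
          by (rule rep[OF rep5])
        then show False using six gt
          unfolding p_def q_def r_def
          by (intro no_rep_A3[of c d a h b]) (simp_all add: g)
      qed
    qed (intro mem)+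
  next
    case seven
    have "k < 2"
    proof (rule ccontr)
      assume "\<not> k < 2"
      then have "3 * 3 \<le> h * k" using odd(2) \<open>k < h\<close> by (intro mult_mono) presburger+
      with seven show False by (simp add: q_def)
    qed
    with pos have "k = 1" by simp
    then have hk: "k = 1" "h = 7" using seven unfolding q_def by simp_all
    show ?thesis
    proof (rule pythagoras_number_ge_6[of 1 _ 1 1 f "1 + f" "1 + sq"])
      show "\<not> is_sum_of_n_squares OK 5 (1\<^sup>2 + 1\<^sup>2 + 1\<^sup>2 + f\<^sup>2 + (1 + f)\<^sup>2 + (1 + sq)\<^sup>2)"
      proof
        assume rep5: "is_sum_of_n_squares OK 5 (1\<^sup>2 + 1\<^sup>2 + 1\<^sup>2 + f\<^sup>2 + (1 + f)\<^sup>2 + (1 + sq)\<^sup>2)"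
        have "16 * (1\<^sup>2 + 1\<^sup>2 + 1\<^sup>2 + f\<^sup>2 + (1 + f)\<^sup>2 + (1 + sq)\<^sup>2) =
            of_int (80 + 16 * q + 8 * p + 8 * r) + of_int (32 + 16 * g) * sq + of_int (16) * sp + of_int (16) * sr"
          unfolding sq by (simp add: field_simps)
        then obtain a b c d where "\<forall>i<5. even (c i - d i)"
          "16 * dot a a + 16 * q * dot b b + 4 * p * dot c c + 4 * r * dot d d = 80 + 16 * q + 8 * p + 8 * r"
          "32 * dot a b + 8 * g * dot c d = 32 + 16 * g" "16 * (dot a c + h * dot b d) = 16"
          "16 * (dot a d + k * dot b c) = 16"
          by (rule rep[OF rep5])
        then show False using seven odd
          unfolding p_def q_def r_def
          by (intro no_rep_A4[of c d a b g1]) (simp_all add: g hk)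
      qed
    qed (intro mem)+
  qed
qed

lemma pythagoras_B:
  assumes q4: "4 dvd q - 1" and g4: "even g \<and> 4 dvd p - 2 \<and> 4 dvd r - 2 \<or> odd g \<and> 4 dvd p - 3 \<and> 4 dvd r - 3"
    and "odd k" "h \<ge> k + 4"
    and gt: "p \<ge> 6" "q \<ge> 13" "p = 9 \<Longrightarrow> False" and exc: "\<not> (g = 2 \<and> k = 3 \<and> h = 7)"
    and nine: "\<not> (g = 2 \<and> k = 5 \<and> h = 9)" and hk4: "4 dvd h - k"
  shows "pythagoras_number OK \<ge> 6"
proof -
  have f: "f \<in> OK"
    using g4
  proof
    assume *: "even g \<and> 4 dvd p - 2 \<and> 4 dvd r - 2"
    then have "4 dvd p + r" by presburger
    with * show ?thesis by (intro half_sum_in_OK) simp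
  next
    assume *: "odd g \<and> 4 dvd p - 3 \<and> 4 dvd r - 3"
    then have "4 dvd p + r - 2" by presburger
    with * q4 show ?thesis by (intro half_sum_in_OK) simp
  qed
  note mem = OK_intros f OK_numeral half_one_plus_sq_in_OK q4
  note rep = five_squares_B[OF q4 g4]
  note sq = witness_squares power2_eq_square[of "1 :: real"] power2_eq_square[of "2 :: real"]
  have k: "k = 1 \<or> k = 3 \<or> k \<ge> 5" using \<open>odd k\<close> pos by presburger
  have g: "g = 1 \<or> g = 2 \<or> g = 3 \<or> g \<ge> 4" using pos by linarith
  consider (k1) "k = 1" | (g1) "g = 1" "k \<ge> 2" | (small) "g = 2" "k = 3"
    | (large) "g \<ge> 2" "k \<ge> 2" "g = 2 \<Longrightarrow> k \<noteq> 3" "p \<ge> 10" "p + r \<ge> 34"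
  proof -
    have "p \<ge> 10 \<and> p + r \<ge> 34" if gk: "g \<ge> 2" "k \<ge> 3" "\<not> (g = 2 \<and> k = 3)"
    proof -
      from gk k g consider "g = 2" "k \<ge> 5" | "g = 3" "k \<ge> 5" | "g \<ge> 4" "k \<ge> 3"
        using gt(3) unfolding p_def by auto
      then show ?thesis
      proof cases
        case 1
        then have "k = 5 \<or> k \<ge> 7" using \<open>odd k\<close> by presburger
        then show ?thesis
        proof
          assume "k = 5"
          \<comment> \<open>The value \<open>h = 9\<close> would give \<open>p + r\<close> = 10 +
            18, short of 34, which is the origin of the hypothesis \<open>nine\<close>. The next
            \<open>h\<close> congruent to 5 modulo 4 is 13.\<close>
          with hk4 \<open>h \<ge> k + 4\<close> nine 1 have "h \<ge> 13" by presburger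
          with 1 \<open>k = 5\<close> show ?thesis unfolding p_def r_def by simp
        next
          assume "k \<ge> 7"
          with 1 \<open>h \<ge> k + 4\<close> show ?thesis unfolding p_def r_def by simp
        qed
      next
        case 2
        with \<open>h \<ge> k + 4\<close> show ?thesis unfolding p_def r_def by simp
      next
        case 3
        then have "4 * 3 \<le> g * k" "4 * 7 \<le> g * h" using \<open>h \<ge> k + 4\<close> by (intro mult_mono; simp)+
        then show ?thesis unfolding p_def r_def by simp
      qed
    qed
    then show ?thesis using that k g by linarith
  qed
  then show ?thesis
  proof cases
    case k1
    show ?thesis
    proof (rule pythagoras_number_ge_6[of 1 _ 1 1 "(1 + sq) / 2" "(1 + sq) / 2 + 1" "1 + sp"])
      show "\<not> is_sum_of_n_squares OK 5
        (1\<^sup>2 + 1\<^sup>2 + 1\<^sup>2 + ((1 + sq) / 2)\<^sup>2 + ((1 + sq) / 2 + 1)\<^sup>2 + (1 + sp)\<^sup>2)"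
      proof
        assume rep5: "is_sum_of_n_squares OK 5
          (1\<^sup>2 + 1\<^sup>2 + 1\<^sup>2 + ((1 + sq) / 2)\<^sup>2 + ((1 + sq) / 2 + 1)\<^sup>2 + (1 + sp)\<^sup>2)"
        have "16 * (1\<^sup>2 + 1\<^sup>2 + 1\<^sup>2 + ((1 + sq) / 2)\<^sup>2 + ((1 + sq) / 2 + 1)\<^sup>2 + (1 + sp)\<^sup>2) =
            of_int (104 + 8 * q + 16 * p) + of_int (32) * sq + of_int (32) * sp + of_int (0) * sr"
          unfolding sq by (simp add: field_simps)
        then obtain a b c d where "\<forall>i<5. even (c i - d i)" "\<forall>i<5. even (a i - b i)"
          "4 * dot a a + 4 * q * dot b b + 4 * p * dot c c + 4 * r * dot d d = 104 + 8 * q + 16 * p"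
          "8 * (dot a b + g * dot c d) = 32" "8 * (dot a c + h * dot b d) = 32"
          "8 * (dot a d + k * dot b c) = 0"
          by (rule rep[OF rep5])
        then show False using k1 gt
          unfolding p_def q_def r_def
          by (intro no_rep_B4[of c d a b "h * k" "g * k"]) (simp_all)
      qed
    qed (intro mem)+
  next
    case g1
    show ?thesis
    proof (rule pythagoras_number_ge_6[of 1 _ 1 1 f "1 + f" "2 + sp"])
      show "\<not> is_sum_of_n_squares OK 5 (1\<^sup>2 + 1\<^sup>2 + 1\<^sup>2 + f\<^sup>2 + (1 + f)\<^sup>2 + (2 + sp)\<^sup>2)"
      proof
        assume rep5: "is_sum_of_n_squares OK 5 (1\<^sup>2 + 1\<^sup>2 + 1\<^sup>2 + f\<^sup>2 + (1 + f)\<^sup>2 + (2 + sp)\<^sup>2)"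
        have "16 * (1\<^sup>2 + 1\<^sup>2 + 1\<^sup>2 + f\<^sup>2 + (1 + f)\<^sup>2 + (2 + sp)\<^sup>2) =
            of_int (128 + 24 * p + 8 * r) + of_int (16 * g) * sq + of_int (80) * sp + of_int (16) * sr"
          unfolding sq by (simp add: field_simps)
        then obtain a b c d where "\<forall>i<5. even (c i - d i)" "\<forall>i<5. even (a i - b i)"
          "4 * dot a a + 4 * q * dot b b + 4 * p * dot c c + 4 * r * dot d d = 128 + 24 * p + 8 * r"
          "8 * (dot a b + g * dot c d) = 16 * g" "8 * (dot a c + h * dot b d) = 80"
          "8 * (dot a d + k * dot b c) = 16"
          by (rule rep[OF rep5])
        moreover have "k \<ge> 7"
        proof -
          have "p = k" using g1 unfolding p_def by simp
          with gt(1) g1 g4 have "k \<ge> 6" "4 dvd k - 3" by simp_all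
          then show ?thesis by presburger
        qed
        ultimately show False using g1 \<open>h \<ge> k + 4\<close>
          unfolding p_def q_def r_def
          by (intro no_rep_B3[of c d a b h k]) (simp_all)
      qed
    qed (intro mem)+
  next
    case small
    show ?thesis
    proof (rule pythagoras_number_ge_6[of 1 _ 1 1 f "1 + f" "1 + sp"])
      show "\<not> is_sum_of_n_squares OK 5 (1\<^sup>2 + 1\<^sup>2 + 1\<^sup>2 + f\<^sup>2 + (1 + f)\<^sup>2 + (1 + sp)\<^sup>2)"
      proof
        assume rep5: "is_sum_of_n_squares OK 5 (1\<^sup>2 + 1\<^sup>2 + 1\<^sup>2 + f\<^sup>2 + (1 + f)\<^sup>2 + (1 + sp)\<^sup>2)"
        have "16 * (1\<^sup>2 + 1\<^sup>2 + 1\<^sup>2 + f\<^sup>2 + (1 + f)\<^sup>2 + (1 + sp)\<^sup>2) =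
            of_int (80 + 24 * p + 8 * r) + of_int (16 * g) * sq + of_int (48) * sp + of_int (16) * sr"
          unfolding sq by (simp add: field_simps)
        then obtain a b c d where "\<forall>i<5. even (c i - d i)" "\<forall>i<5. even (a i - b i)"
          "4 * dot a a + 4 * q * dot b b + 4 * p * dot c c + 4 * r * dot d d = 80 + 24 * p + 8 * r"
          "8 * (dot a b + g * dot c d) = 16 * g" "8 * (dot a c + h * dot b d) = 48"
          "8 * (dot a d + k * dot b c) = 16"
          by (rule rep[OF rep5])
        \<comment> \<open>For \<open>g = 2\<close>, \<open>k = 3\<close> the smallest possible
          \<open>h\<close> is 7, and this is the exceptional triple.\<close>
        moreover have "h \<ge> 11" "odd h" using small \<open>h \<ge> k + 4\<close> exc hk4 by presburger+
        ultimately show False using small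
          unfolding p_def q_def r_def
          by (intro no_rep_B2[of c d a b h]) (simp_all)
      qed
    qed (intro mem)+
  next
    case large
    show ?thesis
    proof (rule pythagoras_number_ge_6[of 1 _ 1 1 2 "(1 + sq) / 2" "1 + f"])
      show "\<not> is_sum_of_n_squares OK 5 (1\<^sup>2 + 1\<^sup>2 + 1\<^sup>2 + 2\<^sup>2 + ((1 + sq) / 2)\<^sup>2 + (1 + f)\<^sup>2)"
      proof
        assume rep5: "is_sum_of_n_squares OK 5 (1\<^sup>2 + 1\<^sup>2 + 1\<^sup>2 + 2\<^sup>2 + ((1 + sq) / 2)\<^sup>2 + (1 + f)\<^sup>2)"
        have "16 * (1\<^sup>2 + 1\<^sup>2 + 1\<^sup>2 + 2\<^sup>2 + ((1 + sq) / 2)\<^sup>2 + (1 + f)\<^sup>2) =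
            of_int (132 + 4 * q + 4 * p + 4 * r) + of_int (8 + 8 * g) * sq + of_int (16) * sp + of_int (16) * sr"
          unfolding sq by (simp add: field_simps)
        then obtain a b c d where "\<forall>i<5. even (c i - d i)" "\<forall>i<5. even (a i - b i)"
          "4 * dot a a + 4 * q * dot b b + 4 * p * dot c c + 4 * r * dot d d = 132 + 4 * q + 4 * p + 4 * r"
          "8 * (dot a b + g * dot c d) = 8 + 8 * g" "8 * (dot a c + h * dot b d) = 16"
          "8 * (dot a d + k * dot b c) = 16"
          by (rule rep[OF rep5])
        moreover have "7 * 3 \<le> h * k" using k large \<open>h \<ge> k + 4\<close> by (intro mult_mono) auto
        moreover have "g * k \<le> g * h" using \<open>h \<ge> k + 4\<close> pos by (intro mult_left_mono) auto
        then have "10 \<le> g * h" using large unfolding p_def by linarith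
        ultimately show False using large \<open>h \<ge> k + 4\<close>
          unfolding p_def q_def r_def
          by (intro no_rep_B1[of c d a b "h * k" "g * k" "g * h" g h k]) (simp_all)
      qed
    qed (intro mem)+
  qed
qed

lemma pythagoras_C:
  assumes odd: "odd g" "odd k" and c4: "4 dvd q - 1" "4 dvd p - 1" "4 dvd r - 1"
    and ghk: "g \<ge> k + 4" "h \<ge> g + 4" "4 dvd g - k" "4 dvd h - k" and p: "p \<ge> 13" 
  shows "pythagoras_number OK \<ge> 6"
proof -
  note mem = OK_intros OK_numeral half_one_plus_sq_in_OK half_one_plus_sp_in_OK c4
  note rep = five_squares_C[OF odd(1) c4]
  note sq = witness_squares power2_eq_square[of "1 :: real"] power2_eq_square[of "2 :: real"]
  have "k = 1 \<or> k \<ge> 3" using \<open>odd k\<close> pos by presburger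
  moreover have "p = 13 \<or> p \<ge> 17" using p c4 by presburger
  ultimately consider (k3) "k \<ge> 3" | (k1) "k = 1" "p \<ge> 17" | (p13) "k = 1" "p = 13" by blast
  then show ?thesis
  proof cases
    case k3
    show ?thesis
    proof (rule pythagoras_number_ge_6[of 1 _ 1 1 2 "(1 + sq) / 2" "(1 + sp) / 2 + 1"])
      show "\<not> is_sum_of_n_squares OK 5 (1\<^sup>2 + 1\<^sup>2 + 1\<^sup>2 + 2\<^sup>2 + ((1 + sq) / 2)\<^sup>2 + ((1 + sp) / 2 + 1)\<^sup>2)"
      proof
        assume rep5: "is_sum_of_n_squares OK 5 (1\<^sup>2 + 1\<^sup>2 + 1\<^sup>2 + 2\<^sup>2 + ((1 + sq) / 2)\<^sup>2 + ((1 + sp) / 2 + 1)\<^sup>2)"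
        have "16 * (1\<^sup>2 + 1\<^sup>2 + 1\<^sup>2 + 2\<^sup>2 + ((1 + sq) / 2)\<^sup>2 + ((1 + sp) / 2 + 1)\<^sup>2) =
            of_int (152 + 4 * p + 4 * q) + of_int (8) * sq + of_int (24) * sp + of_int (0) * sr"
          unfolding sq by (simp add: field_simps)
        then obtain a b c d where "\<forall>i<5. quarter_integral (a i) (b i) (c i) (d i)"
          "dot a a + q * dot b b + p * dot c c + r * dot d d = 152 + 4 * p + 4 * q"
          "2 * (dot a b + g * dot c d) = 8" "2 * (dot a c + h * dot b d) = 24"
          "2 * (dot a d + k * dot b c) = 0"
          by (rule rep[OF rep5])
        then show False using k3 ghk odd
          unfolding p_def q_def r_def
          by (intro no_rep_C2[of a b c d "h * k" "g * k" "g * h" g h k]) (simp_all)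
      qed
    qed (intro mem)+
  next
    case k1
    show ?thesis
    proof (rule pythagoras_number_ge_6[of 1 _ 1 1 2 "(1 + sq) / 2" "(1 + sp) / 2"])
      show "\<not> is_sum_of_n_squares OK 5 (1\<^sup>2 + 1\<^sup>2 + 1\<^sup>2 + 2\<^sup>2 + ((1 + sq) / 2)\<^sup>2 + ((1 + sp) / 2)\<^sup>2)"
      proof
        assume rep5: "is_sum_of_n_squares OK 5 (1\<^sup>2 + 1\<^sup>2 + 1\<^sup>2 + 2\<^sup>2 + ((1 + sq) / 2)\<^sup>2 + ((1 + sp) / 2)\<^sup>2)"
        have "16 * (1\<^sup>2 + 1\<^sup>2 + 1\<^sup>2 + 2\<^sup>2 + ((1 + sq) / 2)\<^sup>2 + ((1 + sp) / 2)\<^sup>2) =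
            of_int (120 + 4 * p + 4 * q) + of_int (8) * sq + of_int (8) * sp + of_int (0) * sr"
          unfolding sq by (simp add: field_simps)
        then obtain a b c d where "\<forall>i<5. quarter_integral (a i) (b i) (c i) (d i)"
          "dot a a + q * dot b b + p * dot c c + r * dot d d = 120 + 4 * p + 4 * q"
          "2 * (dot a b + g * dot c d) = 8" "2 * (dot a c + h * dot b d) = 8"
          "2 * (dot a d + k * dot b c) = 0"
          by (rule rep[OF rep5])
        then show False using k1 ghk c4
          unfolding p_def q_def r_def
          by (intro no_rep_C1[of a b c d "h * k" "g * k"]) (simp_all)
      qed
    qed (intro mem)+
  next
    case p13
    show ?thesis
    proof (rule pythagoras_number_ge_6[of 1 _ 1 1 "(1 + sq) / 2" "(1 + sq) / 2 + 1" "(1 + sp) / 2"])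
      show "\<not> is_sum_of_n_squares OK 5
        (1\<^sup>2 + 1\<^sup>2 + 1\<^sup>2 + ((1 + sq) / 2)\<^sup>2 + ((1 + sq) / 2 + 1)\<^sup>2 + ((1 + sp) / 2)\<^sup>2)"
      proof
        assume rep5: "is_sum_of_n_squares OK 5
          (1\<^sup>2 + 1\<^sup>2 + 1\<^sup>2 + ((1 + sq) / 2)\<^sup>2 + ((1 + sq) / 2 + 1)\<^sup>2 + ((1 + sp) / 2)\<^sup>2)"
        have "16 * (1\<^sup>2 + 1\<^sup>2 + 1\<^sup>2 + ((1 + sq) / 2)\<^sup>2 + ((1 + sq) / 2 + 1)\<^sup>2 + ((1 + sp) / 2)\<^sup>2) =
            of_int (92 + 8 * q + 4 * p) + of_int (32) * sq + of_int (8) * sp + of_int (0) * sr"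
          unfolding sq by (simp add: field_simps)
        then obtain a b c d where "\<forall>i<5. quarter_integral (a i) (b i) (c i) (d i)"
          "dot a a + q * dot b b + p * dot c c + r * dot d d = 92 + 8 * q + 4 * p"
          "2 * (dot a b + g * dot c d) = 32" "2 * (dot a c + h * dot b d) = 8"
          "2 * (dot a d + k * dot b c) = 0"
          by (rule rep[OF rep5])
        moreover have "g = 13" using p13 unfolding p_def by simp
        ultimately show False using p13 ghk c4
          unfolding p_def q_def r_def
          by (intro no_rep_C3[of a b c d "h * k"]) (simp_all)
      qed
    qed (intro mem)+
  qed
qed

end

section \<open>Symmetry in the three factors and distribution over the cases\<close>

text \<open>Exchanging \<open>g\<close> and \<open>h\<close> fixes \<open>r\<close> and swaps
  \<open>p\<close>, \<open>q\<close>; exchanging \<open>h\<close> and \<open>k\<close> fixes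
  \<open>q\<close> and swaps \<open>p\<close>, \<open>r\<close>. These two transpositions generate
  all permutations.\<close>

lemma biquadratic_K_perm:
  assumes "biquadratic g h k"
  shows "biquadratic.K h g k = biquadratic.K g h k" "biquadratic.K g k h = biquadratic.K g h k"
proof -
  interpret biquadratic g h k by fact
  interpret S: biquadratic h g k by (rule biquadratic_perm(1)[OF assms])
  interpret T: biquadratic g k h by (rule biquadratic_perm(3)[OF assms])
  have S: "S.sp = sq" "S.sq = sp" "S.sr = sr"
    by (simp_all add: S.sp_def S.sq_def S.sr_def sp_def sq_def sr_def S.p_def S.q_def S.r_def
        p_def q_def r_def mult.commute)
  have T: "T.sp = sr" "T.sq = sq" "T.sr = sp"
    by (simp_all add: T.sp_def T.sq_def T.sr_def sp_def sq_def sr_def T.p_def T.q_def T.r_def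
        p_def q_def r_def mult.commute)
  have "x \<in> S.K \<longleftrightarrow> x \<in> K" for x
  proof -
    have "a + b * sp + c * sq + d * sr = a + c * sq + b * sp + d * sr" for a b c d :: real by simp
    then show ?thesis unfolding S.K_def K_def S by (auto; metis)
  qed
  moreover have "x \<in> T.K \<longleftrightarrow> x \<in> K" for x
  proof -
    have "a + b * sq + c * sr + d * sp = a + b * sq + d * sp + c * sr" for a b c d :: real by simp
    then show ?thesis unfolding T.K_def K_def T by (auto; metis)
  qed
  ultimately show "S.K = K" "T.K = K" by blast+
qed

text \<open>Reordering the factors as 3, 7, 2 makes 6 and 14 the two radicands that generate the
  field.\<close>

lemma biquadratic_exceptional:
  assumes "biquadratic 2 7 3"
  shows "biquadratic.K 2 7 3 = rat_adjoin {sqrt 6, sqrt 14}"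
proof -
  interpret T: biquadratic 3 7 2 by (rule biquadratic_perm(5)[OF assms])
  have "biquadratic 7 2 3" "biquadratic 7 3 2" using assms biquadratic_perm by blast+
  have "T.K = biquadratic.K 7 3 2" using biquadratic_K_perm(1) T.biquadratic_axioms by metis
  also have "\<dots> = biquadratic.K 7 2 3"
    using biquadratic_K_perm(2)[OF \<open>biquadratic 7 3 2\<close>] by simp
  also have "\<dots> = biquadratic.K 2 7 3" using biquadratic_K_perm(1)[OF assms] .
  finally show ?thesis using T.rat_adjoin_eq_K
    by (simp add: T.sp_def T.sq_def T.p_def T.q_def)
qed

text \<open>This bundles the hypotheses of the theorem in a form symmetric in \<open>g\<close>,
  \<open>h\<close>, \<open>k\<close>, so that the factors may be ordered at will. The absence of the
  roots of 2, 3, 5 becomes a condition on the three radicands.\<close>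

definition admissible :: "int \<Rightarrow> int \<Rightarrow> int \<Rightarrow> bool" where
  "admissible g h k \<longleftrightarrow> biquadratic g h k \<and> g * h \<notin> {2, 3, 5} \<and> g * k \<notin> {2, 3, 5} \<and> h * k \<notin> {2, 3, 5} \<and>
     biquadratic.K g h k \<noteq> rat_adjoin {sqrt 6, sqrt 14}"

lemma admissible_swap:
  assumes "admissible g h k"
  shows "admissible h g k" "admissible g k h"
  using assms biquadratic_perm[of g h k] biquadratic_K_perm[of g h k]
  unfolding admissible_def by (simp_all add: mult.commute)

lemma squarefree_square_dvdD: "x * x dvd n \<Longrightarrow> squarefree n \<Longrightarrow> \<bar>x :: int\<bar> = 1"
  unfolding squarefree_def by (metis power2_eq_square zdvd1_eq)

lemma (in biquadratic) products_not_4_9_dvd: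
  "\<not> 4 dvd g * h" "\<not> 4 dvd g * k" "\<not> 4 dvd h * k" "\<not> 9 dvd g * h" "\<not> 9 dvd g * k" "\<not> 9 dvd h * k"
proof -
  have "\<not> 2 * 2 dvd n \<and> \<not> 3 * 3 dvd n" if "squarefree n" for n :: int
    using squarefree_square_dvdD[OF _ that, of 2] squarefree_square_dvdD[OF _ that, of 3] by auto
  from this[OF squarefree_pqr(1)] this[OF squarefree_pqr(2)] this[OF squarefree_pqr(3)]
  show "\<not> 4 dvd g * h" "\<not> 4 dvd g * k" "\<not> 4 dvd h * k" "\<not> 9 dvd g * h" "\<not> 9 dvd g * k" "\<not> 9 dvd h * k"
    unfolding p_def q_def r_def by simp_all
qed

lemma odd_product_mod4:
  fixes x y :: int
  assumes "odd x" "odd y"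
  shows "4 dvd x - y \<Longrightarrow> 4 dvd x * y - 1" "\<not> 4 dvd x - y \<Longrightarrow> 4 dvd x * y - 3"
proof -
  obtain m n where mn: "x = 2 * m + 1" "y = 2 * n + 1" using assms by (meson oddE)
  have xy: "x * y - 1 = 4 * (m * n) + 2 * (m + n)" "x * y - 3 = 4 * (m * n) + 2 * (m + n - 1)"
    unfolding mn by (simp_all add: algebra_simps)
  show "4 dvd x * y - 1" if "4 dvd x - y"
  proof -
    have "4 dvd 2 * (m + n)" using that unfolding mn by presburger
    then show ?thesis unfolding xy by simp
  qed
  show "4 dvd x * y - 3" if "\<not> 4 dvd x - y"
  proof -
    have "4 dvd 2 * (m + n - 1)" using that unfolding mn by presburger
    then show ?thesis unfolding xy by simp
  qed
qed

text \<open>The other factors are odd and \<open>p\<close>, \<open>r\<close> are twice odd numbers;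
  whether \<open>h\<close> and \<open>k\<close> agree modulo 4 decides between cases B and
  A.\<close>

lemma pythagoras_one_even:
  assumes adm: "admissible g h k" and "even g" "k < h"
  shows "pythagoras_number (ring_of_integers (biquadratic.K g h k)) \<ge> 6"
proof -
  interpret biquadratic g h k using adm by (simp add: admissible_def)
  obtain g1 where g: "g = 2 * g1" using \<open>even g\<close> by (rule evenE)
  have hk: "odd h" "odd k" and "odd g1"
    using products_not_4_9_dvd unfolding g by (auto elim!: evenE)
  have p: "p = 2 * (g1 * k)" "r = 2 * (g1 * h)" using g unfolding p_def r_def by simp_all
  have "odd (g1 * k)" "odd (g1 * h)" using hk \<open>odd g1\<close> by simp_all
  then have d: "4 dvd p - 2" "4 dvd r - 2" unfolding p four_dvd_double_diff_2 by simp_all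
  have g2: "g \<ge> 2" using g pos by simp
  have "p \<notin> {2, 3, 5}" "q \<notin> {2, 3, 5}" using adm by (auto simp: admissible_def p_def q_def)
  with pqr_gt_1 d have p6: "p \<ge> 6" by auto presburger
  have h2: "h \<ge> k + 2" using hk \<open>k < h\<close> by presburger
  show ?thesis
  proof (cases "4 dvd h - k")
    case True
    then have q4: "4 dvd q - 1" unfolding q_def using hk by (intro odd_product_mod4)
    have "\<not> 9 dvd q" using products_not_4_9_dvd by (simp add: q_def)
    with q4 pqr_gt_1 \<open>q \<notin> _\<close> have "q \<ge> 13"
      by auto presburger
    moreover have "h \<ge> k + 4" using True \<open>k < h\<close> by presburger
    moreover have "\<not> (g = 2 \<and> k = 3 \<and> h = 7)"
      using adm biquadratic_exceptional by (auto simp: admissible_def)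
    moreover have "\<not> (g = 2 \<and> k = 5 \<and> h = 9)" using products_not_4_9_dvd by auto
    moreover have "p \<noteq> 9" using d by auto
    ultimately show ?thesis using True q4 d \<open>even g\<close> hk p6
      by (intro pythagoras_B) simp_all
  next
    case False
    then have q4: "4 dvd q - 3" unfolding q_def using hk by (intro odd_product_mod4)
    with pqr_gt_1 \<open>q \<notin> _\<close> have "q \<ge> 7" by auto presburger
    moreover have "g * k + 2 * 2 \<le> g * h"
    proof -
      have "2 * 2 \<le> g * (h - k)" using g2 h2 by (intro mult_mono) auto
      then show ?thesis by (simp add: right_diff_distrib)
    qed
    then have "r \<ge> p + 4" by (simp add: p_def r_def)
    ultimately show ?thesis using q4 d \<open>even g\<close> \<open>k < h\<close> p6 by (intro pythagoras_A)
  qed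
qed

lemma pythagoras_two_congruent:
  assumes adm: "admissible g h k" and odd: "odd g" "odd h" "odd k"
    and hk: "4 dvd h - k" "\<not> 4 dvd g - k" "k < h"
  shows "pythagoras_number (ring_of_integers (biquadratic.K g h k)) \<ge> 6"
proof -
  interpret biquadratic g h k using adm by (simp add: admissible_def)
  have "\<not> 4 dvd g - h" using hk by presburger
  then have d: "4 dvd q - 1" "4 dvd p - 3" "4 dvd r - 3"
    unfolding p_def q_def r_def using odd hk by (auto intro!: odd_product_mod4)
  have "p \<notin> {2, 3, 5}" "q \<notin> {2, 3, 5}" using adm by (auto simp: admissible_def p_def q_def)
  moreover have "\<not> 9 dvd q" using products_not_4_9_dvd by (simp add: q_def)
  ultimately have "p \<ge> 6" "q \<ge> 13" "p \<noteq> 9" using d pqr_gt_1 by (auto; presburger)+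
  moreover have "h \<ge> k + 4" using hk by presburger
  ultimately show ?thesis using d odd hk by (intro pythagoras_B) auto
qed

lemma pythagoras_all_congruent:
  assumes adm: "admissible g h k" and odd: "odd g" "odd h" "odd k"
    and hk: "4 dvd h - k" "4 dvd g - k" "k < g" "g < h"
  shows "pythagoras_number (ring_of_integers (biquadratic.K g h k)) \<ge> 6"
proof -
  interpret biquadratic g h k using adm by (simp add: admissible_def)
  have "4 dvd g - h" using hk by presburger
  then have d: "4 dvd q - 1" "4 dvd p - 1" "4 dvd r - 1"
    unfolding p_def q_def r_def using odd hk by (auto intro!: odd_product_mod4)
  have "p \<notin> {2, 3, 5}" using adm by (auto simp: admissible_def p_def)
  moreover have "\<not> 9 dvd p" using products_not_4_9_dvd by (simp add: p_def)
  ultimately have "p \<ge> 13" using d pqr_gt_1 by (auto; presburger)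
  moreover have "g \<ge> k + 4" "h \<ge> g + 4" using hk by presburger+
  ultimately show ?thesis using d odd hk by (intro pythagoras_C)
qed

text \<open>Either some factor is even, or all are odd; in the latter situation at least two agree
  modulo 4, since there are only two odd classes. Symmetry moves the distinguished factor to the
  first place and sorts the others.\<close>

lemma pythagoras_admissible:
  assumes "admissible g h k"
  shows "pythagoras_number (ring_of_integers (biquadratic.K g h k)) \<ge> 6"
proof -
  interpret biquadratic g h k using assms by (simp add: admissible_def)
  have perms: "admissible g h k" "admissible g k h" "admissible h g k" "admissible h k g"
    "admissible k g h" "admissible k h g"
    using assms admissible_swap by blast+
  have bq: "biquadratic g h k" "biquadratic g k h" "biquadratic h g k" "biquadratic h k g"
    using perms by (simp_all add: admissible_def)
  \<comment> \<open>These equations identify the fields of all reordered triples with the field of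
    \<open>g\<close>, \<open>h\<close>, \<open>k\<close>.\<close>
  note K1 = biquadratic_K_perm(1)[OF bq(1)] biquadratic_K_perm(2)[OF bq(1)]
  note K2 = trans[OF biquadratic_K_perm(1)[OF bq(2)] K1(2)] trans[OF biquadratic_K_perm(2)[OF bq(3)] K1(1)]
  note Ks = K1 K2 trans[OF biquadratic_K_perm(1)[OF bq(4)] K2(2)]
  have unit: "x = 1" if "x * x dvd g * h * k" "x > 0" for x
    using squarefree_square_dvdD[OF that(1) squarefree] that(2) by simp
  have neq: "g \<noteq> h" "g \<noteq> k" "h \<noteq> k"
    using unit[of g] unit[of h] unit[of k] pos nontrivial by (auto simp: mult_ac)
  note even = pythagoras_one_even[OF perms(1)] pythagoras_one_even[OF perms(2)] pythagoras_one_even[OF perms(3)]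
    pythagoras_one_even[OF perms(4)] pythagoras_one_even[OF perms(5)] pythagoras_one_even[OF perms(6)]
  note two = pythagoras_two_congruent[OF perms(1)] pythagoras_two_congruent[OF perms(2)]
    pythagoras_two_congruent[OF perms(3)] pythagoras_two_congruent[OF perms(4)]
    pythagoras_two_congruent[OF perms(5)] pythagoras_two_congruent[OF perms(6)]
  note all = pythagoras_all_congruent[OF perms(1)] pythagoras_all_congruent[OF perms(2)]
    pythagoras_all_congruent[OF perms(3)] pythagoras_all_congruent[OF perms(4)]
    pythagoras_all_congruent[OF perms(5)] pythagoras_all_congruent[OF perms(6)]
  show ?thesis
  proof (cases "even g \<or> even h \<or> even k")
    case True
    then show ?thesis using even neq unfolding Ks by (meson linorder_neqE)
  next
    case False
    then have odd: "odd g" "odd h" "odd k" by simp_all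
    note two = two[unfolded Ks, simplified odd, simplified]
    note all = all[unfolded Ks, simplified odd, simplified]
    have "4 dvd g - h \<and> 4 dvd g - k \<and> 4 dvd h - k \<or> 4 dvd g - h \<and> \<not> 4 dvd g - k \<and> \<not> 4 dvd h - k \<or>
      4 dvd g - k \<and> \<not> 4 dvd g - h \<and> \<not> 4 dvd h - k \<or> 4 dvd h - k \<and> \<not> 4 dvd g - h \<and> \<not> 4 dvd g - k"
      using odd by presburger
    then consider "4 dvd g - h" "4 dvd g - k" "4 dvd h - k" | "4 dvd g - h" "\<not> 4 dvd g - k" "\<not> 4 dvd h - k"
      | "4 dvd g - k" "\<not> 4 dvd g - h" "\<not> 4 dvd h - k" | "4 dvd h - k" "\<not> 4 dvd g - h" "\<not> 4 dvd g - k"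
      by blast
    then show ?thesis
    proof cases
      case 1
      then have "4 dvd h - g" "4 dvd k - g" "4 dvd k - h" by presburger+
      with 1 all neq show ?thesis by (meson linorder_neqE)
    next
      case 2
      then have "4 dvd h - g" "\<not> 4 dvd k - g" "\<not> 4 dvd k - h" by presburger+
      with 2 two neq show ?thesis by (meson linorder_neqE)
    next
      case 3
      then have "\<not> 4 dvd h - g" "4 dvd k - g" "\<not> 4 dvd k - h" by presburger+
      with 3 two neq show ?thesis by (meson linorder_neqE)
    next
      case 4
      then have "\<not> 4 dvd h - g" "\<not> 4 dvd k - g" "4 dvd k - h" by presburger+
      with 4 two neq show ?thesis by (meson linorder_neqE)
    qed
  qed
qed

lemma coprime_if_squarefree_mult:
  assumes "squarefree (x * y :: int)"
  shows "coprime x y"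
proof -
  have "gcd x y * gcd x y dvd x * y" by (intro mult_dvd_mono) auto
  from squarefree_square_dvdD[OF this assms] show ?thesis by (simp add: coprime_iff_gcd_eq_1)
qed

theorem theorem2p1:
  fixes K :: "real set"
  assumes "totally_real_biquadratic K"
    and "sqrt 2 \<notin> K" and "sqrt 3 \<notin> K" and "sqrt 5 \<notin> K"
    and "K \<noteq> rat_adjoin {sqrt 6, sqrt 14}"
  shows "pythagoras_number (ring_of_integers K) \<ge> 6"
proof -
  obtain P Q :: int where PQ: "P > 1" "Q > 1" "P \<noteq> Q" "squarefree P" "squarefree Q"
    "K = rat_adjoin {sqrt (of_int P), sqrt (of_int Q)}"
    using assms(1) unfolding totally_real_biquadratic_def by blast
  \<comment> \<open>The third radicand is the product of \<open>P\<close> and \<open>Q\<close>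
    divided by the square of their gcd; splitting off the gcd therefore gives the symmetric
    triple.\<close>
  define k where "k = gcd P Q"
  have "k > 0" using PQ by (simp add: k_def)
  have "gcd P Q \<noteq> 0" using PQ by simp
  from gcd_coprime_exists[OF this] obtain g h where gh: "P = g * k" "Q = h * k" "coprime g h"
    unfolding k_def by blast
  have pos: "g > 0" "h > 0"
    using zero_less_mult_pos2[of g k] zero_less_mult_pos2[of h k] PQ(1,2) \<open>k > 0\<close> by (simp_all add: gh)
  have cop: "coprime g k" "coprime h k"
    using coprime_if_squarefree_mult PQ(4,5) unfolding gh by blast+
  have "squarefree g" "squarefree (h * k)" using PQ(4,5) unfolding gh by (blast dest: squarefree_multD)+
  moreover have "coprime g (h * k)" using gh(3) cop by simp
  ultimately have "squarefree (g * (h * k))" using squarefree_mult_coprime by blast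
  moreover have "g * h \<noteq> 1"
  proof
    assume "g * h = 1"
    then have "g = 1" "h = 1" using pos by (auto simp: zmult_eq_1_iff)
    with gh PQ(3) show False by simp
  qed
  ultimately have bq: "biquadratic g h k"
    using pos \<open>k > 0\<close> PQ(1,2) unfolding gh biquadratic_def by (simp add: mult.assoc)
  then interpret B: biquadratic g h k .
  have K: "K = B.K"
    using B.rat_adjoin_eq_K PQ(6) by (simp add: B.sp_def B.sq_def B.p_def B.q_def gh)
  have *: "n \<notin> {2, 3, 5}" if "sqrt (of_int n) \<in> B.K" for n :: int
    using that assms(2-4) unfolding K by auto
  have "g * k \<notin> {2, 3, 5}" "h * k \<notin> {2, 3, 5}" "g * h \<notin> {2, 3, 5}"
    using *[of "g * k"] *[of "h * k"] *[of "g * h"] B.sqrt_in_K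
    unfolding B.sp_def B.sq_def B.sr_def B.p_def B.q_def B.r_def by blast+
  with bq assms(5) have "admissible g h k" unfolding admissible_def K by blast
  then show ?thesis unfolding K by (rule pythagoras_admissible)
qed

end
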